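(* If $q\neq\pi^n$ for all integers $n$, then the map taking $f\in\mathscr{A}'$ to $\log([p^r](\phi(f)(x)))$ is an injection of the $\mathbb{Z}_p$-module of all series interpolating norm compatible sequences of principal units into $M'$, the $\mathbb{Z}_p$-module of all series in the kernel of Coleman's trace operator that are divisible by $p$.
   Context: $K$ is a finite extension of $\mathbb{Q}_p$ with ring of integers $\mathcal{O}_K$, uniformizer $\pi$, residue field of size $q$. $F$ is a Lubin-Tate formal group law attached to $\pi$, with $[\pi]_F$ its endomorphism for $\pi$ and $\oplus_F$ its addition; $G_m$ is the multiplicative formal group law with endomorphisms $[a]=[a]_{G_m}(x)=(1+x)^a-1$ ($a\in\mathbb{Z}_p$), subtraction $\ominus_{G_m}$, and logarithm $\log=\log_{G_m}$. $\mathfrak{F}_n$ is the kernel of $[\pi^{n+1}]_F$, $K_n=K(\mathfrak{F}_n)$, and $u_n$ are fixed with $u_0\in\mathfrak{F}_0$ nonzero, $[\pi]_F(u_{n+1})=u_n$. $\mathscr{A}'$ is the $\mathbb{Z}_p$-module of $f\in\mathcal{O}_K[[x]]$ such that $1+f(x)$ interpolates a norm compatible sequence of principal units, i.e. $1+f(u_n)=a_n$ with $a_n$ principal units of $K_n$ and $N_{K_{n+1}/K_n}(a_{n+1})=a_n$ (module operations via $G_m$). $\phi(f)=[q]_{G_m}(f(x))\ominus_{G_m}f([\pi]_F(x))$. $r$ is the smallest positive integer with $[p^r]_{G_m}(\phi(f))\in p\mathcal{O}_K[[x]]$ for all $f\in\mathscr{A}'$. Coleman's trace operator $\mathscr{L}_F$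 satisfies $\mathscr{L}_F(g)([\pi]_F(x))=\sum_{z\in\mathfrak{F}_0}g(x\oplus_F z)$, and $M'=\{g\in p\mathcal{O}_K[[x]]:\mathscr{L}_F(g)=0\}$. *)

theory Defs
  imports
    "HOL-Analysis.Elementary_Topology"
    "HOL-Algebra.Algebraic_Closure_Type"
    "HOL-Algebra.Generated_Fields"
    "HOL-Algebra.Embedded_Algebras"
    "HOL-Algebra.QuotRing"
    "HOL-Algebra.Module"
begin

section \<open>The ambient p-adic field\<close>

text \<open>
  All fields below are subfields of one ambient field, given by a type of sort
  \<open>{nonarch_field, alg_closed_field, complete_space}\<close> in which \<open>vabs p = 1 / p\<close>: a complete
  algebraically closed valued extension of the p-adic numbers, such as the completion of an
  algebraic closure.  The library constant \<open>norm\<close> is restricted to real normed vector spaces,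
  where \<open>norm (n x) = n norm x\<close>, so the absolute value is a separate constant.
\<close>

class nonarch_field = field_char_0 + metric_space +
  fixes vabs :: "'a \<Rightarrow> real"
  assumes dist_vabs: "dist x y = vabs (x - y)"
    and vabs_mult: "vabs (x * y) = vabs x * vabs y"
    and vabs_add: "vabs (x + y) \<le> max (vabs x) (vabs y)"

abbreviation subring_of :: "'a::nonarch_field set \<Rightarrow> 'a ring" where
  "subring_of S \<equiv> ring_of_type_algebra\<lparr>carrier := S\<rparr>"

text \<open>
  If \<open>vabs p = 1 / p\<close>, then \<open>vabs\<close> restricts to the p-adic absolute value on the rationals, so in a
  complete field their closure is their p-adic completion.
\<close>

definition Qp :: "'a::nonarch_field set" where
  "Qp = closure \<rat>"

definition ring_of_integers :: "'a::nonarch_field set \<Rightarrow> 'a set" where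
  "ring_of_integers L = {x \<in> L. vabs x \<le> 1}"

definition max_ideal :: "'a::nonarch_field set \<Rightarrow> 'a set" where
  "max_ideal L = {x \<in> L. vabs x < 1}"

abbreviation Zp :: "'a::nonarch_field ring" where
  "Zp \<equiv> subring_of (ring_of_integers Qp)"

definition finite_ext_Qp :: "'a::nonarch_field set \<Rightarrow> bool" where
  "finite_ext_Qp K \<longleftrightarrow> subfield K ring_of_type_algebra \<and> Qp \<subseteq> K \<and>
     ring.finite_dimension ring_of_type_algebra Qp K"

definition uniformizer :: "'a::nonarch_field set \<Rightarrow> 'a \<Rightarrow> bool" where
  "uniformizer K \<pi> \<longleftrightarrow> \<pi> \<in> ring_of_integers K \<and>
     cgenideal (subring_of (ring_of_integers K)) \<pi> = max_ideal K"

definition residue_field_size :: "'a::nonarch_field set \<Rightarrow> nat" where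
  "residue_field_size K = card (carrier (subring_of (ring_of_integers K) Quot max_ideal K))"

definition principal_units :: "'a::nonarch_field set \<Rightarrow> 'a set" where
  "principal_units L = {a \<in> L. vabs (a - 1) < 1}"

text \<open>
  The norm of a finite extension \<open>L\<close> of \<open>K\<close>, as the product of the conjugates under the
  \<open>K\<close>-embeddings of \<open>L\<close> into the algebraically closed ambient field (characteristic 0, so there
  is no inseparable degree).
\<close>

definition embeddings :: "'a::nonarch_field set \<Rightarrow> 'a set \<Rightarrow> ('a \<Rightarrow> 'a) set" where
  "embeddings K L =
     {\<sigma> \<in> ring_hom (subring_of L) ring_of_type_algebra \<inter> extensional L. \<forall>x\<in>K. \<sigma> x = x}"

definition field_norm :: "'a::nonarch_field set \<Rightarrow> 'a set \<Rightarrow> 'a \<Rightarrow> 'a" where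
  "field_norm K L x = (\<Prod>\<sigma>\<in>embeddings K L. \<sigma> x)"


section \<open>Power series\<close>

definition int_fps :: "'a::nonarch_field set \<Rightarrow> 'a fps set" where
  "int_fps K = {f. \<forall>n. fps_nth f n \<in> ring_of_integers K}"

definition p_int_fps :: "nat \<Rightarrow> 'a::nonarch_field set \<Rightarrow> 'a fps set" where
  "p_int_fps p K = {fps_const (of_nat p) * h | h. h \<in> int_fps K}"

definition fps_value :: "'a::nonarch_field fps \<Rightarrow> 'a \<Rightarrow> 'a" where
  "fps_value f z = (\<Sum>n. fps_nth f n * z ^ n)"

text \<open>
  Substitution \<open>g(f(x))\<close> where \<open>f\<close> may have a nonzero constant term, so that \<open>fps_compose\<close> does not
  apply: each coefficient is an infinite sum converging in the ambient field.
\<close>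

definition fps_subst :: "'a::nonarch_field fps \<Rightarrow> 'a fps \<Rightarrow> 'a fps" where
  "fps_subst g f = Abs_fps (\<lambda>n. \<Sum>k. fps_nth g k * fps_nth (f ^ k) n)"


section \<open>Formal group laws\<close>

text \<open>
  A series in two variables is an element \<open>F\<close> of type \<open>'a fps fps\<close>, the coefficient of \<open>x^i y^j\<close>
  being \<open>fps_nth (fps_nth F i) j\<close>.  The axioms are identities between series in three variables.
  Below \<open>A\<close> and \<open>B\<close> stand for three-variable series without constant term, so a summand of index
  \<open>i\<close> or \<open>(i, j)\<close> only has terms of total degree at least \<open>i\<close> resp. \<open>i + j\<close>, and the
  truncated sums give the full substitutions \<open>f(A)\<close> and \<open>F(A, B)\<close>.
\<close>

type_synonym 'a fps3 = "'a fps fps fps"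

definition varx :: "'a::comm_ring_1 fps3" where "varx = fps_X"
definition vary :: "'a::comm_ring_1 fps3" where "vary = fps_const fps_X"
definition varz :: "'a::comm_ring_1 fps3" where "varz = fps_const (fps_const fps_X)"

definition fps3_nth :: "'a::comm_ring_1 fps3 \<Rightarrow> nat \<Rightarrow> nat \<Rightarrow> nat \<Rightarrow> 'a" where
  "fps3_nth A k l m = fps_nth (fps_nth (fps_nth A k) l) m"

definition subst1 :: "'a::comm_ring_1 fps \<Rightarrow> 'a fps3 \<Rightarrow> 'a fps3" where
  "subst1 f A = Abs_fps (\<lambda>k. Abs_fps (\<lambda>l. Abs_fps (\<lambda>m.
     \<Sum>i\<le>k+l+m. fps_nth f i * fps3_nth (A ^ i) k l m)))"

definition subst2 :: "'a::comm_ring_1 fps fps \<Rightarrow> 'a fps3 \<Rightarrow> 'a fps3 \<Rightarrow> 'a fps3" where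
  "subst2 F A B = Abs_fps (\<lambda>k. Abs_fps (\<lambda>l. Abs_fps (\<lambda>m.
     \<Sum>i\<le>k+l+m. \<Sum>j\<le>k+l+m. fps_nth (fps_nth F i) j * fps3_nth (A ^ i * B ^ j) k l m)))"

definition formal_group_law :: "'a::nonarch_field set \<Rightarrow> 'a fps fps \<Rightarrow> bool" where
  "formal_group_law K F \<longleftrightarrow>
     (\<forall>i j. fps_nth (fps_nth F i) j \<in> ring_of_integers K) \<and>
     subst2 F varx 0 = varx \<and> subst2 F 0 vary = vary \<and>
     subst2 F varx vary = subst2 F vary varx \<and>
     subst2 F (subst2 F varx vary) varz = subst2 F varx (subst2 F vary varz)"

definition fgl_endomorphism :: "'a::nonarch_field set \<Rightarrow> 'a fps fps \<Rightarrow> 'a fps \<Rightarrow> bool" where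
  "fgl_endomorphism K F e \<longleftrightarrow> e \<in> int_fps K \<and> fps_nth e 0 = 0 \<and>
     subst1 e (subst2 F varx vary) = subst2 F (subst1 e varx) (subst1 e vary)"

text \<open>\<open>[a]_F\<close>; in characteristic 0 an endomorphism is determined by its linear coefficient.\<close>

definition fgl_endo :: "'a::nonarch_field set \<Rightarrow> 'a fps fps \<Rightarrow> 'a \<Rightarrow> 'a fps" where
  "fgl_endo K F a = (THE e. fgl_endomorphism K F e \<and> fps_nth e 1 = a)"

text \<open>
  \<open>F\<close> is a Lubin-Tate formal group law attached to \<open>\<pi>\<close>: it has an endomorphism congruent to
  \<open>\<pi> x\<close> modulo degree 2 and to \<open>x^q\<close> modulo \<open>\<pi>\<close>.
\<close>

definition lubin_tate_fgl :: "'a::nonarch_field set \<Rightarrow> 'a \<Rightarrow> 'a fps fps \<Rightarrow> bool" where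
  "lubin_tate_fgl K \<pi> F \<longleftrightarrow> formal_group_law K F \<and>
     (\<exists>e. fgl_endomorphism K F e \<and> fps_nth e 1 = \<pi> \<and>
        (\<forall>n. fps_nth (e - fps_X ^ residue_field_size K) n \<in> max_ideal K))"

text \<open>\<open>torsion K F \<pi> n\<close> is the kernel of \<open>[\<pi>^(n+1)]_F\<close> and \<open>torsion_field K F \<pi> n\<close> is \<open>K_n\<close>.\<close>

definition torsion :: "'a::nonarch_field set \<Rightarrow> 'a fps fps \<Rightarrow> 'a \<Rightarrow> nat \<Rightarrow> 'a set" where
  "torsion K F \<pi> n = {z. vabs z < 1 \<and> fps_value (fgl_endo K F (\<pi> ^ (n + 1))) z = 0}"

definition torsion_field :: "'a::nonarch_field set \<Rightarrow> 'a fps fps \<Rightarrow> 'a \<Rightarrow> nat \<Rightarrow> 'a set" where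
  "torsion_field K F \<pi> n = generate_field ring_of_type_algebra (K \<union> torsion K F \<pi> n)"

text \<open>The series \<open>F(x, z)\<close> in \<open>x\<close>, for an element \<open>z\<close> of the open unit disc.\<close>

definition fgl_translate :: "'a::nonarch_field fps fps \<Rightarrow> 'a \<Rightarrow> 'a fps" where
  "fgl_translate F z = Abs_fps (\<lambda>i. fps_value (fps_nth F i) z)"

text \<open>
  \<open>[\<pi>]_F\<close> has nonzero linear coefficient, so exactly one series over the ambient field
  satisfies the defining equation.
\<close>

definition coleman_trace ::
  "'a::nonarch_field set \<Rightarrow> 'a fps fps \<Rightarrow> 'a \<Rightarrow> 'a fps \<Rightarrow> 'a fps" where
  "coleman_trace K F \<pi> g =
     (THE h. fps_compose h (fgl_endo K F \<pi>) =
        (\<Sum>z\<in>torsion K F \<pi> 0. fps_subst g (fgl_translate F z)))"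


section \<open>The multiplicative formal group law\<close>

definition gm_add :: "'a::nonarch_field fps \<Rightarrow> 'a fps \<Rightarrow> 'a fps" where
  "gm_add f g = f + g + f * g"

definition gm_minus :: "'a::nonarch_field fps \<Rightarrow> 'a fps \<Rightarrow> 'a fps" where
  "gm_minus f g = (1 + f) * inverse (1 + g) - 1"

text \<open>\<open>[a](f)\<close> with \<open>[a](x) = (1 + x)^a - 1\<close> expanded as a binomial series.\<close>

definition gm_smult :: "'a::nonarch_field \<Rightarrow> 'a fps \<Rightarrow> 'a fps" where
  "gm_smult a f = fps_subst (fps_binomial a - 1) f"

definition gm_log :: "'a::nonarch_field fps \<Rightarrow> 'a fps" where
  "gm_log f = fps_subst (fps_ln 1) f"


section \<open>The two modules and the map\<close>

definition interpolating_series ::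
  "'a::nonarch_field set \<Rightarrow> 'a fps fps \<Rightarrow> 'a \<Rightarrow> (nat \<Rightarrow> 'a) \<Rightarrow> 'a fps set" where
  "interpolating_series K F \<pi> u = {f \<in> int_fps K. \<exists>a. \<forall>n.
     a n \<in> principal_units (torsion_field K F \<pi> n) \<and>
     1 + fps_value f (u n) = a n \<and>
     field_norm (torsion_field K F \<pi> n) (torsion_field K F \<pi> (Suc n)) (a (Suc n)) = a n}"

text \<open>The multiplicative part of a module record is irrelevant to the locale \<open>module\<close>.\<close>

definition A_module ::
  "'a::nonarch_field set \<Rightarrow> 'a fps fps \<Rightarrow> 'a \<Rightarrow> (nat \<Rightarrow> 'a) \<Rightarrow> ('a, 'a fps) module" where
  "A_module K F \<pi> u = \<lparr>carrier = interpolating_series K F \<pi> u, monoid.mult = undefined, one = undefined,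
     zero = 0, add = gm_add, module.smult = gm_smult\<rparr>"

definition M_module ::
  "nat \<Rightarrow> 'a::nonarch_field set \<Rightarrow> 'a fps fps \<Rightarrow> 'a \<Rightarrow> ('a, 'a fps) module" where
  "M_module p K F \<pi> = \<lparr>carrier = {g \<in> p_int_fps p K. coleman_trace K F \<pi> g = 0},
     monoid.mult = undefined, one = undefined,
     zero = 0, add = (+), module.smult = (\<lambda>a g. fps_const a * g)\<rparr>"

definition phi :: "'a::nonarch_field set \<Rightarrow> 'a fps fps \<Rightarrow> 'a \<Rightarrow> 'a fps \<Rightarrow> 'a fps" where
  "phi K F \<pi> f = gm_minus (gm_smult (of_nat (residue_field_size K)) f)
     (fps_compose f (fgl_endo K F \<pi>))"

definition min_r ::
  "nat \<Rightarrow> 'a::nonarch_field set \<Rightarrow> 'a fps fps \<Rightarrow> 'a \<Rightarrow> (nat \<Rightarrow> 'a) \<Rightarrow> nat" where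
  "min_r p K F \<pi> u = (LEAST r. 0 < r \<and>
     (\<forall>f\<in>interpolating_series K F \<pi> u. gm_smult (of_nat (p ^ r)) (phi K F \<pi> f) \<in> p_int_fps p K))"

definition module_injection ::
  "('a, 'r) ring_scheme \<Rightarrow> ('a, 'b, 'm) module_scheme \<Rightarrow> ('a, 'c, 'n) module_scheme \<Rightarrow>
     ('b \<Rightarrow> 'c) \<Rightarrow> bool" where
  "module_injection R M N h \<longleftrightarrow> module R M \<and> module R N \<and>
     h \<in> carrier M \<rightarrow> carrier N \<and>
     (\<forall>x\<in>carrier M. \<forall>y\<in>carrier M. h (x \<oplus>\<^bsub>M\<^esub> y) = h x \<oplus>\<^bsub>N\<^esub> h y) \<and>
     (\<forall>a\<in>carrier R. \<forall>x\<in>carrier M. h (a \<odot>\<^bsub>M\<^esub> x) = a \<odot>\<^bsub>N\<^esub> h x) \<and>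
     inj_on h (carrier M)"

end

theory Submission
  imports
    Defs
    "HOL-Analysis.Elementary_Metric_Spaces"
    "HOL-Computational_Algebra.Polynomial_FPS"
    "HOL-Algebra.Sylow"
begin

text \<open>
  By Lubin-Tate theory, proved here by Weierstrass preparation and the orthogonality of the powers
  \<open>1, u_n, u_n^2, ...\<close> over \<open>K_(n-1)\<close>, the conjugates of \<open>u_(n+1)\<close> over \<open>K_n\<close> are its translates by
  the kernel of \<open>[\<pi>]_F\<close>.  Since a nonzero integral series over \<open>K_0\<close> has finitely many zeros,
  \<open>f\<close> interpolates a norm compatible sequence of principal units iff \<open>g = 1 + f\<close> satisfies
  \<open>\<Prod>z. g(x \<oplus> z) = g([\<pi>] x)\<close>.  Hence the product of the translates of
  \<open>1 + \<phi>(f) = g^q / g([\<pi>] x)\<close> is 1 and the trace of its logarithm vanishes; the Frobenius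
  congruence makes it congruent to 1 modulo \<open>\<pi>\<close>, so that \<open>r\<close> exists.  If the logarithm is 0, then
  \<open>\<phi>(f)\<close> is constant, and comparing the lowest terms of the derivatives of \<open>g^q\<close> and \<open>g([\<pi>] x)\<close>
  gives \<open>q = \<pi>^m\<close> unless \<open>f\<close> is constant; the only constant solution is 0.
\<close>

section \<open>Nonarchimedean analysis\<close>

text \<open>Norm compatibility is a condition at infinitely many points, awkward under inverses and
  p-adic limits of powers. The functional equation is a single identity of series, preserved by
  products, quotients and coefficientwise limits; the module structure and linearity are read off
  from it. Reaching it needs exact knowledge of the tower. The norm is a product over embeddings, so
  the embeddings of K_(n+1) over K_n must be listed; and K_n is generated by the whole kernel, so it
  must be shown to be K(u_0, ..., u_n). For the latter, series h over K commuting with [\<pi>] are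
  built for representatives of the residue field: the q values h(u_0) are distinct, hence fill the
  kernel of [\<pi>], and h(u_m) lies above h(u_0) in the m-th field. Scalars in Z_p are limits of
  natural numbers, so linearity reduces to powers with natural exponents. The excluded case q =
  \<pi>^n has its origin in the chain rule: if f - f(0) starts in degree n, the lowest coefficient
  of the derivative is multiplied by \<pi>^n for g([\<pi>](x)) and by q for g^q, up to the same
  unit.\<close>

lemma vabs_zero [simp]: "vabs (0::'a::nonarch_field) = 0"
  using dist_vabs[of "0::'a" 0] by simp

lemma vabs_eq_0_iff [simp]: "vabs (x::'a::nonarch_field) = 0 \<longleftrightarrow> x = 0"
  using dist_vabs[of x 0] by (metis diff_zero dist_eq_0_iff)

lemma vabs_nonneg [simp]: "0 \<le> vabs (x::'a::nonarch_field)"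
  using dist_vabs[of x 0] by (metis diff_zero zero_le_dist)

lemma vabs_pos_iff [simp]: "0 < vabs (x::'a::nonarch_field) \<longleftrightarrow> x \<noteq> 0"
  using vabs_nonneg[of x] vabs_eq_0_iff[of x] by (simp add: less_le del: vabs_nonneg vabs_eq_0_iff)

lemma vabs_one [simp]: "vabs (1::'a::nonarch_field) = 1"
proof -
  have "vabs (1::'a) * vabs (1::'a) = vabs (1::'a)" by (metis mult_1 vabs_mult)
  then show ?thesis by simp
qed

lemma vabs_minus_one [simp]: "vabs (- 1::'a::nonarch_field) = 1"
proof -
  have "vabs (-1::'a) * vabs (-1::'a) = 1" by (metis vabs_mult vabs_one minus_one_mult_self power2_eq_square power2_minus mult_minus1_right minus_minus)
  then show ?thesis using vabs_nonneg[of "-1::'a"] by (metis abs_of_nonneg abs_mult_self_eq mult_1 power2_eq_1_iff power2_eq_square real_sqrt_abs real_sqrt_one)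
qed

lemma vabs_minus [simp]: "vabs (- x::'a::nonarch_field) = vabs x"
  using vabs_mult[of "-1" x] by simp

lemma vabs_minus_commute: "vabs (x - y::'a::nonarch_field) = vabs (y - x)"
  by (metis minus_diff_eq vabs_minus)

lemma vabs_add_le: "vabs x \<le> c \<Longrightarrow> vabs y \<le> c \<Longrightarrow> vabs (x + y::'a::nonarch_field) \<le> c"
  using vabs_add[of x y] by linarith

lemma vabs_diff_le: "vabs x \<le> c \<Longrightarrow> vabs y \<le> c \<Longrightarrow> vabs (x - y::'a::nonarch_field) \<le> c"
  using vabs_add_le[of x c "-y"] by simp

lemma vabs_add_less: "vabs x < c \<Longrightarrow> vabs y < c \<Longrightarrow> vabs (x + y::'a::nonarch_field) < c"
  using vabs_add[of x y] by linarith

lemma vabs_diff_less: "vabs x < c \<Longrightarrow> vabs y < c \<Longrightarrow> vabs (x - y::'a::nonarch_field) < c"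
  using vabs_add_less[of x c "-y"] by simp

lemma vabs_add_eq: "vabs x < vabs y \<Longrightarrow> vabs (x + y::'a::nonarch_field) = vabs y"
  using vabs_add[of x y] vabs_add[of "x + y" "- x"] by simp

lemma vabs_add_eq': "vabs y < vabs x \<Longrightarrow> vabs (x + y::'a::nonarch_field) = vabs x"
  using vabs_add_eq[of y x] by (simp add: add.commute)

text \<open>The form in which domination by a leading term is used throughout: an approximation
  whose error is smaller than its own size already has the right absolute value.\<close>

lemma vabs_eq_of_diff_less: "vabs (x - y) < vabs y \<Longrightarrow> vabs (x::'a::nonarch_field) = vabs y"
  using vabs_add_eq[of "x - y" y] by simp

lemma vabs_power: "vabs (x ^ n::'a::nonarch_field) = vabs x ^ n"
  by (induction n) (auto simp: vabs_mult)

lemma vabs_inverse: "vabs (inverse x::'a::nonarch_field) = inverse (vabs x)"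
proof (cases "x = 0")
  case False
  then have "vabs x * vabs (inverse x) = 1" by (metis vabs_mult vabs_one right_inverse)
  then show ?thesis by (metis inverse_unique)
qed simp

lemma vabs_divide: "vabs (x / y::'a::nonarch_field) = vabs x / vabs y"
  by (simp add: divide_inverse vabs_mult vabs_inverse)

lemma vabs_sum_le:
  fixes f :: "'b \<Rightarrow> 'a::nonarch_field"
  assumes "\<And>i. i \<in> A \<Longrightarrow> vabs (f i) \<le> c" and "0 \<le> c"
  shows "vabs (\<Sum>i\<in>A. f i) \<le> c"
  using assms by (induction A rule: infinite_finite_induct) (auto intro: vabs_add_le)

lemma vabs_sum_less:
  fixes f :: "'b \<Rightarrow> 'a::nonarch_field"
  assumes "\<And>i. i \<in> A \<Longrightarrow> vabs (f i) < c" and "0 < c"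
  shows "vabs (\<Sum>i\<in>A. f i) < c"
  using assms by (induction A rule: infinite_finite_induct) (auto intro: vabs_add_less)

lemma vabs_of_nat_le_1 [simp]: "vabs (of_nat n::'a::nonarch_field) \<le> 1"
  by (induction n) (auto intro: vabs_add_le)

lemma vabs_of_int_le_1 [simp]: "vabs (of_int n::'a::nonarch_field) \<le> 1"
  by (cases n) (simp_all del: of_nat_Suc)

lemma vabs_mult_le: "vabs x \<le> c \<Longrightarrow> vabs y \<le> d \<Longrightarrow> vabs (x * y::'a::nonarch_field) \<le> c * d"
  by (simp add: vabs_mult mult_mono' )

lemma vabs_mult_le_1: "vabs x \<le> 1 \<Longrightarrow> vabs y \<le> 1 \<Longrightarrow> vabs (x * y::'a::nonarch_field) \<le> 1"
  using vabs_mult_le[of x 1 y 1] by simp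

section \<open>Topology and infinite series\<close>

lemma tendsto_vabs_iff:
  "(f \<longlongrightarrow> (l::'a::nonarch_field)) G \<longleftrightarrow> ((\<lambda>x. vabs (f x - l)) \<longlongrightarrow> 0) G"
  unfolding tendsto_dist_iff[of f l] by (simp add: dist_vabs)

text \<open>This instance and the next make the general limit laws for sums and products available;
  the field is not a real normed space, so the laws do not come from there.\<close>

instance nonarch_field \<subseteq> topological_ab_group_add
proof
  fix a b :: 'a
  show "((\<lambda>x. fst x + snd x) \<longlongrightarrow> a + b) (nhds a \<times>\<^sub>F nhds b)"
  proof (rule tendstoI)
    fix e :: real assume "0 < e"
    then have "\<forall>\<^sub>F x in nhds a. dist x a < e" "\<forall>\<^sub>F x in nhds b. dist x b < e"
      by (auto simp: eventually_nhds_metric)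
    then show "\<forall>\<^sub>F x in nhds a \<times>\<^sub>F nhds b. dist (fst x + snd x) (a + b) < e"
      unfolding eventually_prod_filter
      by (intro exI[of _ "\<lambda>x. dist x a < e"] exI[of _ "\<lambda>x. dist x b < e"])
         (auto simp: dist_vabs add_diff_add intro: vabs_add_less)
  qed
  show "(uminus \<longlongrightarrow> - a) (nhds a)"
  proof (rule tendstoI)
    fix e :: real assume "0 < e"
    then have "\<forall>\<^sub>F x in nhds a. dist x a < e" by (auto simp: eventually_nhds_metric)
    then show "\<forall>\<^sub>F x in nhds a. dist (- x) (- a) < e"
      by eventually_elim (simp add: dist_vabs vabs_minus_commute)
  qed
qed

instance nonarch_field \<subseteq> topological_comm_monoid_mult
proof
  fix a b :: 'a
  show "((\<lambda>x. fst x * snd x) \<longlongrightarrow> a * b) (nhds a \<times>\<^sub>F nhds b)"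
  proof (rule tendstoI)
    fix e :: real assume e: "0 < e"
    \<comment> \<open>The bound e / (1 + |a| + |b|) makes the two mixed terms of x y - a b small;
      the cap 1 keeps the quadratic term below d.\<close>
    define d where "d = min 1 (e / (1 + vabs a + vabs b))"
    have s: "0 < 1 + vabs a + vabs b" by (simp add: add_pos_nonneg)
    have d: "0 < d" using e s by (simp add: d_def)
    then have "\<forall>\<^sub>F x in nhds a. dist x a < d" "\<forall>\<^sub>F x in nhds b. dist x b < d"
      by (auto simp: eventually_nhds_metric)
    moreover have "dist (x * y) (a * b) < e" if "dist x a < d" "dist y b < d" for x y
    proof -
      have x: "vabs (x - a) < d" and y: "vabs (y - b) < d" using that by (auto simp: dist_vabs)
      have de: "d * (1 + vabs a + vabs b) \<le> e"
        using s mult_right_mono[of d "e / (1 + vabs a + vabs b)" "1 + vabs a + vabs b"] by (simp add: d_def)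
      have d1: "d \<le> 1" by (simp add: d_def)
      have *: "d * c < e" if "0 \<le> c" "c < 1 + vabs a + vabs b" for c
        using that d de by (meson dual_order.strict_trans1 mult_strict_left_mono)
      have "vabs ((x - a) * (y - b)) \<le> d * vabs (y - b)"
        unfolding vabs_mult using x by (intro mult_right_mono) auto
      also have "\<dots> < d * 1" using d y d1 by (intro mult_strict_left_mono) auto
      also have "\<dots> \<le> d * (1 + vabs a + vabs b)" using d by (intro mult_left_mono) auto
      also have "\<dots> \<le> e" by (rule de)
      finally have 1: "vabs ((x - a) * (y - b)) < e" .
      have "vabs (a * (y - b)) \<le> d * vabs a" unfolding vabs_mult using y
        by (metis less_imp_le mult.commute mult_right_mono vabs_nonneg)
      also have "\<dots> < e" by (intro *) (auto simp: add_pos_nonneg)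
      finally have 2: "vabs (a * (y - b)) < e" .
      have "vabs ((x - a) * b) \<le> d * vabs b" unfolding vabs_mult using x
        by (metis less_imp_le mult_right_mono vabs_nonneg)
      also have "\<dots> < e" by (intro *) (auto simp: add_pos_nonneg)
      finally have 3: "vabs ((x - a) * b) < e" .
      have "x * y - a * b = (x - a) * (y - b) + a * (y - b) + (x - a) * b" by (simp add: algebra_simps)
      then show ?thesis unfolding dist_vabs using 1 2 3 by (metis vabs_add_less)
    qed
    ultimately show "\<forall>\<^sub>F x in nhds a \<times>\<^sub>F nhds b. dist (fst x * snd x) (a * b) < e"
      unfolding eventually_prod_filter
      by (intro exI[of _ "\<lambda>x. dist x a < d"] exI[of _ "\<lambda>x. dist x b < d"]) auto
  qed
qed

lemma tendsto_vabs: "(f \<longlongrightarrow> (l::'a::nonarch_field)) G \<Longrightarrow> ((\<lambda>x. vabs (f x)) \<longlongrightarrow> vabs l) G"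
  using tendsto_dist[of f l G "\<lambda>_. 0" 0] by (simp add: dist_vabs)

lemma vabs_limit_le:
  assumes "f \<longlonglongrightarrow> (l::'a::nonarch_field)" "\<And>n. vabs (f n) \<le> c"
  shows "vabs l \<le> c"
  using tendsto_vabs[OF assms(1)] assms(2) by (simp add: LIMSEQ_le_const2)

lemma tendsto_vabs_bound:
  assumes "b \<longlonglongrightarrow> 0" "\<And>n. vabs (f n - l::'a::nonarch_field) \<le> b n"
  shows "f \<longlonglongrightarrow> l"
  unfolding tendsto_vabs_iff using assms
  by (intro tendsto_sandwich[of "\<lambda>_. 0" "\<lambda>n. vabs (f n - l)" sequentially b 0] always_eventually allI) auto

text \<open>Null terms suffice in a complete ultrametric field, since a block of the series is at
  most as large as its largest term. The majorant \<open>b\<close> is explicit so that one bound can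
  serve a whole family in \<open>nonarch_tannery\<close>.\<close>

lemma nonarch_summable:
  fixes f :: "nat \<Rightarrow> 'a::{nonarch_field,complete_space}"
  assumes "b \<longlonglongrightarrow> 0" "\<And>n. vabs (f n) \<le> b n"
  shows "summable f"
proof -
  have "Cauchy (\<lambda>n. \<Sum>i<n. f i)"
  proof (rule metric_CauchyI)
    fix e :: real assume e: "0 < e"
    then obtain N where N: "\<And>n. n \<ge> N \<Longrightarrow> b n < e"
      using order_tendstoD(2)[OF assms(1) e] by (auto simp: eventually_sequentially)
    have *: "dist (\<Sum>i<m. f i) (\<Sum>i<n. f i) < e" if "N \<le> n" "n \<le> m" for m n
    proof -
      have "(\<Sum>i<m. f i) - (\<Sum>i<n. f i) = (\<Sum>i\<in>{n..<m}. f i)"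
        using that by (metis lessThan_atLeast0 sum_diff_nat_ivl zero_le)
      moreover have "vabs (\<Sum>i\<in>{n..<m}. f i) < e"
        using e that by (intro vabs_sum_less) (auto intro: le_less_trans[OF assms(2) N])
      ultimately show ?thesis by (simp add: dist_vabs)
    qed
    show "\<exists>M. \<forall>m\<ge>M. \<forall>n\<ge>M. dist (\<Sum>i<m. f i) (\<Sum>i<n. f i) < e"
      by (rule exI[of _ N]) (metis * dist_commute nat_le_linear)
  qed
  then show ?thesis unfolding summable_def sums_def
    using Cauchy_convergent_iff convergent_def by blast
qed

lemma nonarch_sums_diff:
  "f sums (a::'a::nonarch_field) \<Longrightarrow> g sums b \<Longrightarrow> (\<lambda>n. f n - g n) sums (a - b)"
  unfolding sums_def by (simp add: sum_subtractf tendsto_diff)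

lemma nonarch_sums_mult: "f sums (a::'a::nonarch_field) \<Longrightarrow> (\<lambda>n. c * f n) sums (c * a)"
  unfolding sums_def by (simp flip: sum_distrib_left add: tendsto_mult_left)

lemma vabs_suminf_le:
  fixes f :: "nat \<Rightarrow> 'a::nonarch_field"
  assumes "summable f" "\<And>n. vabs (f n) \<le> c" "0 \<le> c"
  shows "vabs (suminf f) \<le> c"
  by (rule vabs_limit_le[OF summable_LIMSEQ[OF assms(1)]]) (intro vabs_sum_le assms)

text \<open>Dominated convergence with a null majorant: from \<open>N\<close> on all terms are small
  and so is their sum, while the finitely many terms below \<open>N\<close> converge.\<close>

lemma nonarch_tannery:
  fixes t :: "nat \<Rightarrow> nat \<Rightarrow> 'a::{nonarch_field,complete_space}"
  assumes lim: "\<And>k. (\<lambda>j. t j k) \<longlonglongrightarrow> s k" and b: "b \<longlonglongrightarrow> 0" "\<And>j k. vabs (t j k) \<le> b k"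
  shows "(\<lambda>j. \<Sum>k. t j k) \<longlonglongrightarrow> (\<Sum>k. s k)"
proof (rule tendstoI)
  fix e :: real assume e: "0 < e"
  have sb: "vabs (s k) \<le> b k" for k by (rule vabs_limit_le[OF lim b(2)])
  have summ: "summable (t j)" "summable s" for j
    using nonarch_summable[OF b(1)] b(2) sb by blast+
  obtain N where N: "\<And>n. n \<ge> N \<Longrightarrow> b n < e / 2"
    using order_tendstoD(2)[OF b(1), of "e/2"] e by (auto simp: eventually_sequentially)
  have "\<forall>\<^sub>F j in sequentially. \<forall>k\<in>{..<N}. dist (t j k) (s k) < e / 2"
    using e by (intro eventually_ball_finite ballI tendstoD[OF lim]) auto
  then show "\<forall>\<^sub>F j in sequentially. dist (\<Sum>k. t j k) (\<Sum>k. s k) < e"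
  proof eventually_elim
    case (elim j)
    have "vabs (t j k - s k) \<le> e / 2" for k
    proof (cases "k < N")
      case True then show ?thesis using elim by (auto simp: dist_vabs intro: less_imp_le)
    next
      case False
      then have "vabs (t j k) \<le> e / 2" "vabs (s k) \<le> e / 2"
        using N[of k] b(2)[of j k] sb[of k] by linarith+
      then show ?thesis by (rule vabs_diff_le)
    qed
    moreover have d: "(\<lambda>k. t j k - s k) sums ((\<Sum>k. t j k) - (\<Sum>k. s k))"
      by (intro nonarch_sums_diff summable_sums summ)
    ultimately have "vabs (\<Sum>k. t j k - s k) \<le> e / 2"
      using e by (intro vabs_suminf_le sums_summable[OF d]) auto
    then show ?case using e sums_unique[OF d] by (simp add: dist_vabs)
  qed
qed

section \<open>Bounded power series and substitution\<close>

text \<open>A bound on the Gauss norm. The bound \<open>1 / real p\<close> will express divisibility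
  by p and the bound \<open>vabs \<pi>\<close> divisibility by \<pi>, so that congruences become
  estimates.\<close>

definition fbd :: "real \<Rightarrow> 'a::nonarch_field fps \<Rightarrow> bool" where
  "fbd c f \<longleftrightarrow> (\<forall>n. vabs (fps_nth f n) \<le> c)"

lemma fbdD: "fbd c f \<Longrightarrow> vabs (fps_nth f n) \<le> c"
  by (simp add: fbd_def)

lemma fbd_nonneg: "fbd c f \<Longrightarrow> 0 \<le> c"
  using vabs_nonneg order_trans unfolding fbd_def by blast

lemma fbd_mono: "fbd c f \<Longrightarrow> c \<le> d \<Longrightarrow> fbd d f"
  using order_trans unfolding fbd_def by blast

lemma fbd_0 [simp]: "fbd c 0 \<longleftrightarrow> 0 \<le> c"
  by (simp add: fbd_def)

lemma fbd_const: "0 \<le> c \<Longrightarrow> fbd c (fps_const a) \<longleftrightarrow> vabs a \<le> c"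
  by (auto simp: fbd_def)

lemma fbd_1 [simp]: "1 \<le> c \<Longrightarrow> fbd c 1"
  by (auto simp: fbd_def)

lemma fbd_X [simp]: "fbd 1 fps_X"
  by (auto simp: fbd_def fps_X_nth)

lemma fbd_add: "fbd c f \<Longrightarrow> fbd c g \<Longrightarrow> fbd c (f + g)"
  by (simp add: fbd_def vabs_add_le)

lemma fbd_diff: "fbd c f \<Longrightarrow> fbd c g \<Longrightarrow> fbd c (f - g)"
  by (simp add: fbd_def vabs_diff_le)

lemma fbd_minus [simp]: "fbd c (- f) \<longleftrightarrow> fbd c f"
  by (simp add: fbd_def)

lemma fbd_minus_commute: "fbd c (f - g) \<Longrightarrow> fbd c (g - f)"
  by (metis fbd_minus minus_diff_eq)

lemma fbd_mult: "fbd c f \<Longrightarrow> fbd d g \<Longrightarrow> fbd (c * d) (f * g)"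
  using fbd_nonneg[of c f] fbd_nonneg[of d g] unfolding fbd_def[of "c * d"] fps_mult_nth
  by (intro allI vabs_sum_le vabs_mult_le fbdD) simp_all

lemma fbd_mult_1: "fbd 1 f \<Longrightarrow> fbd c g \<Longrightarrow> fbd c (f * g)"
  using fbd_mult[of 1 f c g] by simp

lemma fbd_mult_1': "fbd c f \<Longrightarrow> fbd 1 g \<Longrightarrow> fbd c (f * g)"
  using fbd_mult[of c f 1 g] by simp

lemma fbd_power: "fbd 1 f \<Longrightarrow> fbd 1 (f ^ n)"
  by (induction n) (auto intro: fbd_mult_1)

lemma fbd_sum: "(\<And>i. i \<in> A \<Longrightarrow> fbd c (f i)) \<Longrightarrow> 0 \<le> c \<Longrightarrow> fbd c (\<Sum>i\<in>A. f i)"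
  by (induction A rule: infinite_finite_induct) (auto intro: fbd_add)

lemma fbd_prod: "(\<And>i. i \<in> A \<Longrightarrow> fbd 1 (f i)) \<Longrightarrow> fbd 1 (\<Prod>i\<in>A. f i)"
  by (induction A rule: infinite_finite_induct) (auto intro: fbd_mult_1)

lemma fbd_power_diff:
  assumes "fbd 1 f" "fbd 1 g" "fbd c (f - g)"
  shows "fbd c (f ^ n - g ^ n)"
proof (induction n)
  case 0
  then show ?case using fbd_nonneg[OF assms(3)] by simp
next
  case (Suc n)
  have "f ^ Suc n - g ^ Suc n = f * (f ^ n - g ^ n) + (f - g) * g ^ n" by (simp add: algebra_simps)
  moreover have "fbd c (f * (f ^ n - g ^ n) + (f - g) * g ^ n)"
    by (intro fbd_add fbd_mult_1[OF assms(1) Suc] fbd_mult_1'[OF assms(3)] fbd_power assms)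
  ultimately show ?case by simp
qed

text \<open>Coefficientwise convergence. Together with a common Gauss bound it is strong enough to
  pass to the limit in substitutions and in values on the open unit disc.\<close>

definition fconv :: "(nat \<Rightarrow> 'a::nonarch_field fps) \<Rightarrow> 'a fps \<Rightarrow> bool" where
  "fconv G f \<longleftrightarrow> (\<forall>n. (\<lambda>j. fps_nth (G j) n) \<longlonglongrightarrow> fps_nth f n)"

lemma fconv_const [simp]: "fconv (\<lambda>_. f) f"
  by (simp add: fconv_def)

lemma fconv_add: "fconv G f \<Longrightarrow> fconv Y g \<Longrightarrow> fconv (\<lambda>j. G j + Y j) (f + g)"
  by (simp add: fconv_def tendsto_add)

lemma fconv_diff: "fconv G f \<Longrightarrow> fconv Y g \<Longrightarrow> fconv (\<lambda>j. G j - Y j) (f - g)"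
  by (simp add: fconv_def tendsto_diff)

lemma fconv_mult: "fconv G f \<Longrightarrow> fconv Y g \<Longrightarrow> fconv (\<lambda>j. G j * Y j) (f * g)"
  by (auto simp: fconv_def fps_mult_nth intro!: tendsto_sum tendsto_mult)

lemma fconv_power: "fconv G f \<Longrightarrow> fconv (\<lambda>j. G j ^ n) (f ^ n)"
  by (induction n) (auto intro: fconv_mult)

lemma fconv_prod: "(\<And>i. i \<in> A \<Longrightarrow> fconv (G i) (f i)) \<Longrightarrow> fconv (\<lambda>j. \<Prod>i\<in>A. G i j) (\<Prod>i\<in>A. f i)"
  by (induction A rule: infinite_finite_induct) (auto intro: fconv_mult)

lemma fconv_unique: "fconv G f \<Longrightarrow> fconv G g \<Longrightarrow> f = g"
  unfolding fconv_def fps_eq_iff by (metis LIMSEQ_unique)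

lemma fconv_fbd: "fconv G f \<Longrightarrow> (\<And>j. fbd c (G j)) \<Longrightarrow> fbd c f"
  unfolding fconv_def fbd_def by (blast intro: vabs_limit_le)

lemma fconv_deriv: "fconv G f \<Longrightarrow> fconv (\<lambda>j. fps_deriv (G j)) (fps_deriv f)"
  by (auto simp: fconv_def intro!: tendsto_mult_left)

lemma fconv_compose: "fconv G f \<Longrightarrow> fconv (\<lambda>j. fps_compose (G j) e) (fps_compose f e)"
  by (auto simp: fconv_def fps_compose_nth intro!: tendsto_sum tendsto_mult_right)

lemma fconv_cutoff: "fconv (\<lambda>j. fps_cutoff j f) f"
  unfolding fconv_def
proof
  fix n
  have "\<forall>\<^sub>F j in sequentially. fps_nth f n = fps_nth (fps_cutoff j f) n"
    unfolding eventually_sequentially by (intro exI[of _ "Suc n"]) auto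
  then show "(\<lambda>j. fps_nth (fps_cutoff j f) n) \<longlonglongrightarrow> fps_nth f n"
    by (rule Lim_transform_eventually[OF tendsto_const])
qed

lemma fbd_cutoff: "fbd c f \<Longrightarrow> fbd c (fps_cutoff j f)"
  using fbd_nonneg[of c f] by (simp add: fbd_def)

lemma fps_cutoff_Suc':
  "fps_cutoff (Suc j) f = fps_cutoff j f + fps_const (fps_nth f j) * fps_X ^ j"
  by (auto simp: fps_eq_iff fps_X_power_nth less_Suc_eq)

text \<open>Reduces a statement that is additive and continuous in a bounded series to monomials,
  because the truncations of \<open>g\<close> keep its bound and converge to it. This spares
  rearrangements of double series.\<close>

lemma fbd_induct [consumes 1, case_names monom add zero limit]:
  assumes "fbd B g"
    and monom: "\<And>c k. vabs c \<le> B \<Longrightarrow> P (fps_const c * fps_X ^ k)"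
    and add: "\<And>f g. fbd B f \<Longrightarrow> fbd B g \<Longrightarrow> P f \<Longrightarrow> P g \<Longrightarrow> P (f + g)"
    and zero: "P 0"
    and limit: "\<And>G g. (\<And>j. fbd B (G j)) \<Longrightarrow> (\<And>j. P (G j)) \<Longrightarrow> fconv G g \<Longrightarrow> P g"
  shows "P g"
proof (rule limit[OF _ _ fconv_cutoff])
  show "fbd B (fps_cutoff j g)" for j by (intro fbd_cutoff assms(1))
  show "P (fps_cutoff j g)" for j
  proof (induction j)
    case 0
    have "fps_cutoff 0 g = 0" by (auto simp: fps_eq_iff)
    then show ?case using zero by simp
  next
    case (Suc j)
    have "vabs (fps_nth g j) \<le> B" using assms(1) by (rule fbdD)
    moreover from this have "fbd B (fps_const (fps_nth g j) * fps_X ^ j)"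
      using fbd_nonneg[OF assms(1)] by (auto simp: fbd_def fps_X_power_nth)
    ultimately show ?case unfolding fps_cutoff_Suc'
      by (intro add monom fbd_cutoff assms(1) Suc)
  qed
qed

section \<open>Substitution of integral series with constant term in the open unit disc\<close>

definition fdisc :: "'a::nonarch_field fps \<Rightarrow> bool" where
  "fdisc T \<longleftrightarrow> fbd 1 T \<and> vabs (fps_nth T 0) < 1"

lemma fdisc_fbd: "fdisc T \<Longrightarrow> fbd 1 T"
  by (simp add: fdisc_def)

lemma fdisc_const [simp]: "fdisc (fps_const z) \<longleftrightarrow> vabs z < 1"
  by (auto simp: fdisc_def fbd_const)

text \<open>A coefficient of degree n in a product of k factors takes positive degree from at most n
  of them; each of the other k - n factors contributes the small constant term. This bound makes the
  sums in \<open>fps_subst\<close> converge.\<close>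

lemma fdisc_power_nth:
  assumes "fdisc T"
  shows "vabs (fps_nth (T ^ k) n) \<le> vabs (fps_nth T 0) ^ (k - n)"
proof (induction k arbitrary: n)
  case 0
  then show ?case by (simp)
next
  case (Suc k)
  let ?c = "vabs (fps_nth T 0)"
  have c: "0 \<le> ?c" "?c < 1" using assms by (auto simp: fdisc_def)
  have "vabs (fps_nth T i * fps_nth (T ^ k) (n - i)) \<le> ?c ^ (Suc k - n)" if "i \<in> {0..n}" for i
  proof (cases i)
    case 0
    have "vabs (fps_nth T i * fps_nth (T ^ k) (n - i)) \<le> ?c * ?c ^ (k - n)"
      using 0 Suc[of n] c by (simp add: vabs_mult mult_left_mono)
    also have "\<dots> = ?c ^ Suc (k - n)" by simp
    also have "\<dots> \<le> ?c ^ (Suc k - n)" using c by (intro power_decreasing) auto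
    finally show ?thesis .
  next
    case (Suc i')
    have "vabs (fps_nth T i * fps_nth (T ^ k) (n - i)) \<le> 1 * ?c ^ (k - (n - i))"
      using assms Suc.IH[of "n - i"] by (intro vabs_mult_le) (auto simp: fdisc_def fbd_def)
    also have "\<dots> \<le> ?c ^ (Suc k - n)" using c that Suc by (simp, intro power_decreasing) auto
    finally show ?thesis .
  qed
  then show ?case using c by (auto simp: fps_mult_nth intro!: vabs_sum_le)
qed

lemma LIMSEQ_power_diff_0: "0 \<le> c \<Longrightarrow> c < 1 \<Longrightarrow> (\<lambda>k. B * c ^ (k - n)) \<longlonglongrightarrow> (0::real)"
  by (rule LIMSEQ_offset[where k = n]) (simp add: tendsto_mult_right_zero LIMSEQ_realpow_zero)

lemma fps_subst_nth: "fps_nth (fps_subst g T) n = (\<Sum>k. fps_nth g k * fps_nth (T ^ k) n)"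
  by (simp add: fps_subst_def)

lemma fps_subst_term_le:
  assumes "fbd B g" "fdisc T"
  shows "vabs (fps_nth g k * fps_nth (T ^ k) n) \<le> B * vabs (fps_nth T 0) ^ (k - n)"
  using assms by (intro vabs_mult_le fdisc_power_nth) (auto simp: fbd_def)

lemma fps_subst_bound_LIMSEQ:
  "fdisc T \<Longrightarrow> (\<lambda>k. B * vabs (fps_nth T 0) ^ (k - n)) \<longlonglongrightarrow> 0"
  by (rule LIMSEQ_power_diff_0) (auto simp: fdisc_def)

lemma fps_subst_sums:
  fixes g :: "'a::{nonarch_field,complete_space} fps"
  assumes "fbd B g" "fdisc T"
  shows "(\<lambda>k. fps_nth g k * fps_nth (T ^ k) n) sums fps_nth (fps_subst g T) n"
  unfolding fps_subst_nth
  by (intro summable_sums nonarch_summable[OF fps_subst_bound_LIMSEQ[of _ B] fps_subst_term_le] assms)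

lemma fps_subst_fbd:
  fixes g :: "'a::{nonarch_field,complete_space} fps"
  assumes "fbd B g" "fdisc T"
  shows "fbd B (fps_subst g T)"
  unfolding fbd_def
proof
  fix n
  have "vabs (fps_nth g k * fps_nth (T ^ k) n) \<le> B * 1" for k
    using assms fbd_power[OF fdisc_fbd[OF assms(2)]] by (intro vabs_mult_le) (auto simp: fbd_def)
  then show "vabs (fps_nth (fps_subst g T) n) \<le> B"
    unfolding fps_subst_nth using sums_summable[OF fps_subst_sums[OF assms]] fbd_nonneg[OF assms(1)]
    by (intro vabs_suminf_le) auto
qed

lemma fps_subst_add:
  fixes g :: "'a::{nonarch_field,complete_space} fps"
  assumes "fbd B g" "fbd C h" "fdisc T"
  shows "fps_subst (g + h) T = fps_subst g T + fps_subst h T"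
proof (rule fps_ext)
  fix n
  show "fps_nth (fps_subst (g + h) T) n = fps_nth (fps_subst g T + fps_subst h T) n"
    using sums_add[OF fps_subst_sums[OF assms(1,3), of n] fps_subst_sums[OF assms(2,3), of n]]
    by (simp add: sums_iff fps_subst_nth ring_distribs)
qed

lemma fps_subst_const_mult:
  fixes g :: "'a::{nonarch_field,complete_space} fps"
  assumes "fbd B g" "fdisc T"
  shows "fps_subst (fps_const c * g) T = fps_const c * fps_subst g T"
proof (rule fps_ext)
  fix n
  show "fps_nth (fps_subst (fps_const c * g) T) n = fps_nth (fps_const c * fps_subst g T) n"
    using nonarch_sums_mult[OF fps_subst_sums[OF assms, of n], of c]
    by (simp add: sums_iff fps_subst_nth mult.assoc)
qed

lemma fps_subst_X_power [simp]: "fps_subst (fps_X ^ m) T = T ^ m"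
proof (rule fps_ext)
  fix n
  have "(\<Sum>k. fps_nth (fps_X ^ m) k * fps_nth (T ^ k) n) = (\<Sum>k\<in>{m}. fps_nth (fps_X ^ m) k * fps_nth (T ^ k) n)"
    by (rule suminf_finite) (auto simp: fps_X_power_nth)
  then show "fps_nth (fps_subst (fps_X ^ m) T) n = fps_nth (T ^ m) n"
    by (simp add: fps_subst_nth fps_X_power_nth)
qed

lemma fps_subst_1 [simp]: "fps_subst 1 T = 1"
  using fps_subst_X_power[of 0 T] by simp

lemma fps_subst_X [simp]: "fps_subst fps_X T = T"
  using fps_subst_X_power[of 1 T] by simp

lemma fps_subst_0 [simp]: "fps_subst 0 T = 0"
  by (rule fps_ext) (simp add: fps_subst_nth)

lemma fps_subst_const [simp]: "fps_subst (fps_const c) T = fps_const c"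
proof (rule fps_ext)
  fix n
  have "(\<Sum>k. fps_nth (fps_const c) k * fps_nth (T ^ k) n) = (\<Sum>k\<in>{0}. fps_nth (fps_const c) k * fps_nth (T ^ k) n)"
    by (rule suminf_finite) auto
  then show "fps_nth (fps_subst (fps_const c) T) n = fps_nth (fps_const c) n"
    by (simp add: fps_subst_nth)
qed

lemma fps_subst_monom:
  fixes c :: "'a::{nonarch_field,complete_space}"
  assumes "fdisc T"
  shows "fps_subst (fps_const c * fps_X ^ m) T = fps_const c * T ^ m"
  by (simp add: fps_subst_const_mult[OF fbd_power[OF fbd_X] assms])

lemma fps_subst_diff:
  fixes g :: "'a::{nonarch_field,complete_space} fps"
  assumes "fbd B g" "fbd C h" "fdisc T"
  shows "fps_subst (g - h) T = fps_subst g T - fps_subst h T"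
proof (rule fps_ext)
  fix n
  show "fps_nth (fps_subst (g - h) T) n = fps_nth (fps_subst g T - fps_subst h T) n"
    using nonarch_sums_diff[OF fps_subst_sums[OF assms(1,3), of n] fps_subst_sums[OF assms(2,3), of n]]
    by (simp add: sums_iff fps_subst_nth left_diff_distrib)
qed

lemma fconv_subst:
  fixes g :: "'a::{nonarch_field,complete_space} fps"
  assumes "\<And>j. fbd B (G j)" "fconv G g" "fdisc T"
  shows "fconv (\<lambda>j. fps_subst (G j) T) (fps_subst g T)"
  unfolding fconv_def fps_subst_nth
proof
  fix n
  show "(\<lambda>j. \<Sum>k. fps_nth (G j) k * fps_nth (T ^ k) n) \<longlonglongrightarrow> (\<Sum>k. fps_nth g k * fps_nth (T ^ k) n)"
  proof (rule nonarch_tannery)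
    show "(\<lambda>j. fps_nth (G j) k * fps_nth (T ^ k) n) \<longlonglongrightarrow> fps_nth g k * fps_nth (T ^ k) n" for k
      using assms(2) by (intro tendsto_mult_right) (simp add: fconv_def)
    show "(\<lambda>k. B * vabs (fps_nth T 0) ^ (k - n)) \<longlonglongrightarrow> 0"
      by (rule fps_subst_bound_LIMSEQ[OF assms(3)])
    show "vabs (fps_nth (G j) k * fps_nth (T ^ k) n) \<le> B * vabs (fps_nth T 0) ^ (k - n)" for j k
      by (rule fps_subst_term_le[OF assms(1,3)])
  qed
qed

text \<open>By \<open>fbd_induct\<close> in each factor in turn; for two monomials the claim is the
  addition of exponents.\<close>

lemma fps_subst_mult:
  fixes g :: "'a::{nonarch_field,complete_space} fps"
  assumes g: "fbd B g" and h: "fbd C h" and T: "fdisc T"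
  shows "fps_subst (g * h) T = fps_subst g T * fps_subst h T"
  using g
proof (induction g rule: fbd_induct)
  case (monom c k)
  have "fps_subst (fps_X ^ k * h) T = T ^ k * fps_subst h T"
    using h
  proof (induction h rule: fbd_induct)
    case (monom c l)
    have *: "fps_X ^ k * (fps_const c * fps_X ^ l) = fps_const c * fps_X ^ (k + l)"
      by (simp add: power_add mult_ac)
    show ?case unfolding * fps_subst_monom[OF T] by (simp add: power_add mult_ac)
  next
    case (add f g)
    then show ?case using T
      by (simp add: ring_distribs fps_subst_add[of C _ C] fbd_mult_1[OF fbd_power[OF fbd_X]])
  next
    case (limit G g)
    have "fconv (\<lambda>j. fps_subst (fps_X ^ k * G j) T) (fps_subst (fps_X ^ k * g) T)"
      by (intro fconv_subst[where B = "1 * C"] fbd_mult fbd_power limit T fconv_mult) auto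
    moreover have "fconv (\<lambda>j. fps_subst (fps_X ^ k * G j) T) (T ^ k * fps_subst g T)"
      unfolding limit by (intro fconv_mult fconv_subst[where B = C] limit T) auto
    ultimately show ?case by (rule fconv_unique)
  qed simp
  moreover have "fbd (1 * C) (fps_X ^ k * h)" by (intro fbd_mult fbd_power h) simp
  ultimately show ?case using T
    by (simp add: fps_subst_monom mult.assoc fps_subst_const_mult)
next
  case (add f g)
  have "fps_subst (f * h + g * h) T = fps_subst (f * h) T + fps_subst (g * h) T"
    by (rule fps_subst_add[OF fbd_mult fbd_mult T]; rule add h)
  then show ?case using add T by (simp add: distrib_right fps_subst_add[of B _ B])
next
  case (limit G g)
  have "fconv (\<lambda>j. fps_subst (G j * h) T) (fps_subst (g * h) T)"
    by (intro fconv_subst[where B = "B * C"] fbd_mult limit T h fconv_mult) auto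
  moreover have "fconv (\<lambda>j. fps_subst (G j * h) T) (fps_subst g T * fps_subst h T)"
    unfolding limit by (intro fconv_mult[OF fconv_subst[where B = B] fconv_const] limit T)
  ultimately show ?case by (rule fconv_unique)
qed simp

lemma fps_subst_power:
  fixes g :: "'a::{nonarch_field,complete_space} fps"
  assumes "fbd 1 g" "fdisc T"
  shows "fps_subst (g ^ n) T = fps_subst g T ^ n"
  by (induction n) (auto simp: fps_subst_mult[OF assms(1) fbd_power[OF assms(1)] assms(2)])

lemma fps_subst_prod:
  fixes g :: "'i \<Rightarrow> 'a::{nonarch_field,complete_space} fps"
  assumes "\<And>i. i \<in> A \<Longrightarrow> fbd 1 (g i)" "fdisc T"
  shows "fps_subst (\<Prod>i\<in>A. g i) T = (\<Prod>i\<in>A. fps_subst (g i) T)"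
  using assms
  by (induction A rule: infinite_finite_induct) (auto simp: fps_subst_mult[where B = 1 and C = 1] fbd_prod)

lemma fdisc_subst:
  fixes g :: "'a::{nonarch_field,complete_space} fps"
  assumes "fdisc g" "fdisc T"
  shows "fdisc (fps_subst g T)"
  unfolding fdisc_def
proof
  show "fbd 1 (fps_subst g T)" using assms fps_subst_fbd fdisc_fbd by blast
  have g: "fbd 1 g" using assms fdisc_fbd by blast
  let ?m = "max (vabs (fps_nth g 0)) (vabs (fps_nth T 0))"
  have "vabs (fps_nth g k * fps_nth (T ^ k) 0) \<le> ?m" for k
  proof (cases k)
    case (Suc l)
    have "vabs (fps_nth g k * fps_nth (T ^ k) 0) \<le> 1 * vabs (fps_nth T 0) ^ (k - 0)"
      using fps_subst_term_le[OF g assms(2), of k 0] by simp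
    also have "\<dots> \<le> vabs (fps_nth T 0) ^ 1"
      using assms Suc power_decreasing[of 1 k "vabs (fps_nth T 0)"] by (auto simp: fdisc_def)
    finally show ?thesis by simp
  qed simp
  then have "vabs (fps_nth (fps_subst g T) 0) \<le> ?m"
    unfolding fps_subst_nth
    by (intro vabs_suminf_le sums_summable[OF fps_subst_sums[OF g assms(2)]]) (auto simp: max_def)
  then show "vabs (fps_nth (fps_subst g T) 0) < 1" using assms by (auto simp: fdisc_def)
qed

lemma fps_subst_assoc:
  fixes g :: "'a::{nonarch_field,complete_space} fps"
  assumes g: "fbd B g" and T: "fdisc T" and S: "fdisc S"
  shows "fps_subst (fps_subst g T) S = fps_subst g (fps_subst T S)"
  using g
proof (induction g rule: fbd_induct)
  case (monom c k)
  then show ?case using T S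
    by (simp add: fps_subst_monom fps_subst_const_mult[OF fbd_power] fdisc_fbd fps_subst_power fdisc_subst)
next
  case (add f g)
  then show ?case using T S
    by (simp add: fps_subst_add[where B = B and C = B] fps_subst_fbd fdisc_subst)
next
  case (limit G g)
  have "fconv (\<lambda>j. fps_subst (fps_subst (G j) T) S) (fps_subst (fps_subst g T) S)"
    by (intro fconv_subst[where B = B] fps_subst_fbd limit T S)
  moreover have "fconv (\<lambda>j. fps_subst (fps_subst (G j) T) S) (fps_subst g (fps_subst T S))"
    unfolding limit by (intro fconv_subst[where B = B] limit fdisc_subst T S)
  ultimately show ?case by (rule fconv_unique)
qed simp

lemma fps_subst_eq_compose:
  assumes "fps_nth e 0 = 0"
  shows "fps_subst g e = fps_compose g e"
proof (rule fps_ext)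
  fix n
  have "(\<Sum>k. fps_nth g k * fps_nth (e ^ k) n) = (\<Sum>k\<in>{0..n}. fps_nth g k * fps_nth (e ^ k) n)"
    using assms by (intro suminf_finite) (auto simp: startsby_zero_power_prefix)
  then show "fps_nth (fps_subst g e) n = fps_nth (fps_compose g e) n"
    by (simp add: fps_subst_nth fps_compose_nth)
qed

section \<open>Evaluation on the open unit disc, as substitution of a constant series\<close>

lemma fps_subst_fps_const: "fps_subst g (fps_const z) = fps_const (fps_value g z)"
  by (rule fps_ext) (auto simp: fps_subst_nth fps_value_def fps_const_power)

lemma fps_value_add:
  fixes g :: "'a::{nonarch_field,complete_space} fps"
  assumes "fbd B g" "fbd C h" "vabs z < 1"
  shows "fps_value (g + h) z = fps_value g z + fps_value h z"
  using fps_subst_add[OF assms(1,2), of "fps_const z"] assms(3)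
  by (simp add: fps_subst_fps_const)

lemma fps_value_diff:
  fixes g :: "'a::{nonarch_field,complete_space} fps"
  assumes "fbd B g" "fbd C h" "vabs z < 1"
  shows "fps_value (g - h) z = fps_value g z - fps_value h z"
  using fps_subst_diff[OF assms(1,2), of "fps_const z"] assms(3)
  by (simp add: fps_subst_fps_const)

lemma fps_value_mult:
  fixes g :: "'a::{nonarch_field,complete_space} fps"
  assumes "fbd B g" "fbd C h" "vabs z < 1"
  shows "fps_value (g * h) z = fps_value g z * fps_value h z"
  using fps_subst_mult[OF assms(1,2), of "fps_const z"] assms(3)
  by (simp add: fps_subst_fps_const)

lemma fps_value_power:
  fixes g :: "'a::{nonarch_field,complete_space} fps"
  assumes "fbd 1 g" "vabs z < 1"
  shows "fps_value (g ^ n) z = fps_value g z ^ n"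
  using fps_subst_power[OF assms(1), of "fps_const z" n] assms(2)
  by (simp add: fps_subst_fps_const fps_const_power)

lemma fps_value_prod:
  fixes g :: "'i \<Rightarrow> 'a::{nonarch_field,complete_space} fps"
  assumes "\<And>i. i \<in> A \<Longrightarrow> fbd 1 (g i)" "vabs z < 1"
  shows "fps_value (\<Prod>i\<in>A. g i) z = (\<Prod>i\<in>A. fps_value (g i) z)"
proof -
  have "fps_const (fps_value (\<Prod>i\<in>A. g i) z) = (\<Prod>i\<in>A. fps_const (fps_value (g i) z))"
    using fps_subst_prod[OF assms(1), where T = "fps_const z" and A = A] assms(2)
    by (simp add: fps_subst_fps_const)
  also have "\<dots> = fps_const (\<Prod>i\<in>A. fps_value (g i) z)"
    by (induction A rule: infinite_finite_induct) auto
  finally show ?thesis by simp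
qed

lemma fps_value_const [simp]: "fps_value (fps_const c) z = c"
  using arg_cong[OF fps_subst_const[of c "fps_const z"], of "\<lambda>f. fps_nth f 0"]
  by (simp only: fps_subst_fps_const fps_nth_fps_const simp_thms if_True)

lemma fps_value_0 [simp]: "fps_value 0 z = 0"
  using fps_value_const[of 0 z] by simp

lemma fps_value_1 [simp]: "fps_value 1 z = 1"
  using fps_value_const[of 1 z] by simp

lemma fps_value_X [simp]: "fps_value fps_X z = z"
  using arg_cong[OF fps_subst_X[of "fps_const z"], of "\<lambda>f. fps_nth f 0"]
  by (simp only: fps_subst_fps_const fps_nth_fps_const simp_thms if_True)

lemma fps_value_at_0 [simp]: "fps_value g 0 = fps_nth g 0"
proof -
  have "(\<Sum>n. fps_nth g n * 0 ^ n) = (\<Sum>n\<in>{0}. fps_nth g n * 0 ^ n)"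
    by (intro suminf_finite) auto
  then show ?thesis by (simp add: fps_value_def)
qed

lemma fps_value_subst:
  fixes g :: "'a::{nonarch_field,complete_space} fps"
  assumes "fbd B g" "fdisc T" "vabs z < 1"
  shows "fps_value (fps_subst g T) z = fps_value g (fps_value T z)"
  using fps_subst_assoc[OF assms(1,2), of "fps_const z"] assms(3)
  by (simp add: fps_subst_fps_const)

lemma fps_value_fdisc:
  fixes T :: "'a::{nonarch_field,complete_space} fps"
  assumes "fdisc T" "vabs z < 1"
  shows "vabs (fps_value T z) < 1"
  using fdisc_subst[OF assms(1), of "fps_const z"] assms(2) by (simp add: fps_subst_fps_const)

lemma vabs_fps_value_le:
  fixes g :: "'a::{nonarch_field,complete_space} fps"
  assumes "fbd B g" "vabs z < 1"
  shows "vabs (fps_value g z) \<le> B"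
  using fps_subst_fbd[OF assms(1), of "fps_const z"] assms fbd_nonneg[OF assms(1)]
  by (simp add: fps_subst_fps_const fbd_const)

lemma fps_value_sums:
  fixes g :: "'a::{nonarch_field,complete_space} fps"
  assumes "fbd B g" "vabs z < 1"
  shows "(\<lambda>k. fps_nth g k * z ^ k) sums fps_value g z"
  using fps_subst_sums[OF assms(1), of "fps_const z" 0] assms(2)
  by (simp add: fps_subst_fps_const fps_const_power)

lemma tendsto_fps_value:
  fixes g :: "'a::{nonarch_field,complete_space} fps"
  assumes "\<And>j. fbd B (G j)" "fconv G g" "vabs z < 1"
  shows "(\<lambda>j. fps_value (G j) z) \<longlonglongrightarrow> fps_value g z"
proof -
  have "fconv (\<lambda>j. fps_const (fps_value (G j) z)) (fps_const (fps_value g z))"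
    using fconv_subst[OF assms(1,2), of "fps_const z"] assms(3) by (simp add: fps_subst_fps_const)
  then show ?thesis unfolding fconv_def by (drule_tac x = 0 in spec) simp
qed

lemma vabs_fps_value_minus_nth_0:
  fixes g :: "'a::{nonarch_field,complete_space} fps"
  assumes "fbd B g" "vabs z < 1"
  shows "vabs (fps_value g z - fps_nth g 0) \<le> B * vabs z"
proof -
  have g: "g - fps_const (fps_nth g 0) = fps_X * fps_shift 1 g"
    by (auto simp: fps_eq_iff)
  have s: "fbd B (fps_shift 1 g)" using assms(1) by (simp add: fbd_def)
  have c: "fbd B (fps_const (fps_nth g 0))" using assms(1) fbd_nonneg by (auto simp: fbd_const fbd_def)
  have "fps_value g z - fps_nth g 0 = z * fps_value (fps_shift 1 g) z"
    using fps_value_diff[OF assms(1) c assms(2)] fps_value_mult[OF fbd_X s assms(2)] unfolding g by simp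
  then show ?thesis using vabs_fps_value_le[OF s assms(2)]
    by (metis mult.commute vabs_mult mult_left_mono vabs_nonneg)
qed

lemma fps_value_eq_0_imp_0:
  fixes g :: "'a::{nonarch_field,complete_space} fps" and z0 :: 'a
  assumes g: "fbd B g" and z0: "z0 \<noteq> 0" "vabs z0 < 1"
    and zero: "\<And>z. vabs z < 1 \<Longrightarrow> fps_value g z = 0"
  shows "g = 0"
proof (rule ccontr)
  assume nz: "g \<noteq> 0"
  define m where "m = subdegree g"
  define h where "h = fps_shift m g"
  have gh: "g = fps_X ^ m * h" unfolding h_def m_def by (metis mult.commute subdegree_decompose)
  have h: "fbd B h" using g by (simp add: fbd_def h_def)
  have h0: "fps_nth h 0 \<noteq> 0" using nz by (simp add: h_def m_def)
  have "(\<lambda>k. B * vabs z0 ^ k) \<longlonglongrightarrow> 0"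
    using z0 by (intro tendsto_mult_right_zero LIMSEQ_realpow_zero) auto
  then have "\<forall>\<^sub>F k in sequentially. B * vabs z0 ^ k < vabs (fps_nth h 0)"
    using h0 by (intro order_tendstoD(2)) auto
  then obtain k where k: "B * vabs z0 ^ Suc k < vabs (fps_nth h 0)"
    by (auto simp: eventually_sequentially intro: le_SucI)
  let ?z = "z0 ^ Suc k"
  have z: "vabs ?z < 1" unfolding vabs_power using z0 by (intro power_Suc_less_one) auto
  have "fps_value g ?z = ?z ^ m * fps_value h ?z"
    unfolding gh using fps_value_mult[OF fbd_power[OF fbd_X] h z] fps_value_power[OF fbd_X z] by simp
  then have "fps_value h ?z = 0" using zero[OF z] z0 by auto
  then show False using vabs_fps_value_minus_nth_0[OF h z] k by (simp add: vabs_power vabs_mult)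
qed

section \<open>Closed subfields\<close>

lemma tendsto_inverse_nonarch:
  assumes f: "f \<longlonglongrightarrow> (l::'a::nonarch_field)" and l: "l \<noteq> 0"
  shows "(\<lambda>n. inverse (f n)) \<longlonglongrightarrow> inverse l"
proof -
  have ev: "\<forall>\<^sub>F n in sequentially. dist (f n) l < vabs l"
    using l by (intro tendstoD[OF f]) auto
  have "(\<lambda>n. vabs (f n - l) / (vabs l * vabs l)) \<longlonglongrightarrow> 0"
    using f by (intro tendsto_divide_zero) (simp add: tendsto_vabs_iff)
  moreover have "\<forall>\<^sub>F n in sequentially. vabs (f n - l) / (vabs l * vabs l) = vabs (inverse (f n) - inverse l)"
    using ev
  proof eventually_elim
    case (elim n)
    then have "vabs (f n) = vabs l" by (intro vabs_eq_of_diff_less) (simp add: dist_vabs)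
    moreover from this l have "f n \<noteq> 0" by (metis vabs_eq_0_iff)
    moreover from this l have "inverse (f n) - inverse l = (l - f n) / (f n * l)"
      by (simp add: field_simps)
    ultimately show ?case by (simp add: vabs_divide vabs_mult vabs_minus_commute)
  qed
  ultimately show ?thesis unfolding tendsto_vabs_iff[of _ "inverse l"]
    by (rule Lim_transform_eventually)
qed

lemma fps_inverse_nth_Suc:
  "fps_nth (inverse (f :: 'a::field fps)) (Suc n) =
     - inverse (fps_nth f 0) * (\<Sum>i=1..Suc n. fps_nth f i * fps_nth (inverse f) (Suc n - i))"
  by (simp add: fps_inverse_def)

definition fps_over :: "'a::nonarch_field set \<Rightarrow> 'a fps set" where
  "fps_over L = {f. \<forall>n. fps_nth f n \<in> L}"

lemma int_fps_iff: "f \<in> int_fps L \<longleftrightarrow> f \<in> fps_over L \<and> fbd 1 f"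
  by (auto simp: int_fps_def fps_over_def fbd_def ring_of_integers_def)

text \<open>Closedness is the property shared by K and the fields of the tower that keeps limits of
  coefficients and values of series inside the field.\<close>

locale closed_subfield =
  fixes L :: "'a::{nonarch_field,complete_space} set"
  assumes one: "1 \<in> L"
    and diff: "x \<in> L \<Longrightarrow> y \<in> L \<Longrightarrow> x - y \<in> L"
    and mult: "x \<in> L \<Longrightarrow> y \<in> L \<Longrightarrow> x * y \<in> L"
    and inv: "x \<in> L \<Longrightarrow> inverse x \<in> L"
    and closed: "closed L"
begin

lemma zero: "0 \<in> L"
  using diff[OF one one] by simp

lemma uminus: "x \<in> L \<Longrightarrow> - x \<in> L"
  using diff[OF zero] by simp

lemma add: "x \<in> L \<Longrightarrow> y \<in> L \<Longrightarrow> x + y \<in> L"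
  using diff[of x "- y"] uminus by simp

lemma divide: "x \<in> L \<Longrightarrow> y \<in> L \<Longrightarrow> x / y \<in> L"
  by (simp add: divide_inverse mult inv)

lemma of_nat: "of_nat n \<in> L"
  by (induction n) (auto intro: add zero one)

lemma power: "x \<in> L \<Longrightarrow> x ^ n \<in> L"
  by (induction n) (auto intro: mult one)

lemma sum: "(\<And>i. i \<in> A \<Longrightarrow> f i \<in> L) \<Longrightarrow> (\<Sum>i\<in>A. f i) \<in> L"
  by (induction A rule: infinite_finite_induct) (auto intro: add zero)

lemma limit: "f \<longlonglongrightarrow> l \<Longrightarrow> (\<And>n. f n \<in> L) \<Longrightarrow> l \<in> L"
  using closed unfolding closed_sequential_limits by blast

lemma sums: "f sums l \<Longrightarrow> (\<And>n. f n \<in> L) \<Longrightarrow> l \<in> L"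
  unfolding sums_def by (rule limit) (auto intro: sum)

lemma fps_over_intros:
  "0 \<in> fps_over L" "1 \<in> fps_over L" "fps_X \<in> fps_over L"
  "c \<in> L \<Longrightarrow> fps_const c \<in> fps_over L"
  "f \<in> fps_over L \<Longrightarrow> g \<in> fps_over L \<Longrightarrow> f + g \<in> fps_over L"
  "f \<in> fps_over L \<Longrightarrow> g \<in> fps_over L \<Longrightarrow> f - g \<in> fps_over L"
  "f \<in> fps_over L \<Longrightarrow> g \<in> fps_over L \<Longrightarrow> f * g \<in> fps_over L"
  by (auto simp: fps_over_def fps_mult_nth fps_X_nth intro: zero one add diff mult sum)

lemma fps_over_power: "f \<in> fps_over L \<Longrightarrow> f ^ n \<in> fps_over L"
  by (induction n) (auto intro: fps_over_intros)

lemma fps_over_prod: "(\<And>i. i \<in> A \<Longrightarrow> f i \<in> fps_over L) \<Longrightarrow> (\<Prod>i\<in>A. f i) \<in> fps_over L"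
  by (induction A rule: infinite_finite_induct) (auto intro: fps_over_intros)

lemma fps_over_nth: "f \<in> fps_over L \<Longrightarrow> fps_nth f n \<in> L"
  by (simp add: fps_over_def)

lemma fps_over_limit: "fconv F f \<Longrightarrow> (\<And>j. F j \<in> fps_over L) \<Longrightarrow> f \<in> fps_over L"
  unfolding fconv_def fps_over_def by (blast intro: limit)

lemma fps_over_subst:
  assumes "fbd B g" "fdisc T" "g \<in> fps_over L" "T \<in> fps_over L"
  shows "fps_subst g T \<in> fps_over L"
proof -
  have "fps_nth (fps_subst g T) n \<in> L" for n
    using assms by (intro sums[OF fps_subst_sums[OF assms(1,2)]] mult fps_over_nth fps_over_power)
  then show ?thesis by (simp add: fps_over_def)
qed

lemma fps_value_in:
  assumes "fbd B g" "vabs z < 1" "g \<in> fps_over L" "z \<in> L"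
  shows "fps_value g z \<in> L"
  using assms by (intro sums[OF fps_value_sums[OF assms(1,2)]] mult power fps_over_nth)

lemma fps_over_compose: "f \<in> fps_over L \<Longrightarrow> g \<in> fps_over L \<Longrightarrow> fps_compose f g \<in> fps_over L"
  unfolding fps_over_def[of L] mem_Collect_eq fps_compose_nth
  by (intro allI sum mult fps_over_nth fps_over_power) (simp_all add: fps_over_def)

lemma fps_over_inverse:
  assumes "f \<in> fps_over L"
  shows "inverse f \<in> fps_over L"
proof -
  have "fps_nth (inverse f) n \<in> L" for n
  proof (induction n rule: less_induct)
    case (less n)
    show ?case
    proof (cases n)
      case 0
      then show ?thesis using assms by (auto simp: fps_inverse_def intro: inv fps_over_nth)
    next
      case (Suc m)
      have "fps_nth (inverse f) n = - inverse (fps_nth f 0) * (\<Sum>i=1..n. fps_nth f i * fps_nth (inverse f) (n - i))"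
        using Suc by (simp only: fps_inverse_nth_Suc)
      also have "\<dots> \<in> L"
        using less by (intro mult uminus inv fps_over_nth[OF assms] sum) auto
      finally show ?thesis .
    qed
  qed
  then show ?thesis by (simp add: fps_over_def)
qed

lemma int_fps_intros:
  "0 \<in> int_fps L" "1 \<in> int_fps L"
  "f \<in> int_fps L \<Longrightarrow> g \<in> int_fps L \<Longrightarrow> f + g \<in> int_fps L"
  "f \<in> int_fps L \<Longrightarrow> g \<in> int_fps L \<Longrightarrow> f - g \<in> int_fps L"
  "f \<in> int_fps L \<Longrightarrow> g \<in> int_fps L \<Longrightarrow> f * g \<in> int_fps L"
  by (auto simp: int_fps_iff intro: fps_over_intros fbd_add fbd_diff fbd_mult_1)

end

lemma fbd_inverse:
  fixes f :: "'a::nonarch_field fps"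
  assumes "fbd 1 f" "vabs (fps_nth f 0) = 1"
  shows "fbd 1 (inverse f)"
proof -
  have "vabs (fps_nth (inverse f) n) \<le> 1" for n
  proof (induction n rule: less_induct)
    case (less n)
    show ?case
    proof (cases n)
      case 0
      then show ?thesis using assms by (simp add: fps_inverse_def vabs_inverse)
    next
      case (Suc m)
      have "fps_nth (inverse f) n = - inverse (fps_nth f 0) * (\<Sum>i=1..n. fps_nth f i * fps_nth (inverse f) (n - i))"
        using Suc by (simp only: fps_inverse_nth_Suc)
      also have "vabs \<dots> \<le> 1"
        using less assms by (intro vabs_mult_le_1 vabs_sum_le) (auto simp: vabs_inverse fbd_def)
      finally show ?thesis .
    qed
  qed
  then show ?thesis by (simp add: fbd_def)
qed

text \<open>A point \<open>b\<close> outside the closed set \<open>E\<close> has positive distance d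
  from it, so by scaling |c| d is at most |c b + v|. Hence in a convergent sequence c_n b + v_n the
  coefficients c_n form a Cauchy sequence.\<close>

lemma (in closed_subfield) closed_line_extension:
  assumes E: "closed E" and E_add: "\<And>x y. x \<in> E \<Longrightarrow> y \<in> E \<Longrightarrow> x + y \<in> E"
    and E_scale: "\<And>c x. c \<in> L \<Longrightarrow> x \<in> E \<Longrightarrow> c * x \<in> E" and E0: "0 \<in> E" and b: "b \<notin> E"
  shows "closed {c * b + v | c v. c \<in> L \<and> v \<in> E}"
  unfolding closed_sequential_limits
proof (intro allI impI, elim conjE)
  fix s l assume s: "\<forall>n. s n \<in> {c * b + v | c v. c \<in> L \<and> v \<in> E}" and l: "s \<longlonglongrightarrow> l"
  obtain d where d: "d > 0" "\<And>v. v \<in> E \<Longrightarrow> d \<le> vabs (b + v)"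
  proof -
    obtain d where d: "d > 0" "ball b d \<subseteq> - E"
      using open_contains_ball[of "- E"] E b by (auto simp: open_Compl)
    have "d \<le> vabs (b + v)" if v: "v \<in> E" for v
    proof (rule ccontr)
      assume "\<not> d \<le> vabs (b + v)"
      then have "- v \<in> ball b d" by (simp add: dist_vabs)
      then show False using d E_scale[OF uminus[OF one] v] by auto
    qed
    with d(1) show ?thesis by (rule that)
  qed
  have *: "vabs c * d \<le> vabs (c * b + v)" if "c \<in> L" "v \<in> E" for c v
  proof (cases "c = 0")
    case False
    have "c * b + v = c * (b + inverse c * v)" using False by (simp add: field_simps)
    then show ?thesis using d(2)[OF E_scale[OF inv[OF that(1)] that(2)]]
      by (simp add: vabs_mult mult_left_mono)
  qed simp
  from s obtain c v where cv: "\<And>n. c n \<in> L" "\<And>n. v n \<in> E" "\<And>n. s n = c n * b + v n"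
    unfolding mem_Collect_eq by metis
  have "Cauchy c"
  proof (rule metric_CauchyI)
    fix e :: real assume "0 < e"
    then have "0 < e * d" using d by simp
    then obtain M where M: "\<And>m n. m \<ge> M \<Longrightarrow> n \<ge> M \<Longrightarrow> dist (s m) (s n) < e * d"
      using metric_CauchyD[OF LIMSEQ_imp_Cauchy[OF l]] by blast
    have "dist (c m) (c n) < e" if "m \<ge> M" "n \<ge> M" for m n
    proof -
      have "s m - s n = (c m - c n) * b + (v m + - 1 * v n)"
        by (simp add: cv algebra_simps)
      then have "vabs (c m - c n) * d \<le> vabs (s m - s n)"
        using *[OF diff[OF cv(1) cv(1)] E_add[OF cv(2) E_scale[OF uminus[OF one] cv(2)]]] by simp
      then have "vabs (c m - c n) * d < e * d" using M[OF that] by (simp add: dist_vabs)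
      then show ?thesis using d by (simp add: dist_vabs)
    qed
    then show "\<exists>M. \<forall>m\<ge>M. \<forall>n\<ge>M. dist (c m) (c n) < e" by blast
  qed
  then obtain k where k: "c \<longlonglongrightarrow> k" using Cauchy_convergent_iff convergent_def by blast
  have "(\<lambda>n. s n - c n * b) \<longlonglongrightarrow> l - k * b" by (intro tendsto_diff l tendsto_mult k tendsto_const)
  then have "v \<longlonglongrightarrow> l - k * b" by (simp add: cv)
  then have "l - k * b \<in> E" using E cv(2) unfolding closed_sequential_limits by blast
  moreover have "k \<in> L" by (rule limit[OF k cv(1)])
  ultimately show "l \<in> {c * b + v | c v. c \<in> L \<and> v \<in> E}"
    by (intro CollectI exI[of _ k] exI[of _ "l - k * b"]) simp
qed

lemma closed_subfield_Qp: "closed_subfield (Qp :: 'a::{nonarch_field,complete_space} set)"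
proof
  show "1 \<in> (Qp :: 'a set)" unfolding Qp_def by (rule subsetD[OF closure_subset]) simp
  show "closed (Qp :: 'a set)" by (simp add: Qp_def)
  fix x y :: 'a
  assume x: "x \<in> Qp"
  then obtain s where s: "\<And>n. s n \<in> \<rat>" "s \<longlonglongrightarrow> x" unfolding Qp_def closure_sequential by blast
  show "inverse x \<in> Qp"
  proof (cases "x = 0")
    case False
    have "(\<lambda>n. inverse (s n)) \<longlonglongrightarrow> inverse x" by (rule tendsto_inverse_nonarch[OF s(2) False])
    then show ?thesis unfolding Qp_def closure_sequential
      by (intro exI[of _ "\<lambda>n. inverse (s n)"]) (auto intro: s)
  qed (use x in simp)
  assume "y \<in> Qp"
  then obtain t where t: "\<And>n. t n \<in> \<rat>" "t \<longlonglongrightarrow> y" unfolding Qp_def closure_sequential by blast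
  show "x - y \<in> Qp" unfolding Qp_def closure_sequential
    by (intro exI[of _ "\<lambda>n. s n - t n"]) (simp add: s t tendsto_diff)
  show "x * y \<in> Qp" unfolding Qp_def closure_sequential
    by (intro exI[of _ "\<lambda>n. s n * t n"]) (simp add: s t tendsto_mult)
qed

lemma ring_of_type_algebra_simps [simp]:
  "carrier ring_of_type_algebra = UNIV" "\<one>\<^bsub>ring_of_type_algebra\<^esub> = 1" "\<zero>\<^bsub>ring_of_type_algebra\<^esub> = 0"
  "x \<otimes>\<^bsub>ring_of_type_algebra\<^esub> y = x * y" "x \<oplus>\<^bsub>ring_of_type_algebra\<^esub> y = x + y"
  by (simp_all add: ring_of_type_algebra_def)

lemma a_inv_ring_of_type_algebra [simp]: "\<ominus>\<^bsub>ring_of_type_algebra\<^esub> (x::'a::field) = - x"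
proof -
  interpret R: field "ring_of_type_algebra :: 'a ring" by (rule field_from_type_algebra)
  show ?thesis using R.minus_equality[of "- x" x] by simp
qed

lemma m_inv_ring_of_type_algebra [simp]: "(x::'a::field) \<noteq> 0 \<Longrightarrow> inv\<^bsub>ring_of_type_algebra\<^esub> x = inverse x"
proof -
  interpret R: field "ring_of_type_algebra :: 'a ring" by (rule field_from_type_algebra)
  assume "x \<noteq> 0"
  then show ?thesis using R.inv_unique'[of x "inverse x"] by simp
qed

lemma subfield_closures:
  assumes "subfield (K :: 'a::field set) ring_of_type_algebra"
  shows "1 \<in> K" "x \<in> K \<Longrightarrow> y \<in> K \<Longrightarrow> x - y \<in> K" "x \<in> K \<Longrightarrow> y \<in> K \<Longrightarrow> x * y \<in> K"
    "x \<in> K \<Longrightarrow> inverse x \<in> K"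
proof -
  interpret R: field "ring_of_type_algebra :: 'a ring" by (rule field_from_type_algebra)
  note sr = subfieldE(1)[OF assms]
  show "1 \<in> K" using subringE(3)[OF sr] by simp
  show "x \<in> K \<Longrightarrow> y \<in> K \<Longrightarrow> x * y \<in> K" using subringE(6)[OF sr, of x y] by simp
  show "x \<in> K \<Longrightarrow> y \<in> K \<Longrightarrow> x - y \<in> K"
    using subringE(7)[OF sr, of x "- y"] subringE(5)[OF sr, of y] by simp
  show "x \<in> K \<Longrightarrow> inverse x \<in> K"
    using R.subfield_m_inv(1)[OF assms, of x] by (cases "x = 0") auto
qed

lemma (in closed_subfield) subfield: "subfield L ring_of_type_algebra"
proof -
  interpret R: field "ring_of_type_algebra :: 'a ring" by (rule field_from_type_algebra)
  show ?thesis
    by (intro R.subfieldI' R.subringI) (auto intro: one uminus add mult inv)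
qed

lemma (in closed_subfield) ring_of_integers_cring: "cring (subring_of (ring_of_integers L))"
proof -
  interpret R: field "ring_of_type_algebra :: 'a ring" by (rule field_from_type_algebra)
  have "subring (ring_of_integers L) ring_of_type_algebra"
    by (rule R.subringI)
      (auto simp: ring_of_integers_def intro: one uminus add mult vabs_add_le vabs_mult_le_1)
  then show ?thesis using R.subcringI' R.subcring_iff[of "ring_of_integers L"] by simp
qed

text \<open>A finite dimensional space over Q_p is built from 0 by adding one line at a time, and
  each addition preserves closedness by \<open>closed_line_extension\<close>.\<close>

lemma finite_ext_Qp_closed_subfield:
  assumes "finite_ext_Qp (K :: 'a::{nonarch_field,complete_space} set)"
  shows "closed_subfield K"
proof -
  interpret Q: closed_subfield "Qp :: 'a set" by (rule closed_subfield_Qp)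
  interpret R: field "ring_of_type_algebra :: 'a ring" by (rule field_from_type_algebra)
  have sub: "subfield K ring_of_type_algebra" and "R.finite_dimension Qp K"
    using assms by (auto simp: finite_ext_Qp_def)
  then obtain n where n: "R.dimension n Qp K" by (auto simp: R.finite_dimension_def)
  have "closed E \<and> 0 \<in> E \<and> (\<forall>x\<in>E. \<forall>y\<in>E. x + y \<in> E) \<and> (\<forall>c\<in>Qp. \<forall>x\<in>E. c * x \<in> E)"
    if "R.dimension n Qp E" for n and E :: "'a set"
    using that
  proof (induction n "Qp :: 'a set" E rule: R.dimension.induct)
    case zero_dim
    then show ?case by simp
  next
    case (Suc_dim v E n)
    have le: "R.line_extension Qp v E = {c * v + w | c w. c \<in> Qp \<and> w \<in> E}"
      unfolding set_eq_iff R.line_extension_mem_iff by (simp add: Bex_def) metis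
    have 1: "closed {c * v + w | c w. c \<in> Qp \<and> w \<in> E}"
      using Suc_dim by (intro Q.closed_line_extension) auto
    have 2: "0 \<in> {c * v + w | c w. c \<in> Qp \<and> w \<in> E}"
      using Suc_dim Q.zero by (intro CollectI exI[of _ 0]) auto
    have 3: "x + y \<in> {c * v + w | c w. c \<in> Qp \<and> w \<in> E}"
      if "x \<in> {c * v + w | c w. c \<in> Qp \<and> w \<in> E}" "y \<in> {c * v + w | c w. c \<in> Qp \<and> w \<in> E}" for x y
    proof -
      from that obtain c w c' w' where "x = c * v + w" "y = c' * v + w'" "c \<in> Qp" "c' \<in> Qp" "w \<in> E" "w' \<in> E"
        by blast
      then show ?thesis using Suc_dim
        by (intro CollectI exI[of _ "c + c'"] exI[of _ "w + w'"]) (auto simp: algebra_simps Q.add)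
    qed
    have 4: "k * x \<in> {c * v + w | c w. c \<in> Qp \<and> w \<in> E}"
      if "x \<in> {c * v + w | c w. c \<in> Qp \<and> w \<in> E}" "k \<in> Qp" for x k
    proof -
      from that obtain c w where "x = c * v + w" "c \<in> Qp" "w \<in> E" by blast
      then show ?thesis using Suc_dim that
        by (intro CollectI exI[of _ "k * c"] exI[of _ "k * w"]) (auto simp: algebra_simps Q.mult)
    qed
    from 1 2 3 4 show ?case unfolding le by blast
  qed
  from this[OF n] show ?thesis
    by (intro closed_subfield.intro) (auto intro: subfield_closures[OF sub])
qed

section \<open>The multiplicative formal group over a p-adic field\<close>

lemma tendsto_gbinomial:
  fixes l :: "'a::nonarch_field"
  assumes "f \<longlonglongrightarrow> l"
  shows "(\<lambda>j. f j gchoose k) \<longlonglongrightarrow> l gchoose k"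
  unfolding gbinomial_prod_rev divide_inverse
  by (intro tendsto_mult tendsto_prod' tendsto_diff assms tendsto_const)

lemma gbinomial_minus_1: "(- 1 :: 'a::field_char_0) gchoose k = (- 1) ^ k"
  using gbinomial_minus[of "1::'a" k] by (simp flip: binomial_gbinomial)

text \<open>If n had absolute value below 1 as well, a Bezout relation a n + b p = 1 would force the
  same on 1.\<close>

lemma coprime_imp_vabs_of_nat:
  assumes "vabs (of_nat p :: 'a::nonarch_field) < 1" "coprime n p"
  shows "vabs (of_nat n :: 'a) = 1"
proof (rule ccontr)
  assume "vabs (of_nat n :: 'a) \<noteq> 1"
  then have n: "vabs (of_nat n :: 'a) < 1" using vabs_of_nat_le_1[of n, where 'a = 'a] by linarith
  obtain a b where ab: "a * int n + b * int p = 1"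
    using assms(2) bezout_int[of "int n" "int p"] by (auto simp flip: coprime_iff_gcd_eq_1)
  have "of_int a * of_nat n + of_int b * of_nat p = (of_int (a * int n + b * int p) :: 'a)" by simp
  also have "\<dots> = 1" using ab by simp
  finally have "vabs (of_int a * of_nat n + of_int b * of_nat p :: 'a) = 1" by simp
  moreover have "vabs (of_int a * of_nat n :: 'a) < 1" "vabs (of_int b * of_nat p :: 'a) < 1"
    unfolding vabs_mult using n assms(1) vabs_of_int_le_1[of a, where 'a = 'a] vabs_of_int_le_1[of b, where 'a = 'a]
    by (meson mult_left_le_one_le order.strict_trans1 vabs_nonneg)+
  ultimately show False using vabs_add_less by fastforce
qed

definition pbinom_approx :: "nat \<Rightarrow> 'a::nonarch_field fps \<Rightarrow> 'a fps" where
  "pbinom_approx P f = fps_const (1 / of_nat P) * ((1 + f) ^ P - 1)"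

locale padic_field =
  fixes p :: nat and K :: "'a::{nonarch_field, complete_space} set"
  assumes prime_p: "prime p" and vabs_p: "vabs (of_nat p :: 'a) = 1 / real p"
    and finite_ext: "finite_ext_Qp K"

sublocale padic_field \<subseteq> K: closed_subfield K
  by (rule finite_ext_Qp_closed_subfield[OF finite_ext])

context padic_field
begin

lemma p_gt_1: "1 < p"
  using prime_p by (rule prime_gt_1_nat)

lemma vabs_p_less_1: "vabs (of_nat p :: 'a) < 1"
  using p_gt_1 by (simp add: vabs_p)

lemma vabs_of_nat_coprime: "coprime n p \<Longrightarrow> vabs (of_nat n :: 'a) = 1"
  by (rule coprime_imp_vabs_of_nat[OF vabs_p_less_1])

text \<open>Controls the denominators of the logarithm: 1/k has absolute value at most k, which
  grows more slowly than the powers of p.\<close>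

lemma vabs_of_nat_ge:
  assumes "0 < n"
  shows "1 / real n \<le> vabs (of_nat n :: 'a)"
proof -
  obtain m where m: "n = p ^ multiplicity p n * m" "\<not> p dvd m"
    using multiplicity_decompose'[of n p] assms p_gt_1 by (metis dvd_1_iff_1 neq0_conv less_irrefl One_nat_def)
  have "coprime m p" using m(2) prime_p by (metis coprime_commute prime_imp_coprime)
  then have "vabs (of_nat n :: 'a) = 1 / real (p ^ multiplicity p n)"
    by (subst m(1)) (simp add: vabs_mult vabs_power vabs_p vabs_of_nat_coprime power_one_over)
  moreover have "real (p ^ multiplicity p n) \<le> real n"
    unfolding of_nat_le_iff using assms by (intro dvd_imp_le multiplicity_dvd)
  moreover have "0 < real (p ^ multiplicity p n)" using p_gt_1 by simp
  ultimately show ?thesis by (simp add: frac_le)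
qed

lemma vabs_of_int_dvd:
  assumes "int (p ^ j) dvd m"
  shows "vabs (of_int m :: 'a) \<le> (1 / real p) ^ j"
proof -
  obtain k where "m = int (p ^ j) * k" using assms by blast
  then have "vabs (of_int m :: 'a) = (1 / real p) ^ j * vabs (of_int k :: 'a)"
    by (simp add: vabs_mult vabs_power vabs_p)
  then show ?thesis by (simp add: mult_left_le)
qed

lemma LIMSEQ_p_power: "(\<lambda>j. (1 / real p) ^ j) \<longlonglongrightarrow> 0"
  using p_gt_1 by (intro LIMSEQ_realpow_zero) auto

text \<open>Density of the natural numbers in Z_p. It allows each identity for [a] to be deduced
  from the one for powers with natural exponents.\<close>

lemma Zp_approx:
  assumes a: "a \<in> (Qp :: 'a set)" "vabs a \<le> 1"
  shows "\<exists>c::nat. vabs (of_nat c - a) \<le> (1 / real p) ^ j"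
proof -
  have pj: "0 < (1 / real p) ^ j" "(1 / real p) ^ j \<le> 1" using p_gt_1 by (auto intro: power_le_one)
  obtain x where x: "x \<in> \<rat>" "vabs (x - a) < (1 / real p) ^ j"
    using a(1) pj(1) unfolding Qp_def closure_approachable dist_vabs by blast
  obtain r :: rat where r: "x = of_rat r" using x(1) by (auto elim: Rats_cases)
  obtain m n where mn: "r = of_int m / of_int n" "0 < n" "coprime m n"
    using Rat_cases[of r] unfolding Fract_of_int_quotient by blast
  have x_eq: "x = of_int m / of_int n" unfolding r mn(1) by (simp add: of_rat_divide)
  have "vabs (x - a + a) \<le> 1" using x(2) pj a by (intro vabs_add_le) auto
  then have "vabs x \<le> 1" by simp
  then have le: "vabs (of_int m :: 'a) \<le> vabs (of_int n :: 'a)" using mn(2) by (simp add: x_eq vabs_divide divide_le_eq_1_pos)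
  have n_eq: "(of_int n :: 'a) = of_nat (nat n)" using mn(2) by simp
  \<comment> \<open>In lowest terms p cannot divide the denominator: it would then not divide the
    numerator, and |m| = 1 would exceed |n|.\<close>
  have "coprime n (int p)"
  proof (rule ccontr)
    assume "\<not> coprime n (int p)"
    then have pn: "int p dvd n" using prime_p by (metis coprime_commute prime_imp_coprime prime_int_nat_transfer nat_int of_nat_0_le_iff)
    then have "\<not> int p dvd m" using mn(3) prime_p
      by (metis coprime_common_divisor not_prime_unit prime_int_nat_transfer nat_int of_nat_0_le_iff)
    then have "coprime (int p) m" using prime_p by (metis prime_imp_coprime prime_int_nat_transfer nat_int of_nat_0_le_iff)
    then have "coprime (nat \<bar>m\<bar>) p"
      by (metis coprime_commute coprime_int_iff coprime_abs_left_iff int_nat_eq abs_ge_zero)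
    then have "vabs (of_nat (nat \<bar>m\<bar>) :: 'a) = 1" by (rule vabs_of_nat_coprime)
    then have "vabs (of_int m :: 'a) = 1" by (cases "0 \<le> m") (auto simp: of_nat_nat abs_if split: if_splits)
    moreover have "vabs (of_int n :: 'a) \<le> (1 / real p) ^ 1" using pn by (intro vabs_of_int_dvd) simp
    moreover have "1 / real p < 1" using p_gt_1 by simp
    ultimately show False using le by simp
  qed
  then have "coprime n (int (p ^ j))" by simp
  then obtain b b' where b: "b * n + b' * int (p ^ j) = 1"
    using bezout_int[of n "int (p ^ j)"] by (auto simp flip: coprime_iff_gcd_eq_1)
  \<comment> \<open>Here \<open>b\<close> inverts n modulo p^j, so c is the residue of m / n modulo
    p^j.\<close>
  define c where "c = nat ((m * b) mod int (p ^ j))"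
  have c: "int c = (m * b) mod int (p ^ j)" using p_gt_1 by (simp add: c_def)
  have n1: "vabs (of_int n :: 'a) = 1"
    unfolding n_eq using \<open>coprime n (int p)\<close> mn(2)
    by (intro vabs_of_nat_coprime) (metis coprime_int_iff int_nat_eq less_imp_le)
  have "n * b - 1 = - b' * int (p ^ j)" using b by (simp add: algebra_simps)
  then have "int (p ^ j) dvd m * (n * b - 1)" by simp
  then have "vabs (of_int (m * (n * b - 1)) :: 'a) \<le> (1 / real p) ^ j" by (rule vabs_of_int_dvd)
  moreover have "(of_int (m * b) - x :: 'a) = of_int (m * (n * b - 1)) / of_int n"
    using mn(2) by (simp add: x_eq field_simps)
  ultimately have 1: "vabs (of_int (m * b) - x :: 'a) \<le> (1 / real p) ^ j" using n1 by (simp add: vabs_divide)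
  have "int (p ^ j) dvd int c - m * b" unfolding c by (metis dvd_minus_mod dvd_diff_commute)
  then have "vabs (of_int (int c - m * b) :: 'a) \<le> (1 / real p) ^ j" by (rule vabs_of_int_dvd)
  then have 2: "vabs (of_nat c - of_int (m * b) :: 'a) \<le> (1 / real p) ^ j" by simp
  have "of_nat c - a = (of_nat c - of_int (m * b)) + ((of_int (m * b) - x) + (x - a))" by simp
  also have "vabs \<dots> \<le> (1 / real p) ^ j" using 1 2 x(2) by (intro vabs_add_le) auto
  finally show ?thesis by blast
qed

lemma Zp_limit:
  assumes "a \<in> (Qp :: 'a set)" "vabs a \<le> 1"
  obtains s where "(\<lambda>j. of_nat (s j)) \<longlonglongrightarrow> a"
proof -
  obtain s where "\<And>j. vabs (of_nat (s j) - a) \<le> (1 / real p) ^ j" using Zp_approx[OF assms] by metis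
  then have "(\<lambda>j. of_nat (s j)) \<longlonglongrightarrow> a" by (rule tendsto_vabs_bound[OF LIMSEQ_p_power])
  then show ?thesis by (rule that)
qed

lemma Qp_subset: "Qp \<subseteq> K"
  using finite_ext by (simp add: finite_ext_Qp_def)

text \<open>Binomial coefficients are polynomials in the upper argument, hence continuous, and at
  natural numbers they are integers.\<close>

lemma fbd_binomial:
  assumes "a \<in> (Qp :: 'a set)" "vabs a \<le> 1"
  shows "fbd 1 (fps_binomial a)"
proof -
  obtain s where s: "(\<lambda>j. of_nat (s j)) \<longlonglongrightarrow> a" using Zp_limit[OF assms] .
  have "vabs (a gchoose k) \<le> 1" for k
    by (rule vabs_limit_le[OF tendsto_gbinomial[OF s]]) (simp flip: binomial_gbinomial)
  then show ?thesis by (simp add: fbd_def)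
qed

lemma gm_smult_eq:
  assumes "a \<in> (Qp :: 'a set)" "vabs a \<le> 1" "fdisc f"
  shows "gm_smult a f = fps_subst (fps_binomial a) f - 1"
  unfolding gm_smult_def using fps_subst_diff[OF fbd_binomial[OF assms(1,2)] _ assms(3), of 1 1] by simp

lemma of_nat_in_Qp: "of_nat n \<in> (Qp :: 'a set)"
  by (rule closed_subfield.of_nat[OF closed_subfield_Qp])

lemma gm_smult_of_nat:
  assumes "fdisc (f :: 'a fps)"
  shows "gm_smult (of_nat n) f = (1 + f) ^ n - 1"
proof -
  have "fps_subst (fps_binomial (of_nat n)) f = fps_subst ((1 + fps_X) ^ n) f"
    by (simp add: fps_binomial_of_nat)
  also have "\<dots> = (1 + f) ^ n"
    using fps_subst_power[of "1 + fps_X" f n] fps_subst_add[OF _ fbd_X assms, of 1 1] assms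
    by (simp add: fbd_add)
  finally show ?thesis using gm_smult_eq[OF of_nat_in_Qp _ assms, of n] by simp
qed

text \<open>The form in which [a] is used: 1 + [a](f) is the limit of powers of 1 + f along natural
  exponents tending to a.\<close>

lemma fconv_gm_smult:
  assumes a: "a \<in> (Qp :: 'a set)" "vabs a \<le> 1" and f: "fdisc f" and s: "(\<lambda>j. of_nat (s j)) \<longlonglongrightarrow> a"
  shows "fconv (\<lambda>j. (1 + f) ^ s j - 1) (gm_smult a f)"
proof -
  have "fconv (\<lambda>j. fps_binomial (of_nat (s j))) (fps_binomial a)"
    unfolding fconv_def using tendsto_gbinomial[OF s] by simp
  then have "fconv (\<lambda>j. fps_subst (fps_binomial (of_nat (s j))) f) (fps_subst (fps_binomial a) f)"
    by (intro fconv_subst[where B = 1] fbd_binomial of_nat_in_Qp f) auto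
  then have "fconv (\<lambda>j. fps_subst (fps_binomial (of_nat (s j))) f - 1) (gm_smult a f)"
    unfolding gm_smult_eq[OF a f] by (intro fconv_diff fconv_const)
  moreover have "fps_subst (fps_binomial (of_nat (s j))) f - 1 = (1 + f) ^ s j - 1" for j
    using gm_smult_eq[OF of_nat_in_Qp _ f, of "s j"] gm_smult_of_nat[OF f, of "s j"] by simp
  ultimately show ?thesis by simp
qed

section \<open>Convergence and integrality of the logarithm on series divisible by p\<close>

lemma one_over_p_powser: "(\<lambda>k. real k * (1 / real p) ^ k) \<longlonglongrightarrow> 0"
  using powser_times_n_limit_0[of "1 / real p"] p_gt_1 by simp

text \<open>For k > 0 this is k \<le> p^(k-1). It makes the logarithm of a series divisible by p
  again divisible by p.\<close>

lemma k_times_p_power_le: "real k * (1 / real p) ^ k \<le> 1 / real p"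
proof (cases k)
  case (Suc m)
  have "Suc m \<le> p ^ m"
  proof (induction m)
    case (Suc m)
    have "Suc (Suc m) \<le> 2 * p ^ m" using Suc by simp
    also have "\<dots> \<le> p * p ^ m" using p_gt_1 by (intro mult_right_mono) auto
    finally show ?case by simp
  qed simp
  then have "real (Suc m) \<le> real p ^ m" by (metis of_nat_le_iff of_nat_power)
  then show ?thesis using p_gt_1 Suc by (simp add: field_simps power_one_over del: of_nat_Suc)
qed (use p_gt_1 in simp)

lemma fbd_p_power_nth:
  assumes "fbd (1 / real p) f"
  shows "vabs (fps_nth (f ^ k) n) \<le> (1 / real p) ^ k"
proof -
  have "fbd ((1 / real p) ^ k) (f ^ k)"
  proof (induction k)
    case (Suc k)
    then show ?case unfolding power_Suc by (rule fbd_mult[OF assms])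
  qed simp
  then show ?thesis by (rule fbdD)
qed

text \<open>The factor \<open>c\<close> is kept general to cover both the signs in the logarithm and
  the binomial coefficients in its approximants.\<close>

lemma gm_log_term_le:
  assumes f: "fbd (1 / real p) (f :: 'a fps)" and c: "vabs c \<le> 1"
  shows "vabs ((if k = 0 then 0 else c / of_nat k) * fps_nth (f ^ k) n) \<le> real k * (1 / real p) ^ k"
proof (cases "k = 0")
  case False
  have "vabs (c / of_nat k) \<le> 1 / (1 / real k)"
    unfolding vabs_divide using c False vabs_of_nat_ge[of k] by (intro frac_le) auto
  then show ?thesis using False fbd_p_power_nth[OF f, of k n] vabs_mult_le by fastforce
qed simp

lemma gm_log_nth:
  "fps_nth (gm_log f) n = (\<Sum>k. (if k = 0 then 0 else (- 1) ^ (k - 1) / of_nat k) * fps_nth (f ^ k) n)"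
  unfolding gm_log_def fps_subst_nth fps_ln_nth by (intro suminf_cong) auto

text \<open>By k binom(P, k) = P binom(P-1, k-1), the approximant is the logarithm series with the
  sign (-1)^(k-1) replaced by binom(P-1, k-1).\<close>

lemma pbinom_approx_nth:
  assumes P: "0 < P"
  shows "fps_nth (pbinom_approx P f) n =
    (\<Sum>k. (if k = 0 then 0 else of_nat ((P - 1) choose (k - 1)) / of_nat k) * fps_nth (f ^ k) n :: 'a)"
proof -
  have "(1 + f) ^ P = (\<Sum>k\<le>P. of_nat (P choose k) * f ^ k)"
    using binomial_ring[of f 1 P] by (simp add: add.commute)
  also have "\<dots> = 1 + (\<Sum>k\<in>{1..P}. of_nat (P choose k) * f ^ k)"
    by (simp add: atMost_atLeast0 sum.atLeast_Suc_atMost)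
  finally have "fps_nth (pbinom_approx P f) n = (\<Sum>k\<in>{1..P}. 1 / of_nat P * (of_nat (P choose k) * fps_nth (f ^ k) n))"
    by (simp add: pbinom_approx_def fps_sum_nth sum_distrib_left fps_mult_of_nat_nth)
  also have "\<dots> = (\<Sum>k\<in>{1..P}. (if k = 0 then 0 else of_nat ((P - 1) choose (k - 1)) / of_nat k) * fps_nth (f ^ k) n)"
  proof (rule sum.cong[OF refl])
    fix k assume k: "k \<in> {1..P}"
    have "k * (P choose k) = P * ((P - 1) choose (k - 1))" using k by (intro times_binomial_minus1_eq) auto
    then have "of_nat k * of_nat (P choose k) = (of_nat P * of_nat ((P - 1) choose (k - 1)) :: 'a)"
      by (metis of_nat_mult)
    then have "of_nat (P choose k) / of_nat P = (of_nat ((P - 1) choose (k - 1)) / of_nat k :: 'a)"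
      using k P by (simp add: field_simps)
    then show "1 / of_nat P * (of_nat (P choose k) * fps_nth (f ^ k) n) =
       (if k = 0 then 0 else of_nat ((P - 1) choose (k - 1)) / of_nat k) * fps_nth (f ^ k) n"
      using k by (simp add: mult.assoc[symmetric])
  qed
  also have "\<dots> = (\<Sum>k. (if k = 0 then 0 else of_nat ((P - 1) choose (k - 1)) / of_nat k) * fps_nth (f ^ k) n)"
    by (rule suminf_finite[symmetric]) (use P in \<open>auto simp: not_le intro!: binomial_eq_0\<close>)
  finally show ?thesis .
qed

lemma fbd_suminf:
  assumes f: "fbd (1 / real p) (f :: 'a fps)" and c: "\<And>k. vabs (c k) \<le> 1"
  shows "vabs (\<Sum>k. (if k = 0 then 0 else c k / of_nat k) * fps_nth (f ^ k) n) \<le> 1 / real p"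
  by (intro vabs_suminf_le nonarch_summable[OF one_over_p_powser gm_log_term_le[OF f c]]
      order_trans[OF gm_log_term_le[OF f c] k_times_p_power_le]) simp

lemma fbd_pbinom_approx:
  assumes "fbd (1 / real p) (f :: 'a fps)" "0 < P"
  shows "fbd (1 / real p) (pbinom_approx P f)"
  unfolding fbd_def pbinom_approx_nth[OF assms(2)] by (intro allI fbd_suminf assms(1)) simp

lemma fbd_gm_log:
  assumes "fbd (1 / real p) (f :: 'a fps)"
  shows "fbd (1 / real p) (gm_log f)"
  unfolding fbd_def gm_log_nth by (intro allI fbd_suminf assms(1)) (simp add: vabs_power)

lemma LIMSEQ_of_nat_p_power: "(\<lambda>j. of_nat (p ^ j) :: 'a) \<longlonglongrightarrow> 0"
  by (rule tendsto_vabs_bound[OF LIMSEQ_p_power]) (simp add: vabs_power vabs_p)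

lemma fconv_p_power: "fconv (\<lambda>j. fps_const (of_nat (p ^ j) :: 'a)) 0"
  unfolding fconv_def
proof
  show "(\<lambda>j. fps_nth (fps_const (of_nat (p ^ j) :: 'a)) n) \<longlonglongrightarrow> fps_nth 0 n" for n
    using LIMSEQ_of_nat_p_power by (cases "n = 0") auto
qed

text \<open>The logarithm is the limit of \<open>((1 + f)^(p^j) - 1) / p^j\<close>; its functional equation, its
  derivative and its compatibility with substitutions are read off these approximants.\<close>

lemma fconv_pbinom_approx:
  assumes f: "fbd (1 / real p) (f :: 'a fps)"
  shows "fconv (\<lambda>j. pbinom_approx (p ^ j) f) (gm_log f)"
proof -
  have P: "0 < p ^ j" for j using p_gt_1 by simp
  \<comment> \<open>The binomial coefficient is a fixed polynomial evaluated at p^j - 1, which tends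
    to -1.\<close>
  have lim: "(\<lambda>j. of_nat ((p ^ j - 1) choose m) :: 'a) \<longlonglongrightarrow> (- 1) ^ m" for m
  proof -
    have "(\<lambda>j. (of_nat (p ^ j) - 1 :: 'a) gchoose m) \<longlonglongrightarrow> (0 - 1) gchoose m"
      by (intro tendsto_gbinomial tendsto_diff LIMSEQ_of_nat_p_power tendsto_const)
    moreover have "of_nat ((p ^ j - 1) choose m) = (of_nat (p ^ j) - 1 :: 'a) gchoose m" for j
      using P[of j] by (simp add: binomial_gbinomial of_nat_diff Suc_leI)
    ultimately show ?thesis by (simp add: gbinomial_minus_1)
  qed
  show ?thesis
    unfolding fconv_def pbinom_approx_nth[OF P] gm_log_nth
  proof (intro allI nonarch_tannery[OF _ one_over_p_powser])
    fix k n
    show "(\<lambda>j. (if k = 0 then 0 else of_nat ((p ^ j - 1) choose (k - 1)) / of_nat k) * fps_nth (f ^ k) n)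
        \<longlonglongrightarrow> (if k = 0 then 0 else (- 1) ^ (k - 1) / of_nat k) * fps_nth (f ^ k) n"
    proof (cases "k = 0")
      case False
      then show ?thesis unfolding if_not_P[OF False] divide_inverse by (intro tendsto_mult lim tendsto_const)
    qed simp
    show "vabs ((if k = 0 then 0 else of_nat ((p ^ j - 1) choose (k - 1)) / of_nat k) * fps_nth (f ^ k) n)
        \<le> real k * (1 / real p) ^ k" for j
      by (intro gm_log_term_le f) simp
  qed
qed

lemma gm_log_gm_add:
  assumes f: "fbd (1 / real p) (f :: 'a fps)" and g: "fbd (1 / real p) g"
  shows "gm_log (gm_add f g) = gm_log f + gm_log g"
proof (rule fconv_unique)
  let ?A = "\<lambda>j. pbinom_approx (p ^ j)"
  have "fbd (1 / real p) (f * g)"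
    using p_gt_1 by (intro fbd_mult_1[OF fbd_mono[OF f] g]) simp
  then have "fbd (1 / real p) (gm_add f g)" unfolding gm_add_def by (intro fbd_add f g)
  then show "fconv (\<lambda>j. ?A j (gm_add f g)) (gm_log (gm_add f g))" by (rule fconv_pbinom_approx)
  \<comment> \<open>Additivity of the approximants fails exactly by p^j times their product, and p^j
    tends to 0.\<close>
  have "?A j (gm_add f g) = ?A j f + ?A j g + fps_const (of_nat (p ^ j)) * (?A j f * ?A j g)" for j
  proof -
    define P where "P = p ^ j"
    have P: "(of_nat P :: 'a) \<noteq> 0" using p_gt_1 by (simp add: P_def)
    define F G where "F = (1 + f) ^ P - 1" and "G = (1 + g) ^ P - 1"
    have "(1 + gm_add f g) ^ P = ((1 + f) * (1 + g)) ^ P" by (simp add: gm_add_def algebra_simps)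
    also have "\<dots> = (1 + F) * (1 + G)" by (simp add: power_mult_distrib F_def G_def)
    finally have *: "(1 + gm_add f g) ^ P - 1 = F + G + F * G" by (simp add: algebra_simps)
    have "fps_const (1 / of_nat P) * (F * G) =
      fps_const (of_nat P * (1 / of_nat P * (1 / of_nat P))) * (F * G)" using P by simp
    also have "\<dots> = fps_const (of_nat P) * ((fps_const (1 / of_nat P) * F) * (fps_const (1 / of_nat P) * G))"
      by (simp only: fps_const_mult[symmetric] mult_ac)
    finally show ?thesis unfolding pbinom_approx_def * P_def[symmetric]
      unfolding F_def[symmetric] G_def[symmetric] by (simp only: distrib_left)
  qed
  moreover have "fconv (\<lambda>j. ?A j f + ?A j g + fps_const (of_nat (p ^ j)) * (?A j f * ?A j g))
      (gm_log f + gm_log g + 0 * (gm_log f * gm_log g))"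
    by (intro fconv_add fconv_mult fconv_p_power fconv_pbinom_approx f g)
  ultimately show "fconv (\<lambda>j. ?A j (gm_add f g)) (gm_log f + gm_log g)" by simp
qed

lemma gm_log_0 [simp]: "gm_log (0 :: 'a fps) = 0"
  using gm_log_gm_add[of 0 0] by (simp add: gm_add_def)

lemma fbd_power_minus_1:
  assumes "fbd c (f :: 'a fps)" "c \<le> 1"
  shows "fbd c ((1 + f) ^ n - 1)"
  using fbd_power_diff[of "1 + f" 1 c n] assms fbd_add[of 1 1 f] fbd_mono[of c f 1] by simp

lemma gm_log_power:
  assumes f: "fbd (1 / real p) (f :: 'a fps)"
  shows "gm_log ((1 + f) ^ n - 1) = of_nat n * gm_log f"
proof (induction n)
  case (Suc n)
  have eq: "gm_add f ((1 + f) ^ n - 1) = (1 + f) ^ Suc n - 1" by (simp add: gm_add_def algebra_simps)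
  have "fbd (1 / real p) ((1 + f) ^ n - 1)" using p_gt_1 by (intro fbd_power_minus_1 f) simp
  then have "gm_log ((1 + f) ^ Suc n - 1) = gm_log f + gm_log ((1 + f) ^ n - 1)"
    unfolding eq[symmetric] by (rule gm_log_gm_add[OF f])
  then show ?case using Suc by (simp add: distrib_right del: power_Suc)
qed simp

lemma gm_log_prod:
  assumes "finite A" "\<And>i. i \<in> A \<Longrightarrow> fbd (1 / real p) (f i :: 'a fps)"
  shows "fbd (1 / real p) ((\<Prod>i\<in>A. 1 + f i) - 1) \<and> gm_log ((\<Prod>i\<in>A. 1 + f i) - 1) = (\<Sum>i\<in>A. gm_log (f i))"
  using assms
proof (induction A)
  case empty
  then show ?case by simp
next
  case (insert i A)
  let ?g = "(\<Prod>i\<in>A. 1 + f i) - 1"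
  have g: "fbd (1 / real p) ?g" and f: "fbd (1 / real p) (f i)" using insert by auto
  have "fbd (1 / real p) (f i * ?g)"
    using p_gt_1 by (intro fbd_mult_1[OF fbd_mono[OF f] g]) simp
  then have "fbd (1 / real p) (gm_add (f i) ?g)" unfolding gm_add_def by (intro fbd_add f g)
  moreover have "gm_add (f i) ?g = (\<Prod>i\<in>insert i A. 1 + f i) - 1"
    using insert by (simp add: gm_add_def algebra_simps)
  ultimately show ?case using gm_log_gm_add[OF f g] insert by simp
qed

lemma gm_log_subst:
  assumes f: "fbd (1 / real p) (f :: 'a fps)" and T: "fdisc T"
  shows "fps_subst (gm_log f) T = gm_log (fps_subst f T)"
proof (rule fconv_unique)
  have P: "0 < p ^ j" for j using p_gt_1 by simp
  have f1: "fbd 1 f" using p_gt_1 by (intro fbd_mono[OF f]) simp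
  then have f2: "fbd 1 (1 + f)" by (intro fbd_add) auto
  show "fconv (\<lambda>j. fps_subst (pbinom_approx (p ^ j) f) T) (fps_subst (gm_log f) T)"
    by (rule fconv_subst[OF fbd_pbinom_approx[OF f P] fconv_pbinom_approx[OF f] T])
  have "fps_subst (pbinom_approx (p ^ j) f) T = pbinom_approx (p ^ j) (fps_subst f T)" for j
  proof -
    have "fps_subst (1 + f) T = 1 + fps_subst f T" using fps_subst_add[OF _ f1 T, of 1 1] by simp
    then have "fps_subst ((1 + f) ^ (p ^ j) - 1) T = (1 + fps_subst f T) ^ (p ^ j) - 1"
      using fps_subst_diff[OF fbd_power[OF f2] _ T, of 1 1] fps_subst_power[OF f2 T] by simp
    moreover have "fbd 1 ((1 + f) ^ (p ^ j) - 1)" by (intro fbd_diff fbd_power f2) simp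
    ultimately show ?thesis unfolding pbinom_approx_def by (simp add: fps_subst_const_mult[OF _ T])
  qed
  then show "fconv (\<lambda>j. fps_subst (pbinom_approx (p ^ j) f) T) (gm_log (fps_subst f T))"
    using fconv_pbinom_approx[OF fps_subst_fbd[OF f T]] by simp
qed

text \<open>Serves the injectivity: a vanishing logarithm forces the derivative of f to
  vanish.\<close>

lemma gm_log_deriv:
  assumes f: "fbd (1 / real p) (f :: 'a fps)"
  shows "(1 + f) * fps_deriv (gm_log f) = fps_deriv f"
proof (rule fconv_unique)
  let ?A = "\<lambda>j. pbinom_approx (p ^ j) f"
  have P: "(of_nat (p ^ j) :: 'a) \<noteq> 0" for j using p_gt_1 by simp
  show "fconv (\<lambda>j. (1 + f) * fps_deriv (?A j)) ((1 + f) * fps_deriv (gm_log f))"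
    by (intro fconv_mult fconv_const fconv_deriv fconv_pbinom_approx f)
  have pow: "(1 + f) ^ (p ^ j) = 1 + fps_const (of_nat (p ^ j)) * ?A j" for j
  proof -
    have "fps_const (of_nat (p ^ j)) * ?A j = fps_const (of_nat (p ^ j) * (1 / of_nat (p ^ j))) * ((1 + f) ^ (p ^ j) - 1)"
      by (simp only: pbinom_approx_def fps_const_mult[symmetric] mult.assoc)
    also have "of_nat (p ^ j) * (1 / of_nat (p ^ j)) = (1 :: 'a)" using P[of j] by (simp del: of_nat_power)
    finally show ?thesis by simp
  qed
  have "(1 + f) * fps_deriv (?A j) = (1 + fps_const (of_nat (p ^ j)) * ?A j) * fps_deriv f" for j
  proof -
    have "fps_deriv (?A j) = fps_const (1 / of_nat (p ^ j)) * (of_nat (p ^ j) * fps_deriv f * (1 + f) ^ (p ^ j - 1))"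
      by (simp add: pbinom_approx_def fps_deriv_power' mult_ac)
    also have "\<dots> = fps_const (1 / of_nat (p ^ j) * of_nat (p ^ j)) * (fps_deriv f * (1 + f) ^ (p ^ j - 1))"
      by (simp only: fps_const_mult[symmetric] fps_of_nat[symmetric] mult.assoc)
    also have "\<dots> = fps_deriv f * (1 + f) ^ (p ^ j - 1)" using P[of j] p_gt_1 by simp
    finally have "(1 + f) * fps_deriv (?A j) = fps_deriv f * ((1 + f) * (1 + f) ^ (p ^ j - 1))" by simp
    also have "(1 + f) * (1 + f) ^ (p ^ j - 1) = (1 + f) ^ (p ^ j)"
      using p_gt_1 by (metis power_eq_if power_eq_0_iff not_less0)
    finally show ?thesis unfolding pow by (simp add: mult.commute)
  qed
  moreover have "fconv (\<lambda>j. (1 + fps_const (of_nat (p ^ j)) * ?A j) * fps_deriv f) ((1 + 0 * gm_log f) * fps_deriv f)"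
    by (intro fconv_add fconv_mult fconv_p_power fconv_pbinom_approx f fconv_const)
  ultimately show "fconv (\<lambda>j. (1 + f) * fps_deriv (?A j)) (fps_deriv f)" by simp
qed

lemma fconv_gm_log:
  assumes F: "\<And>j. fbd (1 / real p) (F j :: 'a fps)" and f: "fconv F f"
  shows "fconv (\<lambda>j. gm_log (F j)) (gm_log f)"
  unfolding fconv_def gm_log_nth
proof (intro allI nonarch_tannery[OF _ one_over_p_powser])
  fix k n
  show "(\<lambda>j. (if k = 0 then 0 else (- 1) ^ (k - 1) / of_nat k) * fps_nth (F j ^ k) n)
      \<longlonglongrightarrow> (if k = 0 then 0 else (- 1) ^ (k - 1) / of_nat k) * fps_nth (f ^ k) n"
    using fconv_power[OF f, of k] by (intro tendsto_mult_left) (simp add: fconv_def)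
  show "vabs ((if k = 0 then 0 else (- 1) ^ (k - 1) / of_nat k) * fps_nth (F j ^ k) n)
      \<le> real k * (1 / real p) ^ k" for j
    by (intro gm_log_term_le F) (simp add: vabs_power)
qed

lemma fps_over_gm_log:
  assumes f: "fbd (1 / real p) f" "f \<in> fps_over K"
  shows "gm_log f \<in> fps_over K"
proof (rule K.fps_over_limit[OF fconv_pbinom_approx[OF f(1)]])
  show "pbinom_approx (p ^ j) f \<in> fps_over K" for j
    unfolding pbinom_approx_def
    by (intro K.fps_over_intros K.fps_over_power K.divide K.one K.of_nat f)
qed

end

section \<open>Formal group laws as functions on the open unit disc\<close>

definition fps_map_const :: "'a::comm_ring_1 fps \<Rightarrow> 'a fps fps" where
  "fps_map_const f = Abs_fps (\<lambda>n. fps_const (fps_nth f n))"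

lemma fps_map_const_nth [simp]: "fps_nth (fps_map_const f) n = fps_const (fps_nth f n)"
  by (simp add: fps_map_const_def)

lemma fps_const_sum: "fps_const (\<Sum>i\<in>A. f i) = (\<Sum>i\<in>A. fps_const (f i))"
  by (induction A rule: infinite_finite_induct) (auto simp flip: fps_const_add)

lemma fps_map_const_mult: "fps_map_const (f * g) = fps_map_const f * fps_map_const g"
  by (rule fps_ext) (simp add: fps_mult_nth fps_const_sum)

lemma fps_map_const_1: "fps_map_const 1 = 1"
  by (rule fps_ext) (simp)

lemma fps_map_const_power: "fps_map_const (f ^ n) = fps_map_const f ^ n"
  by (induction n) (auto simp: fps_map_const_mult fps_map_const_1)

text \<open>Embeds the series in x, y into those in x, y, z. Among series in x, y,
  \<open>fps_map_const f\<close> is f(x) and \<open>fps_const g\<close> is g(y).\<close>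

definition lift3 :: "'a::comm_ring_1 fps fps \<Rightarrow> 'a fps3" where
  "lift3 G = Abs_fps (\<lambda>n. fps_map_const (fps_nth G n))"

lemma lift3_nth [simp]: "fps_nth (lift3 f) n = fps_map_const (fps_nth f n)"
  by (simp add: lift3_def)

lemma fps_map_const_sum: "fps_map_const (\<Sum>i\<in>A. f i) = (\<Sum>i\<in>A. fps_map_const (f i))"
  by (rule fps_ext) (simp add: fps_sum_nth fps_const_sum)

lemma lift3_mult: "lift3 (f * g) = lift3 f * lift3 g"
  by (rule fps_ext) (simp add: fps_mult_nth fps_map_const_sum fps_map_const_mult)

lemma lift3_1: "lift3 1 = 1"
  by (rule fps_ext) (simp add: fps_map_const_1, simp add: fps_eq_iff)

lemma lift3_power: "lift3 (f ^ n) = lift3 f ^ n"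
  by (induction n) (auto simp: lift3_mult lift3_1)

lemma fps3_ext: "(\<And>k l m. fps3_nth A k l m = fps3_nth B k l m) \<Longrightarrow> A = B"
  unfolding fps3_nth_def by (intro fps_ext) blast

lemma fps3_nth_lift3: "fps3_nth (lift3 G) k l m = (if m = 0 then fps_nth (fps_nth G k) l else 0)"
  by (simp add: fps3_nth_def)

lemma varx_eq: "varx = lift3 (fps_map_const fps_X)"
  by (rule fps3_ext) (simp add: fps3_nth_lift3, auto simp: varx_def fps3_nth_def fps_X_def)

lemma vary_eq: "vary = lift3 (fps_const fps_X)"
  by (rule fps3_ext) (simp add: fps3_nth_lift3, auto simp: vary_def fps3_nth_def fps_X_def)

lemma fps3_nth_subst1:
  "fps3_nth (subst1 e A) k l m = (\<Sum>i\<le>k+l+m. fps_nth e i * fps3_nth (A ^ i) k l m)"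
  by (simp add: subst1_def fps3_nth_def)

lemma fps3_nth_subst2:
  "fps3_nth (subst2 F A B) k l m =
     (\<Sum>i\<le>k+l+m. \<Sum>j\<le>k+l+m. fps_nth (fps_nth F i) j * fps3_nth (A ^ i * B ^ j) k l m)"
  by (simp add: subst2_def fps3_nth_def)

lemma fps3_nth_lift_xy:
  "fps3_nth (lift3 (fps_map_const f) ^ i * lift3 (fps_const g) ^ j) k l m =
     (if m = 0 then fps_nth (f ^ i) k * fps_nth (g ^ j) l else 0)"
  by (simp add: lift3_power[symmetric] lift3_mult[symmetric] fps_map_const_power[symmetric] fps3_nth_lift3
      fps_const_power)

lemma fps3_nth_lift_x:
  "fps3_nth (lift3 (fps_map_const f) ^ i) k l m = (if l = 0 \<and> m = 0 then fps_nth (f ^ i) k else 0)"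
  by (simp add: lift3_power[symmetric] fps_map_const_power[symmetric] fps3_nth_lift3)

lemma fps3_nth_lift_y:
  "fps3_nth (lift3 (fps_const g) ^ j) k l m = (if k = 0 \<and> m = 0 then fps_nth (g ^ j) l else 0)"
  by (simp add: lift3_power[symmetric] fps3_nth_lift3 fps_const_power)

lemma subst2_xy: "subst2 F varx vary = lift3 F"
proof (rule fps3_ext)
  fix k l m
  have "fps3_nth (subst2 F varx vary) k l m =
    (\<Sum>i\<le>k+l+m. \<Sum>j\<le>k+l+m. if i = k \<and> j = l then (if m = 0 then fps_nth (fps_nth F i) j else 0) else 0)"
    unfolding fps3_nth_subst2 varx_eq vary_eq fps3_nth_lift_xy
    by (intro sum.cong refl) (auto simp: fps_X_power_nth)
  also have "\<dots> = (\<Sum>i\<le>k+l+m. if i = k then (if m = 0 then fps_nth (fps_nth F k) l else 0) else 0)"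
    by (intro sum.cong refl) (auto simp: sum.delta)
  finally show "fps3_nth (subst2 F varx vary) k l m = fps3_nth (lift3 F) k l m"
    by (simp add: fps3_nth_lift3)
qed

lemma subst1_x: "subst1 e varx = lift3 (fps_map_const e)"
proof (rule fps3_ext)
  fix k l m
  have "fps3_nth (subst1 e varx) k l m = (\<Sum>i\<le>k+l+m. if i = k then (if l = 0 \<and> m = 0 then fps_nth e k else 0) else 0)"
    unfolding fps3_nth_subst1 varx_eq fps3_nth_lift_x
    by (intro sum.cong refl) (auto simp: fps_X_power_nth)
  then show "fps3_nth (subst1 e varx) k l m = fps3_nth (lift3 (fps_map_const e)) k l m"
    by (auto simp: fps3_nth_lift3)
qed

lemma subst1_y: "subst1 e vary = lift3 (fps_const e)"
proof (rule fps3_ext)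
  fix k l m
  have "fps3_nth (subst1 e vary) k l m = (\<Sum>i\<le>k+l+m. if i = l then (if k = 0 \<and> m = 0 then fps_nth e l else 0) else 0)"
    unfolding fps3_nth_subst1 vary_eq fps3_nth_lift_y
    by (intro sum.cong refl) (auto simp: fps_X_power_nth)
  then show "fps3_nth (subst1 e vary) k l m = fps3_nth (lift3 (fps_const e)) k l m"
    by (auto simp: fps3_nth_lift3)
qed

lemma subst2_varx_0: "fps3_nth (subst2 F varx 0) k 0 0 = fps_nth (fps_nth F k) 0"
proof -
  have "fps3_nth (subst2 F varx 0) k 0 0 = (\<Sum>i\<le>k. \<Sum>j\<le>k. if i = k \<and> j = 0 then fps_nth (fps_nth F i) j else 0)"
    unfolding fps3_nth_subst2
    by (simp add: varx_eq, intro sum.cong refl)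
      (auto simp: power_0_left fps3_nth_lift_x fps_X_power_nth, simp_all add: fps3_nth_def)
  also have "\<dots> = (\<Sum>i\<le>k. if i = k then fps_nth (fps_nth F k) 0 else 0)"
    by (intro sum.cong refl) (auto simp: sum.delta)
  finally show ?thesis by simp
qed

lemma subst2_0_vary: "fps3_nth (subst2 F 0 vary) 0 l 0 = fps_nth (fps_nth F 0) l"
proof -
  have "fps3_nth (subst2 F 0 vary) 0 l 0 = (\<Sum>i\<le>l. \<Sum>j\<le>l. if i = 0 \<and> j = l then fps_nth (fps_nth F i) j else 0)"
    unfolding fps3_nth_subst2
    by (simp add: vary_eq, intro sum.cong refl)
      (auto simp: power_0_left fps3_nth_lift_y fps_X_power_nth, simp_all add: fps3_nth_def)
  also have "\<dots> = (\<Sum>i\<le>l. if i = 0 then fps_nth (fps_nth F 0) l else 0)"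
    by (intro sum.cong refl) (auto simp: sum.delta)
  finally show ?thesis by simp
qed

text \<open>The coefficients of \<open>x^k y^l\<close> in \<open>e(F(x, y))\<close> and in \<open>F(e(x), e(y))\<close>.\<close>

definition endo_lhs :: "'a::comm_ring_1 fps fps \<Rightarrow> 'a fps \<Rightarrow> nat \<Rightarrow> nat \<Rightarrow> 'a" where
  "endo_lhs F e k l = (\<Sum>i\<le>k+l. fps_nth e i * fps_nth (fps_nth (F ^ i) k) l)"

definition endo_rhs :: "'a::comm_ring_1 fps fps \<Rightarrow> 'a fps \<Rightarrow> nat \<Rightarrow> nat \<Rightarrow> 'a" where
  "endo_rhs F e k l = (\<Sum>i\<le>k+l. \<Sum>j\<le>k+l. fps_nth (fps_nth F i) j * (fps_nth (e ^ i) k * fps_nth (e ^ j) l))"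

lemma endo_coefficients_iff:
  "subst1 e (subst2 F varx vary) = subst2 F (subst1 e varx) (subst1 e vary) \<longleftrightarrow>
     (\<forall>k l. endo_lhs F e k l = endo_rhs F e k l)"
proof -
  have 1: "fps3_nth (subst1 e (subst2 F varx vary)) k l m = (if m = 0 then endo_lhs F e k l else 0)" for k l m
    by (simp add: fps3_nth_subst1 subst2_xy lift3_power[symmetric] fps3_nth_lift3 endo_lhs_def)
  have 2: "fps3_nth (subst2 F (subst1 e varx) (subst1 e vary)) k l m = (if m = 0 then endo_rhs F e k l else 0)" for k l m
    by (simp add: fps3_nth_subst2 subst1_x subst1_y fps3_nth_lift_xy endo_rhs_def)
  show ?thesis
  proof
    assume "subst1 e (subst2 F varx vary) = subst2 F (subst1 e varx) (subst1 e vary)"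
    then show "\<forall>k l. endo_lhs F e k l = endo_rhs F e k l" using 1[of _ _ 0] 2[of _ _ 0] by simp
  next
    assume "\<forall>k l. endo_lhs F e k l = endo_rhs F e k l"
    then show "subst1 e (subst2 F varx vary) = subst2 F (subst1 e varx) (subst1 e vary)"
      by (intro fps3_ext) (simp add: 1 2)
  qed
qed

lemma fps_power_nth_cong:
  assumes "\<And>m. m \<le> k \<Longrightarrow> fps_nth e m = fps_nth e' m"
  shows "fps_nth (e ^ i) k = fps_nth (e' ^ i :: 'a::comm_ring_1 fps) k"
  using assms
proof (induction i arbitrary: k)
  case (Suc i)
  have "fps_nth e j * fps_nth (e ^ i) (k - j) = fps_nth e' j * fps_nth (e' ^ i) (k - j)" if "j \<in> {0..k}" for j
    using that Suc.prems Suc.IH[of "k - j"] by auto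
  then show ?case by (simp add: fps_mult_nth)
qed simp

locale integral_fgl =
  fixes F :: "'a::{nonarch_field,complete_space} fps fps"
  assumes F_le: "vabs (fps_nth (fps_nth F i) j) \<le> 1"
    and F_x0: "fps_nth (fps_nth F i) 0 = (if i = 1 then 1 else 0)"
    and F_0y: "fps_nth (fps_nth F 0) j = (if j = 1 then 1 else 0)"

lemma formal_group_law_integral:
  assumes "formal_group_law K (F :: 'a::{nonarch_field,complete_space} fps fps)"
  shows "integral_fgl F"
proof
  show "vabs (fps_nth (fps_nth F i) j) \<le> 1" for i j
    using assms by (auto simp: formal_group_law_def ring_of_integers_def)
  have "subst2 F varx 0 = varx" "subst2 F 0 vary = vary"
    using assms by (auto simp: formal_group_law_def)
  then show "fps_nth (fps_nth F i) 0 = (if i = 1 then 1 else 0)"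
    and "fps_nth (fps_nth F 0) j = (if j = 1 then 1 else 0)" for i j
    using subst2_varx_0[of F i] subst2_0_vary[of F j]
    by (auto simp: varx_def vary_def fps3_nth_def fps_X_def)
qed

context integral_fgl
begin

abbreviation trans :: "'a \<Rightarrow> 'a fps" where
  "trans \<equiv> fgl_translate F"

abbreviation fadd :: "'a \<Rightarrow> 'a \<Rightarrow> 'a" where
  "fadd x z \<equiv> fps_value (trans z) x"

lemma F_nth_0: "fps_nth F 0 = fps_X"
  by (rule fps_ext) (simp add: F_0y)

lemma fbd_F_nth: "fbd 1 (fps_nth F i)"
  by (simp add: fbd_def F_le)

lemma trans_nth: "fps_nth (trans z) i = fps_value (fps_nth F i) z"
  by (simp add: fgl_translate_def)

lemma trans_0: "trans 0 = fps_X"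
  by (rule fps_ext) (simp add: trans_nth F_x0)

lemma trans_nth_0: "fps_nth (trans z) 0 = z"
  by (simp add: trans_nth F_nth_0)

lemma fdisc_trans: "vabs z < 1 \<Longrightarrow> fdisc (trans z)"
  by (simp add: fdisc_def fbd_def trans_nth_0) (simp add: trans_nth vabs_fps_value_le[OF fbd_F_nth])

lemma vabs_fadd_less: "vabs x < 1 \<Longrightarrow> vabs z < 1 \<Longrightarrow> vabs (fadd x z) < 1"
  by (rule fps_value_fdisc[OF fdisc_trans])

text \<open>The series F(x, z) - F(x, z') has constant term z - z' and all coefficients bounded by
  |z - z'|, so at points of the open disc its constant term dominates. It follows that distinct
  kernel points give distinct translates.\<close>

lemma vabs_fadd_diff:
  assumes v: "vabs v < 1" and z: "vabs z < 1" "vabs z' < 1"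
  shows "vabs (fadd v z - fadd v z') = vabs (z - z')"
proof (cases "z = z'")
  case False
  have lip: "vabs (fps_value f z - fps_value f z') \<le> vabs (z - z')" if f: "fbd 1 f" for f :: "'a fps"
  proof -
    have s: "(\<lambda>k. fps_nth f k * z ^ k - fps_nth f k * z' ^ k) sums (fps_value f z - fps_value f z')"
      by (intro nonarch_sums_diff fps_value_sums[OF f] z)
    have "fbd (vabs (z - z')) (fps_const z ^ k - fps_const z' ^ k)" for k
      using z by (intro fbd_power_diff) (auto simp: fbd_const)
    then have "vabs (z ^ k - z' ^ k) \<le> vabs (z - z')" for k
      by (simp add: fps_const_power fbd_const)
    then have "vabs (fps_nth f k * z ^ k - fps_nth f k * z' ^ k) \<le> 1 * vabs (z - z')" for k
      unfolding right_diff_distrib[symmetric] using f by (intro vabs_mult_le) (auto simp: fbd_def)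
    then show ?thesis
      unfolding sums_unique[OF s] by (intro vabs_suminf_le sums_summable[OF s]) auto
  qed
  let ?g = "trans z - trans z'"
  have b: "fbd (vabs (z - z')) ?g" using lip[OF fbd_F_nth] by (simp add: fbd_def trans_nth)
  have "fps_value ?g v = fadd v z - fadd v z'"
    by (rule fps_value_diff[OF fdisc_fbd fdisc_fbd]) (use fdisc_trans z v in auto)
  then have "vabs (fadd v z - fadd v z' - (z - z')) \<le> vabs (z - z') * vabs v"
    using vabs_fps_value_minus_nth_0[OF b v] by (simp add: trans_nth_0)
  also have "\<dots> < vabs (z - z')" using v False by simp
  finally show ?thesis by (rule vabs_eq_of_diff_less)
qed simp

definition ev :: "'a \<Rightarrow> 'a fps fps \<Rightarrow> 'a fps" where
  "ev w G = Abs_fps (\<lambda>k. fps_value (fps_nth G k) w)"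

lemma bounded_power: "fbd 1 (fps_nth (F ^ i) k)"
proof (induction i arbitrary: k)
  case 0
  then show ?case by auto
next
  case (Suc i)
  show ?case unfolding power_Suc fps_mult_nth
    by (intro fbd_sum fbd_mult_1 fbd_F_nth Suc) simp
qed

lemma fps_value_sum:
  assumes "\<And>i. i \<in> A \<Longrightarrow> fbd (1::real) (g i :: 'a fps)" "vabs z < 1"
  shows "fps_value (\<Sum>i\<in>A. g i) z = (\<Sum>i\<in>A. fps_value (g i) z)"
  using assms
proof (induction A rule: infinite_finite_induct)
  case (insert i A)
  then have "fps_value (g i + sum g A) z = fps_value (g i) z + fps_value (sum g A) z"
    by (intro fps_value_add[where B = 1 and C = 1] fbd_sum) auto
  then show ?case using insert by simp
qed auto

lemma ev_power:
  assumes "vabs w < 1"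
  shows "ev w (F ^ i) = trans w ^ i"
proof (induction i)
  case 0
  show ?case by (rule fps_ext) (auto simp: ev_def)
next
  case (Suc i)
  show ?case
  proof (rule fps_ext)
    fix k
    have "fps_nth (ev w (F ^ Suc i)) k = (\<Sum>j=0..k. fps_value (fps_nth F j * fps_nth (F ^ i) (k - j)) w)"
      unfolding ev_def power_Suc fps_mult_nth fps_nth_Abs_fps
      by (intro fps_value_sum fbd_mult_1 fbd_F_nth bounded_power assms)
    also have "\<dots> = (\<Sum>j=0..k. fps_nth (trans w) j * fps_nth (ev w (F ^ i)) (k - j))"
      by (simp add: fps_value_mult[OF fbd_F_nth bounded_power assms] trans_nth ev_def)
    finally show "fps_nth (ev w (F ^ Suc i)) k = fps_nth (trans w ^ Suc i) k"
      by (simp add: Suc fps_mult_nth)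
  qed
qed

lemma F_power_nth_0: "k + l < i \<Longrightarrow> fps_nth (fps_nth (F ^ i) k) l = 0"
proof (induction i arbitrary: k l)
  case (Suc i)
  have "fps_nth (fps_nth F a) b * fps_nth (fps_nth (F ^ i) (k - a)) (l - b) = 0"
    if "a \<in> {0..k}" "b \<in> {0..l}" for a b
  proof (cases "a = 0 \<and> b = 0")
    case True
    then show ?thesis by (simp add: F_nth_0)
  next
    case False
    then have "k - a + (l - b) < i" using that Suc.prems by auto
    then show ?thesis by (simp add: Suc.IH)
  qed
  then show ?case unfolding power_Suc fps_mult_nth fps_sum_nth by (intro sum.neutral ballI) blast
qed simp

text \<open>Evaluates y at w in e(F(x, y)), coefficient by coefficient in x. This turns the formal
  identity of an endomorphism into one between series in x alone.\<close>

lemma endo_lhs_value: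
  assumes e: "fbd 1 e" and w: "vabs w < 1"
  shows "fps_value (Abs_fps (endo_lhs F e k)) w = fps_nth (fps_subst e (trans w)) k"
proof (rule LIMSEQ_unique)
  let ?G = "\<lambda>j. \<Sum>i<j. fps_const (fps_nth e i) * fps_nth (F ^ i) k"
  have b: "fbd 1 (fps_const (fps_nth e i) * fps_nth (F ^ i) k)" for i
    using e by (intro fbd_mult_1 bounded_power) (auto simp: fbd_const fbd_def)
  have "fconv ?G (Abs_fps (endo_lhs F e k))"
    unfolding fconv_def
  proof
    fix l
    have "\<forall>\<^sub>F j in sequentially. endo_lhs F e k l = fps_nth (?G j) l"
      unfolding eventually_sequentially
    proof (intro exI allI impI)
      fix j assume j: "Suc (k + l) \<le> j"
      have "fps_nth (?G j) l = (\<Sum>i<j. fps_nth e i * fps_nth (fps_nth (F ^ i) k) l)"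
        by (simp add: fps_sum_nth)
      also have "\<dots> = (\<Sum>i\<le>k+l. fps_nth e i * fps_nth (fps_nth (F ^ i) k) l)"
        using j by (intro sum.mono_neutral_right) (auto simp: F_power_nth_0)
      finally show "endo_lhs F e k l = fps_nth (?G j) l" by (simp add: endo_lhs_def)
    qed
    then show "(\<lambda>j. fps_nth (?G j) l) \<longlonglongrightarrow> fps_nth (Abs_fps (endo_lhs F e k)) l"
      by (simp add: Lim_transform_eventually[OF tendsto_const])
  qed
  then show "(\<lambda>j. fps_value (?G j) w) \<longlonglongrightarrow> fps_value (Abs_fps (endo_lhs F e k)) w"
    by (intro tendsto_fps_value[where B = 1] fbd_sum b w) simp_all
  have "fps_value (?G j) w = (\<Sum>i<j. fps_nth e i * fps_nth (trans w ^ i) k)" for j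
  proof -
    have "fps_value (fps_const (fps_nth e i) * fps_nth (F ^ i) k) w = fps_nth e i * fps_nth (trans w ^ i) k" for i
      using fps_value_mult[of 1 "fps_const (fps_nth e i)", OF _ bounded_power w] e
      by (simp add: fbd_const fbd_def ev_power[OF w, symmetric] ev_def)
    then show ?thesis by (simp add: fps_value_sum[OF b w])
  qed
  then show "(\<lambda>j. fps_value (?G j) w) \<longlonglongrightarrow> fps_nth (fps_subst e (trans w)) k"
    using fps_subst_sums[OF e fdisc_trans[OF w], of k] by (simp add: sums_def)
qed

text \<open>Evaluates y at w in F(e(x), e(y)). The outer sum is finite, because e^i has no term of
  degree k for i > k.\<close>

lemma endo_rhs_value:
  assumes e: "fbd 1 e" "fps_nth e 0 = 0" and w: "vabs w < 1"
  shows "fps_value (Abs_fps (endo_rhs F e k)) w = fps_nth (fps_compose (trans (fps_value e w)) e) k"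
proof -
  have de: "fdisc e" using e by (simp add: fdisc_def)
  have ei: "vabs (fps_nth (e ^ i) k) \<le> 1" for i by (rule fbdD[OF fbd_power[OF e(1)]])
  have bF: "fbd 1 (fps_subst (fps_nth F i) e)" for i by (rule fps_subst_fbd[OF fbd_F_nth de])
  have b: "fbd 1 (fps_const (fps_nth (e ^ i) k) * fps_subst (fps_nth F i) e)" for i
    using bF ei by (intro fbd_mult_1) (auto simp: fbd_const)
  have "Abs_fps (endo_rhs F e k) = (\<Sum>i=0..k. fps_const (fps_nth (e ^ i) k) * fps_subst (fps_nth F i) e)"
  proof (rule fps_ext)
    fix l
    have "(\<Sum>j\<le>k+l. fps_nth (fps_nth F i) j * (fps_nth (e ^ i) k * fps_nth (e ^ j) l)) =
       fps_nth (e ^ i) k * fps_nth (fps_compose (fps_nth F i) e) l" for i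
    proof -
      have "(\<Sum>j\<le>k+l. fps_nth (fps_nth F i) j * (fps_nth (e ^ i) k * fps_nth (e ^ j) l)) =
        (\<Sum>j=0..l. fps_nth (fps_nth F i) j * (fps_nth (e ^ i) k * fps_nth (e ^ j) l))"
        by (intro sum.mono_neutral_right) (auto simp: startsby_zero_power_prefix[OF e(2)])
      also have "\<dots> = fps_nth (e ^ i) k * fps_nth (fps_compose (fps_nth F i) e) l"
        by (simp add: fps_compose_nth sum_distrib_left mult_ac)
      finally show ?thesis .
    qed
    then have "endo_rhs F e k l = (\<Sum>i\<le>k+l. fps_nth (e ^ i) k * fps_nth (fps_compose (fps_nth F i) e) l)"
      by (simp add: endo_rhs_def)
    also have "\<dots> = (\<Sum>i=0..k. fps_nth (e ^ i) k * fps_nth (fps_compose (fps_nth F i) e) l)"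
      by (intro sum.mono_neutral_right) (auto simp: startsby_zero_power_prefix[OF e(2)])
    finally show "fps_nth (Abs_fps (endo_rhs F e k)) l =
        fps_nth (\<Sum>i=0..k. fps_const (fps_nth (e ^ i) k) * fps_subst (fps_nth F i) e) l"
      by (simp add: fps_sum_nth fps_subst_eq_compose[OF e(2)])
  qed
  then have "fps_value (Abs_fps (endo_rhs F e k)) w =
      (\<Sum>i=0..k. fps_value (fps_const (fps_nth (e ^ i) k) * fps_subst (fps_nth F i) e) w)"
    by (simp only: fps_value_sum[OF b w])
  also have "\<dots> = (\<Sum>i=0..k. fps_nth (e ^ i) k * fps_value (fps_nth F i) (fps_value e w))"
    using ei by (intro sum.cong refl)
      (simp add: fps_value_mult[OF _ bF w, where B = 1] fbd_const fps_value_subst[OF fbd_F_nth de w])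
  also have "\<dots> = fps_nth (fps_compose (trans (fps_value e w)) e) k"
    by (simp add: fps_compose_nth trans_nth mult.commute)
  finally show ?thesis .
qed

lemma fbd_endo_lhs: "fbd 1 e \<Longrightarrow> fbd 1 (Abs_fps (endo_lhs F e k))"
  unfolding fbd_def[of _ "Abs_fps _"] fps_nth_Abs_fps endo_lhs_def
  by (intro allI vabs_sum_le vabs_mult_le_1 fbdD[OF bounded_power]) (auto simp: fbd_def)

lemma fbd_endo_rhs: "fbd 1 e \<Longrightarrow> fbd 1 (Abs_fps (endo_rhs F e k))"
  unfolding fbd_def[of _ "Abs_fps _"] fps_nth_Abs_fps endo_rhs_def
  by (intro allI vabs_sum_le vabs_mult_le_1 F_le fbdD[OF fbd_power]) auto

lemma endo_translate:
  assumes e: "fbd 1 e" "fps_nth e 0 = 0" and w: "vabs w < 1"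
    and "subst1 e (subst2 F varx vary) = subst2 F (subst1 e varx) (subst1 e vary)"
  shows "fps_subst e (trans w) = fps_compose (trans (fps_value e w)) e"
proof (rule fps_ext)
  fix k
  have "endo_lhs F e k = endo_rhs F e k" using assms(4) by (auto simp: endo_coefficients_iff)
  then show "fps_nth (fps_subst e (trans w)) k = fps_nth (fps_compose (trans (fps_value e w)) e) k"
    using endo_lhs_value[OF e(1) w, of k] endo_rhs_value[OF e w, of k] by simp
qed

lemma endo_fadd:
  assumes e: "fbd 1 e" "fps_nth e 0 = 0" and w: "vabs w < 1" and z: "vabs z < 1"
    and "subst1 e (subst2 F varx vary) = subst2 F (subst1 e varx) (subst1 e vary)"
  shows "fps_value e (fadd z w) = fadd (fps_value e z) (fps_value e w)"
proof -
  have de: "fdisc e" using e by (simp add: fdisc_def)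
  have ew: "vabs (fps_value e w) < 1" by (rule fps_value_fdisc[OF de w])
  have "fps_value (fps_subst e (trans w)) z = fps_value (fps_subst (trans (fps_value e w)) e) z"
    by (simp add: endo_translate[OF e w assms(5)] fps_subst_eq_compose[OF e(2)])
  then show ?thesis
    by (simp add: fps_value_subst[OF e(1) fdisc_trans[OF w] z] fps_value_subst[OF fdisc_fbd[OF fdisc_trans[OF ew]] de z])
qed

text \<open>Converse of \<open>endo_fadd\<close>, by the identity theorem first in x and then in y.
  It shows that the iterates of [\<pi>] are endomorphisms by a computation with values instead of
  series in three variables.\<close>

lemma endo_from_fadd:
  assumes e: "fbd 1 e" "fps_nth e 0 = 0" and z0: "(z0 :: 'a) \<noteq> 0" "vabs z0 < 1"
    and hom: "\<And>w z. vabs w < 1 \<Longrightarrow> vabs z < 1 \<Longrightarrow> fps_value e (fadd z w) = fadd (fps_value e z) (fps_value e w)"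
  shows "subst1 e (subst2 F varx vary) = subst2 F (subst1 e varx) (subst1 e vary)"
proof -
  have de: "fdisc e" using e by (simp add: fdisc_def)
  have *: "fps_subst e (trans w) = fps_compose (trans (fps_value e w)) e" if w: "vabs w < 1" for w
  proof -
    have ew: "vabs (fps_value e w) < 1" by (rule fps_value_fdisc[OF de w])
    have b1: "fbd 1 (fps_subst e (trans w))" by (rule fps_subst_fbd[OF e(1) fdisc_trans[OF w]])
    have b2: "fbd 1 (fps_subst (trans (fps_value e w)) e)"
      by (rule fps_subst_fbd[OF fdisc_fbd[OF fdisc_trans[OF ew]] de])
    have "fps_subst e (trans w) - fps_subst (trans (fps_value e w)) e = 0"
    proof (rule fps_value_eq_0_imp_0[OF fbd_diff[OF b1 b2] z0])
      fix z :: 'a assume z: "vabs z < 1"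
      show "fps_value (fps_subst e (trans w) - fps_subst (trans (fps_value e w)) e) z = 0"
        using hom[OF w z]
        by (simp add: fps_value_diff[OF b1 b2 z] fps_value_subst[OF e(1) fdisc_trans[OF w] z]
            fps_value_subst[OF fdisc_fbd[OF fdisc_trans[OF ew]] de z])
    qed
    then show ?thesis by (simp add: fps_subst_eq_compose[OF e(2)])
  qed
  have "endo_lhs F e k l = endo_rhs F e k l" for k l
  proof -
    have "Abs_fps (endo_lhs F e k) - Abs_fps (endo_rhs F e k) = 0"
    proof (rule fps_value_eq_0_imp_0[OF fbd_diff[OF fbd_endo_lhs[OF e(1)] fbd_endo_rhs[OF e(1)]] z0])
      fix w :: 'a assume w: "vabs w < 1"
      show "fps_value (Abs_fps (endo_lhs F e k) - Abs_fps (endo_rhs F e k)) w = 0"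
        unfolding fps_value_diff[OF fbd_endo_lhs[OF e(1)] fbd_endo_rhs[OF e(1)] w]
          endo_lhs_value[OF e(1) w] endo_rhs_value[OF e w] *[OF w] by simp
    qed
    then show ?thesis by (metis eq_iff_diff_eq_0 fps_nth_Abs_fps)
  qed
  then show ?thesis by (simp add: endo_coefficients_iff)
qed

lemma F_power_nth_1: "fps_nth (fps_nth (F ^ Suc n) n) 1 = of_nat (Suc n)"
proof -
  \<comment> \<open>\<open>E0\<close> sets y = 0 and \<open>E1\<close> takes the y-derivative at y =
    0, so \<open>E1\<close> obeys the product rule over \<open>E0\<close>.\<close>
  define E0 E1 where "E0 = (\<lambda>G :: 'a fps fps. Abs_fps (\<lambda>k. fps_nth (fps_nth G k) 0))"
    and "E1 = (\<lambda>G :: 'a fps fps. Abs_fps (\<lambda>k. fps_nth (fps_nth G k) 1))"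
  have E0_mult: "E0 (G * H) = E0 G * E0 H" for G H
    by (rule fps_ext) (simp add: E0_def fps_mult_nth fps_sum_nth)
  have E1_mult: "E1 (G * H) = E0 G * E1 H + E1 G * E0 H" for G H
    by (rule fps_ext) (simp add: E0_def E1_def fps_mult_nth fps_sum_nth sum.distrib)
  have E0F: "E0 F = fps_X" by (rule fps_ext) (simp add: E0_def F_x0)
  have E0_pow: "E0 (F ^ n) = fps_X ^ n" for n
  proof (induction n)
    case 0
    show ?case by (rule fps_ext) (auto simp: E0_def)
  qed (simp add: E0_mult E0F)
  have E1_pow: "E1 (F ^ Suc n) = of_nat (Suc n) * (fps_X ^ n * E1 F)" for n
  proof (induction n)
    case 0
    show ?case by simp
  next
    case (Suc n)
    have "E1 (F ^ Suc (Suc n)) = fps_X * E1 (F ^ Suc n) + E1 F * fps_X ^ Suc n"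
      unfolding power_Suc[of F "Suc n"] E1_mult E0_pow E0F ..
    then show ?case unfolding Suc by (simp add: algebra_simps)
  qed
  have "fps_nth (fps_nth (F ^ Suc n) n) 1 = fps_nth (E1 (F ^ Suc n)) n" by (simp add: E1_def)
  also have "\<dots> = of_nat (Suc n) * fps_nth (E1 F) 0"
    unfolding E1_pow by (simp add: fps_mult_of_nat_nth fps_X_power_mult_nth del: of_nat_Suc)
  also have "fps_nth (E1 F) 0 = 1" by (simp add: E1_def F_nth_0)
  finally show ?thesis by simp
qed

text \<open>Comparing coefficients of \<open>x^n y\<close> determines the coefficient of index \<open>n + 1\<close> of an
  endomorphism from the previous ones, since the characteristic is 0.\<close>

lemma endo_unique:
  assumes e: "fps_nth e 0 = 0" "fps_nth e' 0 = 0" "fps_nth e 1 = fps_nth e' 1"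
    and "subst1 e (subst2 F varx vary) = subst2 F (subst1 e varx) (subst1 e vary)"
    and "subst1 e' (subst2 F varx vary) = subst2 F (subst1 e' varx) (subst1 e' vary)"
  shows "e = e'"
proof -
  have lr: "endo_lhs F e k l = endo_rhs F e k l" "endo_lhs F e' k l = endo_rhs F e' k l" for k l
    using assms(4,5) by (auto simp: endo_coefficients_iff)
  have "fps_nth e n = fps_nth e' n" for n
  proof (induction n rule: less_induct)
    case (less n)
    show ?case
    proof (cases "n < 2")
      case True
      then show ?thesis using e by (auto simp: less_2_cases_iff)
    next
      case False
      then obtain k where n: "n = Suc k" and k: "k > 0" by (cases n) auto
      have pk: "fps_nth (e ^ i) k = fps_nth (e' ^ i) k" "fps_nth (e ^ i) 1 = fps_nth (e' ^ i) 1" for i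
        using less n k by (auto intro!: fps_power_nth_cong)
      have "endo_rhs F e k 1 = endo_rhs F e' k 1" by (simp only: endo_rhs_def pk)
      then have "endo_lhs F e k 1 = endo_lhs F e' k 1" using lr by simp
      moreover have "(\<Sum>i\<le>k. fps_nth e i * fps_nth (fps_nth (F ^ i) k) 1) =
          (\<Sum>i\<le>k. fps_nth e' i * fps_nth (fps_nth (F ^ i) k) 1)"
        using less n by (intro sum.cong) auto
      ultimately have "fps_nth e (Suc k) * of_nat (Suc k) = fps_nth e' (Suc k) * of_nat (Suc k)"
        unfolding endo_lhs_def using F_power_nth_1[of k] by (simp del: of_nat_Suc power_Suc)
      then show ?thesis using n by (simp del: of_nat_Suc)
    qed
  qed
  then show ?thesis by (simp add: fps_eq_iff)
qed

end

section \<open>Lubin-Tate formal group laws\<close>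

locale lubin_tate = padic_field p K
  for p :: nat and K :: "'a::{nonarch_field, alg_closed_field, complete_space} set" +
  fixes \<pi> :: 'a and F :: "'a fps fps" and q :: nat
  assumes uniformizer: "uniformizer K \<pi>"
    and q_def: "q = residue_field_size K"
    and lubin_tate_fgl: "lubin_tate_fgl K \<pi> F"

sublocale lubin_tate \<subseteq> integral_fgl F
  using lubin_tate_fgl formal_group_law_integral unfolding lubin_tate_fgl_def by blast

context lubin_tate
begin

abbreviation OK :: "'a ring" where "OK \<equiv> subring_of (ring_of_integers K)"

lemma max_ideal_eq: "max_ideal K = {x * \<pi> | x. x \<in> ring_of_integers K}"
  using uniformizer unfolding uniformizer_def by (auto simp: cgenideal_def)

lemma vabs_pi_less_1: "vabs \<pi> < 1" and pi_in_K: "\<pi> \<in> K"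
proof -
  have "1 * \<pi> \<in> max_ideal K" unfolding max_ideal_eq
    by (intro CollectI exI[of _ 1]) (simp add: ring_of_integers_def K.one)
  then show "vabs \<pi> < 1" "\<pi> \<in> K" by (auto simp: max_ideal_def)
qed

lemma vabs_le_pi: "x \<in> K \<Longrightarrow> vabs x < 1 \<Longrightarrow> vabs x \<le> vabs \<pi>"
proof -
  assume "x \<in> K" "vabs x < 1"
  then have "x \<in> max_ideal K" by (simp add: max_ideal_def)
  then obtain y where "x = y * \<pi>" "vabs y \<le> 1" by (auto simp: max_ideal_eq ring_of_integers_def)
  then show ?thesis by (simp add: vabs_mult mult_left_le_one_le)
qed

lemma vabs_p_le_pi: "1 / real p \<le> vabs \<pi>"
  using vabs_le_pi[OF K.of_nat vabs_p_less_1] by (simp add: vabs_p)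

lemma pi_nonzero: "\<pi> \<noteq> 0"
  using vabs_p_le_pi p_gt_1 by (metis less_le_trans of_nat_0_less_iff order.strict_trans vabs_pos_iff zero_less_divide_1_iff zero_less_one)

text \<open>For |x| \<le> 1, choose m with |\<pi>|^(m+1) < |x| \<le> |\<pi>|^m. Then x / \<pi>^m has
  absolute value above |\<pi>| and at most 1, and an element of K below 1 is at most |\<pi>|, so it
  is a unit. Inverses give the rest.\<close>

lemma vabs_K_eq_powi:
  assumes "x \<in> K" "x \<noteq> 0"
  shows "\<exists>k::int. vabs x = vabs \<pi> powi k"
proof -
  have pi: "0 < vabs \<pi>" using pi_nonzero by simp
  have down: "\<exists>k::int. vabs x = vabs \<pi> powi k" if x: "x \<in> K" "x \<noteq> 0" "vabs x \<le> 1" for x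
  proof -
    have "(\<lambda>n. vabs \<pi> ^ n) \<longlonglongrightarrow> 0" using vabs_pi_less_1 by (intro LIMSEQ_realpow_zero) auto
    then have "\<forall>\<^sub>F n in sequentially. vabs \<pi> ^ n < vabs x" using x by (intro order_tendstoD(2)) auto
    then have ex: "\<exists>n. vabs \<pi> ^ n < vabs x" by (auto simp: eventually_sequentially)
    define n where "n = (LEAST n. vabs \<pi> ^ n < vabs x)"
    have n: "vabs \<pi> ^ n < vabs x" unfolding n_def by (rule LeastI_ex[OF ex])
    then have "n \<noteq> 0" using x by (auto intro: ccontr)
    then obtain m where m: "n = Suc m" by (cases n) auto
    have "\<not> vabs \<pi> ^ m < vabs x" using not_less_Least[of m "\<lambda>n. vabs \<pi> ^ n < vabs x"] by (simp add: n_def[symmetric] m)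
    then have le: "vabs x \<le> vabs \<pi> ^ m" by simp
    have "x / \<pi> ^ m \<in> K" using x pi_in_K by (intro K.divide K.power)
    moreover have "\<not> vabs (x / \<pi> ^ m) \<le> vabs \<pi>"
      using n pi by (simp add: m vabs_divide vabs_power field_simps)
    ultimately have "\<not> vabs (x / \<pi> ^ m) < 1" using vabs_le_pi by blast
    then have "vabs x = vabs \<pi> ^ m" using le pi by (simp add: vabs_divide vabs_power field_simps)
    then show ?thesis by (intro exI[of _ "int m"]) simp
  qed
  show ?thesis
  proof (cases "vabs x \<le> 1")
    case True
    then show ?thesis using down assms by blast
  next
    case False
    then have "vabs (inverse x) \<le> 1" by (simp add: vabs_inverse inverse_le_1_iff)
    then obtain k where "vabs (inverse x) = vabs \<pi> powi k"
      using down[of "inverse x"] assms K.inv by auto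
    then have "vabs x = vabs \<pi> powi (- k)" by (simp add: vabs_inverse power_int_minus) (metis inverse_inverse_eq)
    then show ?thesis by blast
  qed
qed

subsection \<open>The residue field\<close>

lemma OK_cring: "cring OK"
  by (rule K.ring_of_integers_cring)

lemma max_ideal_ideal: "ideal (max_ideal K) OK"
proof (rule idealI)
  interpret O: cring OK by (rule OK_cring)
  show "ring OK" by (rule O.ring_axioms)
  interpret R: field "ring_of_type_algebra :: 'a ring" by (rule field_from_type_algebra)
  have minus: "\<ominus>\<^bsub>OK\<^esub> x = - x" if "x \<in> ring_of_integers K" for x
    using that by (intro O.minus_equality) (auto simp: ring_of_integers_def K.uminus)
  show "subgroup (max_ideal K) (add_monoid OK)"
  proof (rule O.add.subgroupI)
    show "max_ideal K \<noteq> {}" using K.zero by (auto simp: max_ideal_def)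
    show "\<ominus>\<^bsub>OK\<^esub> a \<in> max_ideal K" if "a \<in> max_ideal K" for a
      using that minus[of a] by (simp add: max_ideal_def ring_of_integers_def K.uminus)
  qed (auto simp: max_ideal_def ring_of_integers_def intro: K.add vabs_add_less)
  have "vabs (a * x) < 1" if "vabs a < 1" "vabs x \<le> 1" for a x :: 'a
    using that by (metis mult_left_le order_le_less_trans vabs_mult vabs_nonneg)
  then show "x \<otimes>\<^bsub>OK\<^esub> a \<in> max_ideal K" "a \<otimes>\<^bsub>OK\<^esub> x \<in> max_ideal K"
    if "a \<in> max_ideal K" "x \<in> carrier OK" for a x
    using that by (auto simp: max_ideal_def ring_of_integers_def K.mult mult.commute[of x a])
qed

lemma max_ideal_maximal: "maximalideal (max_ideal K) OK"
proof (rule maximalidealI[OF max_ideal_ideal])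
  have "1 \<in> ring_of_integers K" "1 \<notin> max_ideal K" by (auto simp: ring_of_integers_def max_ideal_def K.one)
  then show "carrier OK \<noteq> max_ideal K" by auto
  fix J assume J: "ideal J OK" "max_ideal K \<subseteq> J" "J \<subseteq> carrier OK"
  interpret J: ideal J OK by (rule J(1))
  show "J = max_ideal K \<or> J = carrier OK"
  proof (cases "J = max_ideal K")
    case False
    then obtain x where x: "x \<in> J" "x \<notin> max_ideal K" using J(2) by blast
    then have xo: "x \<in> K" "vabs x = 1" using J(3) by (auto simp: ring_of_integers_def max_ideal_def)
    then have "inverse x \<in> carrier OK" by (simp add: ring_of_integers_def K.inv vabs_inverse)
    then have "inverse x \<otimes>\<^bsub>OK\<^esub> x \<in> J" using x(1) by (intro J.I_l_closed)
    moreover have "inverse x * x = 1" using xo by (intro left_inverse) auto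
    ultimately have "\<one>\<^bsub>OK\<^esub> \<in> J" by simp
    then show ?thesis using J.one_imp_carrier by blast
  qed simp
qed

abbreviation res :: "'a \<Rightarrow> 'a set" where "res a \<equiv> max_ideal K +>\<^bsub>OK\<^esub> a"

abbreviation kres :: "'a set ring" where "kres \<equiv> OK Quot max_ideal K"

lemma kres_field: "field kres"
  by (rule maximalideal.quotient_is_field[OF max_ideal_maximal OK_cring])

lemma res_hom: "res \<in> ring_hom OK kres"
  by (rule ideal.rcos_ring_hom[OF max_ideal_ideal])

lemma res_eq_iff:
  assumes "a \<in> K" "vabs a \<le> 1" "b \<in> K" "vabs b \<le> 1"
  shows "res a = res b \<longleftrightarrow> vabs (a - b) < 1"
proof -
  interpret O: cring OK by (rule OK_cring)
  have ab: "a \<in> carrier OK" "b \<in> carrier OK" using assms by (auto simp: ring_of_integers_def)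
  have "\<ominus>\<^bsub>OK\<^esub> b = - b"
    using assms by (intro O.minus_equality) (auto simp: ring_of_integers_def K.uminus)
  then have "a \<ominus>\<^bsub>OK\<^esub> b = a - b" by (simp add: a_minus_def)
  then show ?thesis using O.quotient_eq_iff_same_a_r_cos[OF max_ideal_ideal ab] assms
    by (auto simp: max_ideal_def K.diff)
qed

lemma carrier_kres: "carrier kres = res ` ring_of_integers K"
  by (auto simp: FactRing_def A_RCOSETS_def')

text \<open>A series witnessing the Lubin-Tate property. By uniqueness of endomorphisms
  \<open>fgl_endo_pi\<close> identifies it with [\<pi>], so the choice is harmless.\<close>

definition e :: "'a fps" where
  "e = (SOME e. fgl_endomorphism K F e \<and> fps_nth e 1 = \<pi> \<and> (\<forall>n. fps_nth (e - fps_X ^ q) n \<in> max_ideal K))"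

lemma e_props: "fgl_endomorphism K F e" "fps_nth e 1 = \<pi>" "fps_nth (e - fps_X ^ q) n \<in> max_ideal K"
proof -
  have "\<exists>e. fgl_endomorphism K F e \<and> fps_nth e 1 = \<pi> \<and> (\<forall>n. fps_nth (e - fps_X ^ q) n \<in> max_ideal K)"
    using lubin_tate_fgl by (auto simp: lubin_tate_fgl_def q_def)
  from someI_ex[OF this, folded e_def]
  show "fgl_endomorphism K F e" "fps_nth e 1 = \<pi>" "fps_nth (e - fps_X ^ q) n \<in> max_ideal K" by auto
qed

lemma e_int: "e \<in> int_fps K" and e_0: "fps_nth e 0 = 0"
  and e_endo: "subst1 e (subst2 F varx vary) = subst2 F (subst1 e varx) (subst1 e vary)"
  using e_props(1) by (auto simp: fgl_endomorphism_def)

lemma e_fbd: "fbd 1 e" and e_over: "e \<in> fps_over K"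
  using e_int by (auto simp: int_fps_iff)

lemma fdisc_e: "fdisc e"
  by (simp add: fdisc_def e_fbd e_0)

lemma e_cong: "fbd (vabs \<pi>) (e - fps_X ^ q)"
  using e_props(3) vabs_le_pi by (auto simp: fbd_def max_ideal_def)

text \<open>Since \<open>card\<close> of an infinite set is 0, the case q = 0 includes an infinite
  residue field. The congruence of \<open>e\<close> with x^q excludes it by comparing the constant
  terms 0 and 1, and excludes q = 1 by the linear terms \<pi> and 1.\<close>

lemma q_ge_2: "2 \<le> q"
proof (rule ccontr)
  assume "\<not> 2 \<le> q"
  then consider "q = 0" | "q = 1" by linarith
  then show False
  proof cases
    case 1
    then have "fps_nth (fps_X ^ q :: 'a fps) 0 = 1" by simp
    then show ?thesis using e_props(3)[of 0] unfolding fps_sub_nth e_0 by (simp add: max_ideal_def)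
  next
    case 2
    then have "fps_nth (fps_X ^ q :: 'a fps) 1 = 1" by simp
    then have "vabs (\<pi> - 1) < 1"
      using e_props(3)[of 1] unfolding fps_sub_nth e_props(2) by (simp add: max_ideal_def)
    then have "vabs (\<pi> - (\<pi> - 1)) < 1" by (rule vabs_diff_less[OF vabs_pi_less_1])
    then show ?thesis by simp
  qed
qed

lemma card_kres: "card (carrier kres) = q" and finite_kres: "finite (carrier kres)"
proof -
  show c: "card (carrier kres) = q" by (simp add: q_def residue_field_size_def)
  show "finite (carrier kres)" by (rule card_ge_0_finite) (use q_ge_2 c in simp)
qed

lemma res_power: "a \<in> ring_of_integers K \<Longrightarrow> res (a ^ n) = res a [^]\<^bsub>kres\<^esub> n"
proof (induction n)
  case 0
  interpret Q: field kres by (rule kres_field)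
  show ?case using ring_hom_one[OF res_hom] by simp
next
  case (Suc n)
  interpret Q: field kres by (rule kres_field)
  have "a ^ n \<in> ring_of_integers K" using Suc.prems by (auto simp: ring_of_integers_def K.power vabs_power power_le_one)
  then have "res (a ^ n * a) = res (a ^ n) \<otimes>\<^bsub>kres\<^esub> res a"
    using ring_hom_mult[OF res_hom, of "a ^ n" a] Suc.prems by simp
  then show ?case using Suc by (simp add: mult.commute)
qed

text \<open>Lagrange's theorem in the multiplicative group of the residue field gives |a^q - a| < 1;
  discreteness of the value group sharpens this to |\<pi>|.\<close>

lemma vabs_power_q_diff:
  assumes a: "a \<in> K" "vabs a \<le> 1"
  shows "vabs (a ^ q - a) \<le> vabs \<pi>"
proof -
  interpret Q: field kres by (rule kres_field)
  have ao: "a \<in> ring_of_integers K" using a by (simp add: ring_of_integers_def)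
  then have ra: "res a \<in> carrier kres" by (simp add: carrier_kres)
  have aq: "a ^ q \<in> K" "vabs (a ^ q) \<le> 1" using a by (auto simp: K.power vabs_power power_le_one)
  have "res a [^]\<^bsub>kres\<^esub> q = res a"
  proof (cases "res a = \<zero>\<^bsub>kres\<^esub>")
    case True
    then show ?thesis using q_ge_2 Q.nat_pow_zero by simp
  next
    case False
    interpret M: group "Multiplicative_Group.mult_of kres" by (rule Q.field_mult_group)
    have "res a [^]\<^bsub>Multiplicative_Group.mult_of kres\<^esub> Coset.order (Multiplicative_Group.mult_of kres) = \<one>\<^bsub>Multiplicative_Group.mult_of kres\<^esub>"
      using ra False by (intro M.pow_order_eq_1) simp
    then have "res a [^]\<^bsub>kres\<^esub> (q - 1) = \<one>\<^bsub>kres\<^esub>"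
      using Q.order_mult_of[OF finite_kres] card_kres by (simp add: Coset.order_def Multiplicative_Group.nat_pow_mult_of)
    then have "res a [^]\<^bsub>kres\<^esub> (Suc (q - 1)) = res a" using ra by simp
    then show ?thesis using q_ge_2 by (simp add: Suc_diff_le)
  qed
  then have "res (a ^ q) = res a" using res_power[OF ao] by simp
  then have "vabs (a ^ q - a) < 1" using res_eq_iff[OF aq a] by simp
  then show ?thesis using a aq by (intro vabs_le_pi K.diff)
qed

text \<open>A prime divisor l of q yields, by Sylow, a nonzero residue class killed by l. If l
  differs from p, then l is a unit and the class would vanish.\<close>

lemma prime_dvd_q:
  assumes l: "prime l" "l dvd q"
  shows "l = p"
proof (rule ccontr)
  assume lp: "l \<noteq> p"
  interpret Q: field kres by (rule kres_field)
  let ?G = "add_monoid kres"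
  note G = Q.a_group
  obtain m where "q = l * m" using l(2) by blast
  then have "Coset.order ?G = l ^ 1 * m" using card_kres by (simp add: Coset.order_def)
  then obtain H where H: "subgroup H ?G" "card H = l"
    using sylow_thm[OF l(1) G, of 1 m] finite_kres by auto
  have "H \<noteq> {\<zero>\<^bsub>kres\<^esub>}" using H(2) l(1) by (auto simp: prime_nat_iff)
  moreover have "H \<noteq> {}" using subgroup.one_closed[OF H(1)] by auto
  ultimately obtain x where x: "x \<in> H" "x \<noteq> \<zero>\<^bsub>kres\<^esub>" by auto
  interpret H: group "?G\<lparr>carrier := H\<rparr>" by (rule subgroup.subgroup_is_group[OF H(1) G])
  have "x [^]\<^bsub>?G\<lparr>carrier := H\<rparr>\<^esub> Coset.order (?G\<lparr>carrier := H\<rparr>) = \<zero>\<^bsub>kres\<^esub>"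
    using H.pow_order_eq_1[of x] x(1) by simp
  then have xl: "x [^]\<^bsub>?G\<^esub> l = \<zero>\<^bsub>kres\<^esub>" using monoid.nat_pow_consistent[OF group.is_monoid[OF G], of x l H] H(2) by (simp add: Coset.order_def)
  have "x \<in> carrier kres" using x(1) subgroup.subset[OF H(1)] by auto
  then obtain a where a: "a \<in> ring_of_integers K" "x = res a" by (auto simp: carrier_kres)
  have ao: "a \<in> K" "vabs a \<le> 1" using a(1) by (auto simp: ring_of_integers_def)
  have na: "of_nat n * a \<in> K" "vabs (of_nat n * a) \<le> 1" for n
    using ao by (auto intro: K.mult K.of_nat vabs_mult_le_1)
  have r0: "res 0 = \<zero>\<^bsub>kres\<^esub>"
    using ring_hom_zero[OF res_hom] OK_cring kres_field by (simp add: cring_def field_def domain_def)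
  have "res (of_nat n * a) = x [^]\<^bsub>?G\<^esub> n" for n
  proof (induction n)
    case 0
    then show ?case using r0 by simp
  next
    case (Suc n)
    have "res (of_nat n * a + a) = res (of_nat n * a) \<oplus>\<^bsub>kres\<^esub> res a"
      using ring_hom_add[OF res_hom, of "of_nat n * a" a] na[of n] a(1) by (simp add: ring_of_integers_def)
    then show ?case using Suc a(2) by (simp add: algebra_simps)
  qed
  then have "res (of_nat l * a) = res 0" using xl r0 by simp
  then have "vabs (of_nat l * a) < 1" using res_eq_iff[OF na K.zero, of l] by simp
  moreover have "vabs (of_nat l :: 'a) = 1"
    using l(1) prime_p lp by (intro vabs_of_nat_coprime) (simp add: primes_coprime)
  ultimately have "vabs (a - 0) < 1" by (simp add: vabs_mult)
  then have "res a = res 0" using res_eq_iff[OF ao K.zero] by simp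
  then show False using x(2) a(2) r0 by simp
qed

lemma q_prime_power: "\<exists>k. q = p ^ k"
proof -
  obtain m where m: "q = p ^ multiplicity p q * m" "\<not> p dvd m"
    using multiplicity_decompose'[of q p] q_ge_2 p_gt_1 by (metis dvd_1_iff_1 less_irrefl One_nat_def not_numeral_le_zero)
  have "m = 1"
  proof (rule ccontr)
    assume "m \<noteq> 1"
    then obtain l where l: "prime l" "l dvd m" using prime_factor_nat by blast
    then have "l dvd q" using m(1) by (metis dvd_mult)
    then show False using prime_dvd_q l m(2) by blast
  qed
  then show ?thesis using m(1) by auto
qed

subsection \<open>The Frobenius congruence\<close>

lemma fbd_add_power_p:
  assumes "fbd 1 f" "fbd 1 (g :: 'a fps)"
  shows "fbd (1 / real p) ((f + g) ^ p - (f ^ p + g ^ p))"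
proof -
  have "(f + g) ^ p = (\<Sum>i\<le>p. of_nat (p choose i) * f ^ i * g ^ (p - i))" by (rule binomial_ring)
  also have "{..p} = insert 0 (insert p {1..<p})" using p_gt_1 by auto
  finally have "(f + g) ^ p = g ^ p + (f ^ p + (\<Sum>i\<in>{1..<p}. of_nat (p choose i) * f ^ i * g ^ (p - i)))"
    using p_gt_1 by simp
  then have "(f + g) ^ p - (f ^ p + g ^ p) = (\<Sum>i\<in>{1..<p}. of_nat (p choose i) * (f ^ i * g ^ (p - i)))"
    by (simp add: mult.assoc)
  moreover have "fbd (1 / real p) (of_nat (p choose i) :: 'a fps)" if "i \<in> {1..<p}" for i
  proof -
    have "p dvd (p choose i)" using that prime_p by (intro dvd_choose_prime) auto
    then have "vabs (of_nat (p choose i) :: 'a) \<le> (1 / real p) ^ 1"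
      using vabs_of_int_dvd[of 1 "int (p choose i)"] by simp
    then show ?thesis unfolding fps_of_nat[symmetric] using p_gt_1 by (simp add: fbd_const)
  qed
  ultimately show ?thesis
    using p_gt_1 assms by (auto intro!: fbd_sum fbd_mult_1' fbd_mult_1[OF fbd_power fbd_power] fbd_power)
qed

text \<open>The p-th power is additive modulo p, and a congruence modulo p survives raising to the
  p-th power by \<open>fbd_power_diff\<close>.\<close>

lemma fbd_add_power_p_power:
  assumes "fbd 1 f" "fbd 1 (g :: 'a fps)"
  shows "fbd (1 / real p) ((f + g) ^ (p ^ k) - (f ^ (p ^ k) + g ^ (p ^ k)))"
proof (induction k)
  case 0
  then show ?case by simp
next
  case (Suc k)
  let ?A = "(f + g) ^ (p ^ k)" and ?B = "f ^ (p ^ k) + g ^ (p ^ k)"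
  have 1: "fbd (1 / real p) (?A ^ p - ?B ^ p)"
    using assms by (intro fbd_power_diff Suc fbd_add fbd_power)
  have 2: "fbd (1 / real p) (?B ^ p - ((f ^ (p ^ k)) ^ p + (g ^ (p ^ k)) ^ p))"
    using assms by (intro fbd_add_power_p fbd_power)
  have pow: "h ^ (p ^ Suc k) = (h ^ (p ^ k)) ^ p" for h :: "'a fps"
    by (simp add: power_mult[symmetric] mult.commute)
  have "?A ^ p - ((f ^ (p ^ k)) ^ p + (g ^ (p ^ k)) ^ p) =
      (?A ^ p - ?B ^ p) + (?B ^ p - ((f ^ (p ^ k)) ^ p + (g ^ (p ^ k)) ^ p))" by simp
  then show ?case unfolding pow using fbd_add[OF 1 2] by (simp only:)
qed

text \<open>Proved monomial by monomial: the q-th power is additive modulo p, hence modulo \<pi>,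
  and fixes integral coefficients of K modulo \<pi>.\<close>

lemma fbd_frobenius:
  assumes "f \<in> int_fps K"
  shows "fbd (vabs \<pi>) (f ^ q - fps_compose f (fps_X ^ q))"
proof (rule fconv_fbd)
  have f: "f \<in> fps_over K" "fbd 1 f" using assms by (auto simp: int_fps_iff)
  obtain k where k: "q = p ^ k" using q_prime_power by blast
  show "fconv (\<lambda>j. fps_cutoff j f ^ q - fps_compose (fps_cutoff j f) (fps_X ^ q)) (f ^ q - fps_compose f (fps_X ^ q))"
    by (intro fconv_diff fconv_power fconv_compose fconv_cutoff)
  show "fbd (vabs \<pi>) (fps_cutoff j f ^ q - fps_compose (fps_cutoff j f) (fps_X ^ q))" for j
  proof (induction j)
    case 0
    have "fps_cutoff 0 f = 0" by (auto simp: fps_eq_iff)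
    then show ?case using q_ge_2 by (simp add: power_0_left)
  next
    case (Suc j)
    let ?c = "fps_nth f j" and ?A = "fps_cutoff j f"
    let ?M = "fps_const ?c * fps_X ^ j"
    have c: "?c \<in> K" "vabs ?c \<le> 1" using f by (auto simp: fps_over_def fbd_def)
    have M: "fbd 1 ?M" using c by (intro fbd_mult_1 fbd_power fbd_X) (simp add: fbd_const)
    have 1: "fbd (vabs \<pi>) ((?A + ?M) ^ q - (?A ^ q + ?M ^ q))"
      unfolding k by (intro fbd_mono[OF fbd_add_power_p_power vabs_p_le_pi] fbd_cutoff f M)
    have "?M ^ q - fps_compose ?M (fps_X ^ q) = fps_const (?c ^ q - ?c) * (fps_X ^ q) ^ j"
    proof -
      have "fps_compose ?M (fps_X ^ q) = fps_const ?c * (fps_X ^ q) ^ j"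
        using q_ge_2 by (simp add: fps_compose_mult_distrib fps_compose_power[symmetric] fps_X_power_nth)
      then show ?thesis
        by (simp add: power_mult_distrib fps_const_power power_mult[symmetric] mult.commute[of j q]
            fps_const_sub[symmetric] left_diff_distrib del: fps_const_sub)
    qed
    moreover have "fbd (vabs \<pi>) (fps_const (?c ^ q - ?c) * (fps_X ^ q) ^ j)"
      using vabs_power_q_diff[OF c] by (intro fbd_mult_1' fbd_power fbd_X) (simp add: fbd_const)
    ultimately have 2: "fbd (vabs \<pi>) (?M ^ q - fps_compose ?M (fps_X ^ q))" by simp
    have "(?A + ?M) ^ q - fps_compose (?A + ?M) (fps_X ^ q) =
      ((?A + ?M) ^ q - (?A ^ q + ?M ^ q)) + ((?A ^ q - fps_compose ?A (fps_X ^ q)) + (?M ^ q - fps_compose ?M (fps_X ^ q)))"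
      by (simp add: fps_compose_add_distrib)
    then show ?case unfolding fps_cutoff_Suc' using fbd_add[OF 1 fbd_add[OF Suc 2]] by (simp only:)
  qed
qed

text \<open>Both f^q and f([\<pi>](x)) agree with f(x^q) modulo \<pi>. Applied to 1 + f this makes
  \<phi>(f) divisible by \<pi>.\<close>

lemma fbd_power_q_compose_e:
  assumes f: "f \<in> int_fps K"
  shows "fbd (vabs \<pi>) (f ^ q - fps_compose f e)"
proof -
  have "fbd (vabs \<pi>) (fps_compose f (fps_X ^ q) - fps_compose f e)"
    unfolding fbd_def
  proof
    fix n
    have "vabs (fps_nth f i * (fps_nth ((fps_X ^ q) ^ i) n - fps_nth (e ^ i) n)) \<le> 1 * vabs \<pi>" for i
    proof (rule vabs_mult_le)
      show "vabs (fps_nth f i) \<le> 1" using f by (auto simp: int_fps_iff fbd_def)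
      have "fbd (vabs \<pi>) ((fps_X ^ q) ^ i - e ^ i)"
        by (intro fbd_power_diff fbd_power fbd_X e_fbd fbd_minus_commute[OF e_cong])
      from fbdD[OF this, of n] show "vabs (fps_nth ((fps_X ^ q) ^ i) n - fps_nth (e ^ i) n) \<le> vabs \<pi>" by simp
    qed
    then have "vabs (\<Sum>i=0..n. fps_nth f i * (fps_nth ((fps_X ^ q) ^ i) n - fps_nth (e ^ i) n)) \<le> vabs \<pi>"
      by (intro vabs_sum_le) auto
    then show "vabs (fps_nth (fps_compose f (fps_X ^ q) - fps_compose f e) n) \<le> vabs \<pi>"
      by (simp add: fps_compose_nth sum_subtractf right_diff_distrib)
  qed
  from fbd_add[OF fbd_frobenius[OF f] this] show ?thesis by simp
qed

lemma fbd_e_compose_power_q: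
  assumes f: "fbd 1 f" "fps_nth f 0 = 0"
  shows "fbd (vabs \<pi>) (fps_compose e f - f ^ q)"
proof -
  have "fdisc f" using f by (simp add: fdisc_def)
  then have "fbd (vabs \<pi>) (fps_subst (e - fps_X ^ q) f)" by (rule fps_subst_fbd[OF e_cong])
  moreover have "fps_subst (e - fps_X ^ q) f = fps_compose e f - f ^ q"
    using fps_subst_diff[OF e_fbd fbd_power[OF fbd_X] \<open>fdisc f\<close>, of q]
      fps_subst_X_power[of q f] fps_subst_eq_compose[OF f(2), of e] by simp
  ultimately show ?thesis by simp
qed

subsection \<open>Power series commuting with the Lubin-Tate endomorphism\<close>

lemma fps_compose_e_nth_cong:
  assumes "\<And>m. m \<le> k \<Longrightarrow> fps_nth h m = fps_nth h' m"
  shows "fps_nth (fps_compose h e) k = fps_nth (fps_compose h' e) k"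
    and "fps_nth (fps_compose e h) k = fps_nth (fps_compose e h') k"
proof -
  show "fps_nth (fps_compose h e) k = fps_nth (fps_compose h' e) k"
    using assms by (auto simp: fps_compose_nth intro!: sum.cong)
  show "fps_nth (fps_compose e h) k = fps_nth (fps_compose e h') k"
    using fps_power_nth_cong[OF assms] by (simp add: fps_compose_nth)
qed

text \<open>Commutation is demanded through degree n + 1, so that stage 0 is the linear series a
  x.\<close>

definition partial_commute :: "'a \<Rightarrow> nat \<Rightarrow> 'a fps \<Rightarrow> bool" where
  "partial_commute a n h \<longleftrightarrow> h \<in> int_fps K \<and> fps_nth h 0 = 0 \<and> fps_nth h 1 = a \<and>
     (\<forall>m\<le>Suc n. fps_nth (fps_compose e h) m = fps_nth (fps_compose h e) m)"

text \<open>The approximation of Lubin and Tate. Adding c x^N changes e(h) in degree N by \<pi> c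
  and h(e) by \<pi>^N c. The defect d is divisible by \<pi>, because e(h) and h(e) are both
  congruent to h^q, and \<pi>^N - \<pi> has absolute value |\<pi>|; so the required c is
  integral.\<close>

lemma partial_commute_step:
  assumes "partial_commute a n h"
  shows "\<exists>h'. partial_commute a (Suc n) h' \<and> (\<forall>m\<le>Suc n. fps_nth h' m = fps_nth h m)"
proof -
  let ?N = "Suc (Suc n)"
  have h: "h \<in> int_fps K" "fps_nth h 0 = 0" "fps_nth h 1 = a"
    "\<And>m. m \<le> Suc n \<Longrightarrow> fps_nth (fps_compose e h) m = fps_nth (fps_compose h e) m"
    using assms by (auto simp: partial_commute_def)
  have hK: "h \<in> fps_over K" "fbd 1 h" using h(1) by (auto simp: int_fps_iff)
  define d where "d = fps_nth (fps_compose e h - fps_compose h e) ?N"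
  have "fbd (vabs \<pi>) ((fps_compose e h - h ^ q) + (h ^ q - fps_compose h e))"
    by (intro fbd_add fbd_e_compose_power_q fbd_power_q_compose_e h hK)
  then have d_le: "vabs d \<le> vabs \<pi>" unfolding d_def by (auto dest: fbdD)
  have dK: "d \<in> K" unfolding d_def by (intro K.fps_over_nth K.fps_over_intros K.fps_over_compose e_over hK)
  define c where "c = d / (\<pi> ^ ?N - \<pi>)"
  have v: "vabs (\<pi> ^ ?N - \<pi>) = vabs \<pi>"
  proof -
    have "vabs (\<pi> ^ ?N) < vabs \<pi>"
      unfolding vabs_power using vabs_pi_less_1 pi_nonzero power_strict_decreasing[of 1 ?N "vabs \<pi>"]
      by (simp del: power_Suc)
    then show ?thesis using vabs_add_eq[of "\<pi> ^ ?N" "- \<pi>"] by simp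
  qed
  then have nz: "\<pi> ^ ?N - \<pi> \<noteq> 0" using pi_nonzero by (metis vabs_eq_0_iff)
  have cK: "c \<in> K" unfolding c_def by (intro K.divide K.diff K.power dK pi_in_K)
  have c1: "vabs c \<le> 1" using d_le v pi_nonzero by (simp add: c_def vabs_divide)
  define h' where "h' = h + fps_const c * fps_X ^ ?N"
  have agree: "fps_nth h' m = fps_nth h m" if "m \<le> Suc n" for m
    using that by (simp add: h'_def fps_X_power_nth del: power_Suc)
  have h'N: "fps_nth h' ?N = fps_nth h ?N + c"
    by (simp add: h'_def fps_X_power_nth del: power_Suc)
  \<comment> \<open>The new coefficient reaches degree N only in the first power, since h has no
    constant term.\<close>
  have pow: "fps_nth (h' ^ i) ?N = fps_nth (h ^ i) ?N" if i: "i \<noteq> 1" for i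
  proof (cases "i = 0")
    case False
    then obtain j where j: "i = Suc j" "j > 0" using i by (cases i) auto
    have "fps_nth h' k * fps_nth (h' ^ j) (?N - k) = fps_nth h k * fps_nth (h ^ j) (?N - k)" if k: "k \<in> {0..?N}" for k
    proof -
      consider "k = 0" | "k = ?N" | "0 < k" "k \<le> Suc n" using k by force
      then show ?thesis
      proof cases
        case 1
        then show ?thesis using h(2) agree[of 0] by simp
      next
        case 2
        then show ?thesis using j h(2) agree[of 0] by (simp add: startsby_zero_power)
      next
        case 3
        have "fps_nth (h' ^ j) (?N - k) = fps_nth (h ^ j) (?N - k)"
          using 3 by (intro fps_power_nth_cong agree) auto
        then show ?thesis using agree[OF 3(2)] by simp
      qed
    qed
    then show ?thesis by (simp only: j power_Suc fps_mult_nth cong: sum.cong)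
  qed simp
  have "fps_nth (fps_compose e h') ?N = fps_nth (fps_compose e h) ?N + \<pi> * c"
  proof -
    have "{0..?N} = insert 1 ({0..?N} - {1})" by auto
    then have split: "fps_nth (fps_compose e g) ?N = fps_nth e 1 * fps_nth (g ^ 1) ?N + (\<Sum>i\<in>{0..?N}-{1}. fps_nth e i * fps_nth (g ^ i) ?N)" for g
      unfolding fps_compose_nth by (metis (no_types, lifting) finite_atLeastAtMost insertI1 sum.remove)
    show ?thesis unfolding split using pow by (simp add: h'N e_props(2)[unfolded One_nat_def] algebra_simps)
  qed
  moreover have "fps_nth (fps_compose h' e) ?N = fps_nth (fps_compose h e) ?N + c * \<pi> ^ ?N"
  proof -
    have "fps_compose h' e = fps_compose h e + fps_const c * e ^ ?N"
      using e_0 by (simp add: h'_def fps_compose_add_distrib fps_compose_mult_distrib fps_compose_power[symmetric] del: power_Suc)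
    moreover have "fps_nth (e ^ ?N) ?N = \<pi> ^ ?N"
      using startsby_zero_power_nth_same[OF e_0, of ?N] e_props(2) by simp
    ultimately show ?thesis by (simp del: power_Suc)
  qed
  moreover have "c * (\<pi> ^ ?N - \<pi>) = d" using nz by (simp add: c_def)
  ultimately have N: "fps_nth (fps_compose e h') ?N = fps_nth (fps_compose h' e) ?N"
    by (simp add: d_def algebra_simps)
  have "fps_nth (fps_compose e h') m = fps_nth (fps_compose h' e) m" if "m \<le> ?N" for m
  proof (cases "m = ?N")
    case False
    then have m: "m \<le> Suc n" using that by simp
    show ?thesis using fps_compose_e_nth_cong[of m h' h] agree m h(4)[OF m] by simp
  qed (use N in simp)
  moreover have "h' \<in> int_fps K" unfolding int_fps_iff h'_def
    using c1 by (intro conjI K.fps_over_intros K.fps_over_power fbd_add fbd_mult_1 fbd_power fbd_X hK cK)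
      (simp add: fbd_const)
  ultimately have "partial_commute a (Suc n) h'"
    using agree[of 0] agree[of 1] h(2,3) by (simp add: partial_commute_def)
  then show ?thesis using agree by blast
qed

lemma commuting_series_exists:
  assumes a: "a \<in> K" "vabs a \<le> 1"
  obtains h where "h \<in> int_fps K" "fps_nth h 0 = 0" "fps_nth h 1 = a" "fps_compose e h = fps_compose h e"
proof -
  have "partial_commute a 0 (fps_const a * fps_X)"
  proof -
    have int: "fps_const a * fps_X \<in> int_fps K" unfolding int_fps_iff
      using a by (intro conjI K.fps_over_intros fbd_mult_1 fbd_X) (auto simp: fbd_const)
    have "fps_compose (fps_const a * fps_X) e = fps_const a * e"
      using e_0 by (simp add: fps_compose_mult_distrib)
    moreover have "m = 0 \<or> m = 1" if "m \<le> Suc 0" for m using that by auto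
    ultimately show ?thesis using int e_0 e_props(2)
      by (auto simp: partial_commute_def le_Suc_eq fps_compose_nth)
  qed
  then have "\<exists>H. \<forall>n. partial_commute a n (H n) \<and> (\<forall>m\<le>Suc n. fps_nth (H (Suc n)) m = fps_nth (H n) m)"
    by (intro dependent_nat_choice[of "partial_commute a" "\<lambda>n h h'. \<forall>m\<le>Suc n. fps_nth h' m = fps_nth h m"] partial_commute_step)
      blast
  then obtain H where H: "\<And>n. partial_commute a n (H n)"
    and step: "\<And>n m. m \<le> Suc n \<Longrightarrow> fps_nth (H (Suc n)) m = fps_nth (H n) m" by blast
  \<comment> \<open>Successive stages agree through growing degrees, so the diagonal series agrees
    with stage n through degree n.\<close>
  define h where "h = Abs_fps (\<lambda>m. fps_nth (H m) m)"
  have agree: "fps_nth h m = fps_nth (H n) m" if "m \<le> n" for m n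
    using that
  proof (induction n)
    case (Suc n)
    show ?case
    proof (cases "m = Suc n")
      case False
      then show ?thesis using Suc step[of m n] by simp
    qed (simp add: h_def)
  qed (simp add: h_def)
  show ?thesis
  proof (rule that)
    show "h \<in> int_fps K" using H by (auto simp: int_fps_def h_def partial_commute_def)
    show "fps_nth h 0 = 0" "fps_nth h 1 = a" using H by (auto simp: h_def partial_commute_def)
    show "fps_compose e h = fps_compose h e"
    proof (rule fps_ext)
      fix m
      show "fps_nth (fps_compose e h) m = fps_nth (fps_compose h e) m"
        using fps_compose_e_nth_cong[of m h "H m"] agree H[of m] by (simp add: partial_commute_def)
    qed
  qed
qed

subsection \<open>The endomorphisms attached to powers of the uniformizer\<close>

lemma fgl_endo_eqI:
  assumes "fgl_endomorphism K F f" "fps_nth f 1 = a"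
  shows "fgl_endo K F a = f"
  unfolding fgl_endo_def
proof (rule the_equality)
  show "fgl_endomorphism K F f \<and> fps_nth f 1 = a" using assms by simp
  fix g assume "fgl_endomorphism K F g \<and> fps_nth g 1 = a"
  then show "g = f" using assms by (intro endo_unique) (auto simp: fgl_endomorphism_def)
qed

lemma fgl_endo_pi: "fgl_endo K F \<pi> = e"
  by (rule fgl_endo_eqI) (rule e_props)+

definition e_iter :: "nat \<Rightarrow> 'a fps" where
  "e_iter n = ((\<lambda>f. fps_compose f e) ^^ n) fps_X"

lemma e_iter_Suc: "e_iter (Suc n) = fps_compose (e_iter n) e"
  by (simp add: e_iter_def)

abbreviation E :: "'a \<Rightarrow> 'a" where "E z \<equiv> fps_value e z"

lemma vabs_E_less: "vabs z < 1 \<Longrightarrow> vabs (E z) < 1"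
  by (rule fps_value_fdisc[OF fdisc_e])

lemma vabs_E_iter_less: "vabs z < 1 \<Longrightarrow> vabs ((E ^^ n) z) < 1"
  by (induction n) (auto intro: vabs_E_less)

lemma e_iter_props: "e_iter n \<in> int_fps K" "fps_nth (e_iter n) 0 = 0" "fps_nth (e_iter n) 1 = \<pi> ^ n"
  "vabs z < 1 \<Longrightarrow> fps_value (e_iter n) z = (E ^^ n) z"
proof (induction n arbitrary: z)
  case 0
  {
    case 1
    show ?case by (auto simp: e_iter_def int_fps_iff intro: K.fps_over_intros)
  next
    case 2
    show ?case by (simp add: e_iter_def)
  next
    case 3
    show ?case by (simp add: e_iter_def)
  next
    case 4
    show ?case by (simp add: e_iter_def)
  }
next
  case (Suc n)
  have i: "e_iter n \<in> fps_over K" "fbd 1 (e_iter n)" using Suc(1) by (auto simp: int_fps_iff)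
  {
    case 1
    show ?case unfolding e_iter_Suc int_fps_iff
      using fps_subst_fbd[OF i(2) fdisc_e] by (auto intro: K.fps_over_compose i e_over simp: fps_subst_eq_compose[OF e_0])
  next
    case 2
    show ?case using Suc(2) by (simp add: e_iter_Suc)
  next
    case 3
    show ?case using Suc(3) e_0 e_props(2) by (simp add: e_iter_Suc fps_compose_nth)
  next
    case 4
    have "fps_value (e_iter (Suc n)) z = fps_value (e_iter n) (E z)"
      unfolding e_iter_Suc fps_subst_eq_compose[OF e_0, symmetric] by (rule fps_value_subst[OF i(2) fdisc_e 4])
    also have "\<dots> = (E ^^ Suc n) z" unfolding Suc(4)[OF vabs_E_less[OF 4]] by (simp add: funpow_swap1)
    finally show ?case .
  }
qed

lemma E_fadd: "vabs z < 1 \<Longrightarrow> vabs w < 1 \<Longrightarrow> E (fadd z w) = fadd (E z) (E w)"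
  by (rule endo_fadd[OF e_fbd e_0 _ _ e_endo])

lemma E_iter_fadd: "vabs z < 1 \<Longrightarrow> vabs w < 1 \<Longrightarrow> (E ^^ n) (fadd z w) = fadd ((E ^^ n) z) ((E ^^ n) w)"
  by (induction n) (auto simp: E_fadd vabs_E_iter_less)

lemma fgl_endo_pi_power: "fgl_endo K F (\<pi> ^ n) = e_iter n"
proof (rule fgl_endo_eqI)
  show "fps_nth (e_iter n) 1 = \<pi> ^ n" by (rule e_iter_props)
  have i: "e_iter n \<in> fps_over K" "fbd 1 (e_iter n)" using e_iter_props(1) by (auto simp: int_fps_iff)
  have "subst1 (e_iter n) (subst2 F varx vary) = subst2 F (subst1 (e_iter n) varx) (subst1 (e_iter n) vary)"
    by (rule endo_from_fadd[OF i(2) e_iter_props(2) pi_nonzero vabs_pi_less_1])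
      (simp add: e_iter_props(4) vabs_fadd_less E_iter_fadd)
  then show "fgl_endomorphism K F (e_iter n)"
    by (simp add: fgl_endomorphism_def e_iter_props)
qed

lemma torsion_iff: "z \<in> torsion K F \<pi> n \<longleftrightarrow> vabs z < 1 \<and> (E ^^ Suc n) z = 0"
  unfolding torsion_def Suc_eq_plus1[symmetric] fgl_endo_pi_power by (auto simp: e_iter_props(4) simp del: funpow.simps)

lemma e_translate: "vabs w < 1 \<Longrightarrow> fps_subst e (trans w) = fps_compose (trans (E w)) e"
  by (rule endo_translate[OF e_fbd e_0 _ e_endo])

text \<open>[\<pi>] sends z to 0 and F(x, 0) = x. Consequently every integral series in [\<pi>](x)
  is invariant under translation by the kernel.\<close>

lemma e_translate_torsion:
  assumes "z \<in> torsion K F \<pi> 0"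
  shows "fps_subst e (trans z) = e"
  using assms e_translate[of z] by (simp add: torsion_iff trans_0 fps_X_fps_compose_startby0 e_0)

end

section \<open>Weierstrass preparation\<close>

lemma card_simple_roots:
  fixes P :: "'a::alg_closed_field poly"
  assumes "P \<noteq> 0" "\<And>a. poly P a = 0 \<Longrightarrow> poly (pderiv P) a \<noteq> 0"
  shows "card {x. poly P x = 0} = degree P"
  using assms
proof (induction "degree P" arbitrary: P)
  case 0
  then obtain c where "P = [:c:]" by (metis degree_eq_zeroE)
  then show ?case using 0 by auto
next
  case (Suc n)
  then obtain a where a: "poly P a = 0" using alg_closed_imp_poly_has_root[of P] by auto
  then obtain Q where Q: "P = [:-a, 1:] * Q" by (auto simp: poly_eq_0_iff_dvd dvd_def)
  have Q0: "Q \<noteq> 0" using Q Suc.prems by auto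
  have deg: "degree P = Suc (degree Q)" unfolding Q using Q0 by (subst degree_mult_eq) auto
  have "pderiv P = [:-a, 1:] * pderiv Q + Q * pderiv [:-a, 1:]" unfolding Q by (rule pderiv_mult)
  then have der: "poly (pderiv P) x = poly Q x + (x - a) * poly (pderiv Q) x" for x
    by (simp only: poly_add poly_mult) (simp add: pderiv_pCons)
  have Qa: "poly Q a \<noteq> 0" using Suc.prems(2)[OF a] der[of a] by simp
  have "card {x. poly Q x = 0} = degree Q"
  proof (rule Suc.hyps(1))
    show "n = degree Q" using Suc.hyps(2) deg by simp
    show "poly (pderiv Q) x \<noteq> 0" if "poly Q x = 0" for x
      using Suc.prems(2)[of x] der[of x] that by (auto simp: Q)
  qed (rule Q0)
  moreover have "{x. poly P x = 0} = insert a {x. poly Q x = 0}" by (auto simp: Q)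
  ultimately show ?case using Qa poly_roots_finite[OF Q0] deg by simp
qed

lemma fps_value_fps_of_poly: "fps_value (fps_of_poly P) x = poly P x"
proof -
  have "fps_value (fps_of_poly P) x = (\<Sum>n\<le>degree P. coeff P n * x ^ n)"
    unfolding fps_value_def fps_of_poly_nth by (rule suminf_finite) (auto simp: coeff_eq_0)
  then show ?thesis by (simp add: poly_altdef)
qed

lemma fps_shift_fconv: "fconv Y f \<Longrightarrow> fconv (\<lambda>j. fps_shift q (Y j)) (fps_shift q f)"
  by (simp add: fconv_def)

lemma fps_shift_diff: "fps_shift n (f - g) = fps_shift n f - fps_shift n (g :: 'a::ab_group_add fps)"
  by (simp add: fps_eq_iff)

lemma fconv_telescope:
  fixes Z :: "nat \<Rightarrow> 'a::{nonarch_field,complete_space} fps"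
  assumes c: "0 \<le> c" "c < 1" and Z: "\<And>k. fbd (c ^ k) (Z (Suc k) - Z k)"
  shows "\<exists>z. fconv Z z"
proof -
  have "convergent (\<lambda>k. fps_nth (Z k) n)" for n
  proof -
    have "summable (\<lambda>k. fps_nth (Z (Suc k)) n - fps_nth (Z k) n)"
      using Z c by (intro nonarch_summable[OF LIMSEQ_realpow_zero[OF c]]) (simp add: fbd_def)
    then have "convergent (\<lambda>k. (\<Sum>i<k. fps_nth (Z (Suc i)) n - fps_nth (Z i) n))"
      by (simp add: summable_iff_convergent)
    then have "convergent (\<lambda>k. fps_nth (Z k) n - fps_nth (Z 0) n)" by (simp only: sum_lessThan_telescope[of "\<lambda>i. fps_nth (Z i) n"])
    then obtain l where "(\<lambda>k. fps_nth (Z k) n - fps_nth (Z 0) n) \<longlonglongrightarrow> l" by (auto simp: convergent_def)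
    from tendsto_add[OF this tendsto_const[of "fps_nth (Z 0) n"]] show ?thesis by (auto simp: convergent_def)
  qed
  then have "\<forall>n. \<exists>l. (\<lambda>k. fps_nth (Z k) n) \<longlonglongrightarrow> l" by (simp add: convergent_def)
  then obtain l where "\<And>n. (\<lambda>k. fps_nth (Z k) n) \<longlonglongrightarrow> l n" by metis
  then show ?thesis by (intro exI[of _ "Abs_fps l"]) (simp add: fconv_def)
qed

text \<open>The cofactor is \<open>V Z\<close>, where \<open>V\<close> inverts the part of \<open>g\<close> of order at least \<open>q\<close> and \<open>Z\<close> is
  the fixed point of a contraction.\<close>

lemma (in closed_subfield) weierstrass_preparation:
  assumes g: "g \<in> int_fps L" and gq: "vabs (fps_nth g q) = 1"
    and c: "0 \<le> c" "c < 1" and small: "\<And>i. i < q \<Longrightarrow> vabs (fps_nth g i) \<le> c"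
  obtains P Q where "\<And>i. coeff P i \<in> L" "degree P = q" "lead_coeff P = 1"
    "\<And>i. i < q \<Longrightarrow> vabs (coeff P i) \<le> c" "fbd 1 Q" "vabs (fps_nth Q 0) = 1" "fps_of_poly P = g * Q"
proof -
  have gL: "g \<in> fps_over L" and g1: "fbd 1 g" using g by (auto simp: int_fps_iff)
  define A U V where "A = fps_cutoff q g" and "U = fps_shift q g" and "V = inverse U"
  have U0: "vabs (fps_nth U 0) = 1" using gq by (simp add: U_def)
  have U: "U \<in> fps_over L" "fbd 1 U" using gL g1 by (auto simp: U_def fps_over_def fbd_def)
  have V: "V \<in> fps_over L" "fbd 1 V" "V * U = 1"
    using fps_over_inverse[OF U(1)] fbd_inverse[OF U(2) U0] U0
    by (auto simp: V_def intro!: inverse_mult_eq_1)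
  have A: "A \<in> fps_over L" "fbd c A" using gL zero small c by (auto simp: A_def fps_over_def fbd_def)
  have g_eq: "g = A + fps_X ^ q * U"
    by (auto simp: fps_eq_iff A_def U_def fps_X_power_mult_nth)
  \<comment> \<open>Since V U = 1, the product g V Z is A V Z + x^q Z. Requiring its part of degree
    at least q to be exactly x^q gives Z = \<Phi> Z; the contraction factor is the bound c of
    A.\<close>
  define \<Phi> where "\<Phi> Z = 1 - fps_shift q (A * (V * Z))" for Z
  define Z where "Z k = (\<Phi> ^^ k) 0" for k
  have Z_Suc: "Z (Suc k) = \<Phi> (Z k)" for k by (simp add: Z_def)
  have shift_fbd: "fbd d (fps_shift q f)" if "fbd d f" for d and f :: "'a fps" using that by (simp add: fbd_def)
  have Zi: "Z k \<in> fps_over L \<and> fbd 1 (Z k)" for k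
  proof (induction k)
    case 0
    then show ?case by (simp add: Z_def fps_over_intros)
  next
    case (Suc k)
    have "A * (V * Z k) \<in> fps_over L" using Suc by (intro fps_over_intros A V) auto
    moreover have "fbd 1 (A * (V * Z k))" using Suc c by (intro fbd_mult_1 V fbd_mono[OF A(2)]) auto
    ultimately show ?case unfolding Z_Suc \<Phi>_def
      by (auto intro!: fps_over_intros fbd_diff shift_fbd) (simp add: fps_over_def)
  qed
  have diff: "fbd (c ^ k) (Z (Suc k) - Z k)" for k
  proof (induction k)
    case 0
    then show ?case by (simp add: Z_def \<Phi>_def)
  next
    case (Suc k)
    have "\<Phi> x - \<Phi> y = - fps_shift q (A * (V * (x - y)))" for x y
      unfolding \<Phi>_def right_diff_distrib fps_shift_diff by simp
    then have "Z (Suc (Suc k)) - Z (Suc k) = - fps_shift q (A * (V * (Z (Suc k) - Z k)))"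
      using Z_Suc by metis
    moreover have "fbd (c * c ^ k) (A * (V * (Z (Suc k) - Z k)))"
      by (intro fbd_mult A fbd_mult_1 V Suc)
    ultimately show ?case by (simp add: shift_fbd)
  qed
  obtain z where z: "fconv Z z" using fconv_telescope[OF c diff] by blast
  have zL: "z \<in> fps_over L" by (rule fps_over_limit[OF z]) (use Zi in blast)
  have z1: "fbd 1 z" by (rule fconv_fbd[OF z]) (use Zi in blast)
  have "fconv (\<lambda>k. \<Phi> (Z k)) (\<Phi> z)" unfolding \<Phi>_def
    by (intro fconv_diff fconv_const fps_shift_fconv fconv_mult z)
  moreover have "fconv (\<lambda>k. Z (Suc k)) z" 
    unfolding fconv_def by (intro allI, rule LIMSEQ_Suc) (use z in \<open>simp add: fconv_def\<close>)
  ultimately have fixpoint: "z = \<Phi> z" unfolding Z_Suc by (rule fconv_unique[symmetric])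
  define Q where "Q = V * z"
  have AVz: "fbd c (A * (V * z))" by (intro fbd_mult_1' A fbd_mult_1 V z1)
  have gQ: "g * Q = A * (V * z) + fps_X ^ q * z"
  proof -
    have "g * Q = A * (V * z) + fps_X ^ q * ((V * U) * z)" unfolding g_eq Q_def by (simp add: algebra_simps)
    then show ?thesis using V(3) by simp
  qed
  have hi: "fps_nth (g * Q) n = (if n = q then 1 else 0)" if "q \<le> n" for n
  proof -
    have "fps_nth z (n - q) = fps_nth (\<Phi> z) (n - q)" using fixpoint by simp
    then show ?thesis using that by (auto simp: gQ \<Phi>_def fps_X_power_mult_nth)
  qed
  have lo: "fps_nth (g * Q) n = fps_nth (A * (V * z)) n" if "n < q" for n
    using that by (simp add: gQ fps_X_power_mult_nth)
  define P where "P = monom 1 q + (\<Sum>i<q. monom (fps_nth (g * Q) i) i)"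
  have coeff_P: "coeff P n = fps_nth (g * Q) n" for n
  proof -
    have "coeff P n = (if q = n then 1 else 0) + (\<Sum>i<q. if i = n then fps_nth (g * Q) i else 0)"
      by (simp add: P_def coeff_sum)
    also have "\<dots> = (if q = n then 1 else 0) + (if n < q then fps_nth (g * Q) n else 0)"
      by (simp add: sum.delta)
    finally show ?thesis using hi[of n] by auto
  qed
  have "degree P = q"
    by (rule antisym, rule degree_le) (auto simp: coeff_P hi intro!: le_degree)
  moreover have "coeff P i \<in> L" for i
    unfolding coeff_P Q_def by (intro fps_over_nth fps_over_intros gL V zL)
  moreover have "fbd 1 Q" unfolding Q_def by (intro fbd_mult_1 V z1)
  moreover have "vabs (fps_nth Q 0) = 1"
  proof -
    have "fps_nth z 0 = 1 - fps_nth (A * (V * z)) q" by (subst fixpoint) (simp add: \<Phi>_def)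
    moreover have "vabs (fps_nth (A * (V * z)) q) < 1" using fbdD[OF AVz, of q] c by simp
    ultimately have "vabs (fps_nth z 0 - 1) < vabs (1::'a)" by simp
    then have "vabs (fps_nth z 0) = 1" using vabs_eq_of_diff_less[of "fps_nth z 0" 1] by simp
    moreover have "vabs (fps_nth V 0) = 1" using U0 by (simp add: V_def vabs_inverse)
    ultimately show ?thesis by (simp add: Q_def vabs_mult)
  qed
  moreover have "fps_of_poly P = g * Q" by (simp add: fps_eq_iff coeff_P)
  ultimately show ?thesis
    using that[of P Q] hi[of q] lo fbdD[OF AVz] by (simp add: coeff_P)
qed

text \<open>Where |x| \<ge> 1 the leading term strictly dominates all others, so there is no
  root.\<close>

lemma monic_root_vabs_less_1:
  fixes P :: "'a::nonarch_field poly"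
  assumes "degree P = q" "lead_coeff P = 1" "\<And>i. i < q \<Longrightarrow> vabs (coeff P i) < 1" "poly P x = 0"
  shows "vabs x < 1"
proof (rule ccontr)
  assume "\<not> vabs x < 1"
  then have x: "1 \<le> vabs x" by simp
  then have x0: "x \<noteq> 0" by auto
  have "poly P x = (\<Sum>i<q. coeff P i * x ^ i) + x ^ q"
    using assms(1,2) by (simp add: poly_altdef lessThan_Suc_atMost[symmetric])
  then have "vabs (\<Sum>i<q. coeff P i * x ^ i) = vabs (x ^ q)"
    using assms(4) by (metis add_eq_0_iff2 vabs_minus)
  moreover have "vabs (\<Sum>i<q. coeff P i * x ^ i) < vabs (x ^ q)"
  proof (rule vabs_sum_less)
    fix i assume "i \<in> {..<q}"
    then have i: "vabs (coeff P i) < 1" "i \<le> q" using assms(3) by auto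
    have "vabs (coeff P i * x ^ i) = vabs (coeff P i) * vabs x ^ i" by (simp add: vabs_mult vabs_power)
    also have "\<dots> < 1 * vabs x ^ i" using i x0 by (intro mult_strict_right_mono) auto
    also have "\<dots> \<le> vabs (x ^ q)" using i x by (simp add: vabs_power power_increasing)
    finally show "vabs (coeff P i * x ^ i) < vabs (x ^ q)" .
  qed (use x in auto)
  ultimately show False by simp
qed

text \<open>The cofactor has no zero on the open disc, so the polynomial has exactly the zeros of
  \<open>g\<close> there. The clause on linear coefficients will show that 0 is a simple root of the
  polynomial attached to [\<pi>].\<close>

lemma (in closed_subfield) weierstrass_polynomial:
  assumes g: "g \<in> int_fps L" and gq: "vabs (fps_nth g q) = 1"
    and c: "0 \<le> c" "c < 1" and small: "\<And>i. i < q \<Longrightarrow> vabs (fps_nth g i) \<le> c"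
  obtains P where "\<And>i. coeff P i \<in> L" "degree P = q" "lead_coeff P = 1"
    "\<And>x. poly P x = 0 \<longleftrightarrow> vabs x < 1 \<and> fps_value g x = 0"
    "fps_nth g 0 = 0 \<Longrightarrow> vabs (coeff P 1) = vabs (fps_nth g 1)"
proof -
  obtain P Q where P: "\<And>i. coeff P i \<in> L" "degree P = q" "lead_coeff P = 1"
    "\<And>i. i < q \<Longrightarrow> vabs (coeff P i) \<le> c" and Q: "fbd 1 Q" "vabs (fps_nth Q 0) = 1" "fps_of_poly P = g * Q"
    using weierstrass_preparation[OF assms] by metis
  have g1: "fbd 1 g" using g by (simp add: int_fps_iff)
  have "poly P x = 0 \<longleftrightarrow> fps_value g x = 0" if x: "vabs x < 1" for x
  proof -
    have "vabs (fps_value Q x - fps_nth Q 0) < vabs (fps_nth Q 0)"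
      using vabs_fps_value_minus_nth_0[OF Q(1) x] x Q(2) by simp
    then have "vabs (fps_value Q x) = 1" using vabs_eq_of_diff_less Q(2) by metis
    then have "fps_value Q x \<noteq> 0" by auto
    moreover have "poly P x = fps_value g x * fps_value Q x"
      using fps_value_mult[OF g1 Q(1) x] Q(3) fps_value_fps_of_poly[of P x] by simp
    ultimately show ?thesis by simp
  qed
  moreover have "vabs x < 1" if "poly P x = 0" for x
    by (rule monic_root_vabs_less_1[OF P(2,3) _ that]) (use P(4) c in \<open>auto intro: le_less_trans\<close>)
  moreover have "vabs (coeff P 1) = vabs (fps_nth g 1)" if "fps_nth g 0 = 0"
  proof -
    have "coeff P 1 = fps_nth (g * Q) 1" by (simp flip: Q(3))
    then show ?thesis using that Q(2) by (simp add: fps_mult_nth vabs_mult)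
  qed
  ultimately show ?thesis using that[OF P(1-3)] by blast
qed

section \<open>Totally ramified simple extensions\<close>

definition polys_over :: "'a::zero set \<Rightarrow> 'a poly set" where
  "polys_over L = {A. \<forall>i. coeff A i \<in> L}"

text \<open>The ring L[u]; in the ramified situation below it is a field, by
  \<open>M_closed_subfield\<close>.\<close>

definition adjoin :: "'a::comm_semiring_0 set \<Rightarrow> 'a \<Rightarrow> 'a set" where
  "adjoin L u = {poly A u | A. A \<in> polys_over L}"

context closed_subfield
begin

lemma polys_over_intros:
  "0 \<in> polys_over L" "c \<in> L \<Longrightarrow> monom c n \<in> polys_over L" "c \<in> L \<Longrightarrow> [:c:] \<in> polys_over L"
  "A \<in> polys_over L \<Longrightarrow> B \<in> polys_over L \<Longrightarrow> A + B \<in> polys_over L"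
  "A \<in> polys_over L \<Longrightarrow> B \<in> polys_over L \<Longrightarrow> A - B \<in> polys_over L"
  "A \<in> polys_over L \<Longrightarrow> B \<in> polys_over L \<Longrightarrow> A * B \<in> polys_over L"
  "A \<in> polys_over L \<Longrightarrow> pderiv A \<in> polys_over L"
  by (auto simp: polys_over_def coeff_mult coeff_pderiv coeff_pCons split: nat.splits
      intro!: zero add diff mult sum of_nat simp del: of_nat_Suc)

text \<open>Long division: the leading coefficient of \<open>B\<close> is invertible in
  \<open>L\<close>, so quotient and remainder keep their coefficients there.\<close>

lemma polys_over_divide:
  assumes B: "B \<in> polys_over L" "B \<noteq> 0" and A: "A \<in> polys_over L"
  shows "\<exists>C\<in>polys_over L. \<exists>R\<in>polys_over L. A = B * C + R \<and> (R = 0 \<or> degree R < degree B)"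
  using A
proof (induction "degree A" arbitrary: A rule: less_induct)
  case less
  show ?case
  proof (cases "A = 0 \<or> degree A < degree B")
    case True
    then show ?thesis using less.prems by (intro bexI[of _ 0] bexI[of _ A]) (auto intro: polys_over_intros)
  next
    case False
    then have A0: "A \<noteq> 0" and deg: "degree B \<le> degree A" by auto
    define M where "M = monom (lead_coeff A / lead_coeff B) (degree A - degree B)"
    have M: "M \<in> polys_over L" unfolding M_def
      using less.prems B(1) by (intro polys_over_intros divide) (auto simp: polys_over_def)
    define A' where "A' = A - B * M"
    have A': "A' \<in> polys_over L" unfolding A'_def by (intro polys_over_intros less.prems B M)
    have degBM: "degree (B * M) = degree A"
      using B A0 deg by (simp add: M_def degree_mult_eq degree_monom_eq)
    have "coeff (B * M) (degree A) = lead_coeff A"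
      using lead_coeff_mult[of B M] B A0 degBM by (simp add: M_def degree_monom_eq)
    then have c0: "coeff A' (degree A) = 0" by (simp add: A'_def)
    have le: "degree A' \<le> degree A" unfolding A'_def using degBM by (intro degree_diff_le) auto
    have "\<exists>C\<in>polys_over L. \<exists>R\<in>polys_over L. A' = B * C + R \<and> (R = 0 \<or> degree R < degree B)"
    proof (cases "A' = 0")
      case True
      then show ?thesis by (intro bexI[of _ 0]) (auto intro: polys_over_intros)
    next
      case False
      have "degree A' \<noteq> degree A" using c0 False by (metis leading_coeff_0_iff)
      then show ?thesis using less.hyps[of A'] le A' by simp
    qed
    then obtain C R where CR: "C \<in> polys_over L" "R \<in> polys_over L" "A' = B * C + R" "R = 0 \<or> degree R < degree B"
      by blast
    then have "A = B * (C + M) + R" by (simp add: A'_def algebra_simps)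
    then show ?thesis using CR M by (intro bexI[of _ "C + M"] bexI[of _ R]) (auto intro: polys_over_intros)
  qed
qed

end

text \<open>An extension generated by \<open>u\<close> whose powers \<open>1, u, ..., u^(d-1)\<close> have distinct absolute values
  modulo the value group of the base, hence are orthogonal.\<close>

locale ramified_extension = closed_subfield L
  for L :: "'a::{nonarch_field, alg_closed_field, complete_space} set" +
  fixes P :: "'a poly" and d :: nat and \<rho> :: real and u :: 'a
  assumes value_group: "\<And>x. x \<in> L \<Longrightarrow> x \<noteq> 0 \<Longrightarrow> \<exists>k::int. vabs x = \<rho> powi (int d * k)"
    and rho: "0 < \<rho>" "\<rho> < 1" and d_pos: "0 < d"
    and P: "P \<in> polys_over L" "degree P = d" "lead_coeff P = 1"
    and root_vabs: "\<And>w. poly P w = 0 \<Longrightarrow> vabs w = \<rho>"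
    and root_u: "poly P u = 0"
begin

lemma powi_rho_inject: "\<rho> powi k = \<rho> powi l \<Longrightarrow> k = l"
  using power_int_strict_decreasing[of k l \<rho>] power_int_strict_decreasing[of l k \<rho>] rho
  by (cases k l rule: linorder_cases) auto

lemma orthogonal:
  assumes c: "\<And>i. i < d \<Longrightarrow> c i \<in> L" and w: "vabs w = \<rho>" and nz: "\<exists>i<d. c i \<noteq> 0"
  shows "\<exists>i<d. c i \<noteq> 0 \<and> vabs (\<Sum>j<d. c j * w ^ j) = vabs (c i * w ^ i) \<and>
      vabs ((\<Sum>j<d. c j * w ^ j) - c i * w ^ i) < vabs (c i * w ^ i) \<and>
      (\<forall>j<d. vabs (c j * w ^ j) \<le> vabs (c i * w ^ i))"
proof -
  let ?f = "\<lambda>i. vabs (c i * w ^ i)"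
  let ?S = "{i. i < d \<and> c i \<noteq> 0}"
  have w0: "w \<noteq> 0" using w rho by auto
  have "finite ?S" "?S \<noteq> {}" using nz by auto
  then have "Max (?f ` ?S) \<in> ?f ` ?S" by (intro Max_in) auto
  then obtain i where i: "i < d" "c i \<noteq> 0" "?f i = Max (?f ` ?S)" by force
  have powi: "\<exists>k. ?f j = \<rho> powi (int d * k + int j)" if j: "j < d" "c j \<noteq> 0" for j
  proof -
    obtain k where "vabs (c j) = \<rho> powi (int d * k)" using value_group[OF c[OF j(1)] j(2)] by blast
    then have "?f j = \<rho> powi (int d * k + int j)"
      using w rho j by (simp add: vabs_mult vabs_power power_int_add)
    then show ?thesis by blast
  qed
  have less: "?f j < ?f i" if j: "j < d" "j \<noteq> i" for j
  proof (cases "c j = 0")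
    case True
    moreover have "0 < ?f i" using i(2) w0 by simp
    ultimately show ?thesis by simp
  next
    case False
    have "?f j \<le> ?f i" unfolding i(3) using j False \<open>finite ?S\<close> by (intro Max_ge) auto
    moreover have "?f j \<noteq> ?f i"
    proof
      assume eq: "?f j = ?f i"
      obtain k where k: "?f j = \<rho> powi (int d * k + int j)" using powi[OF \<open>j < d\<close> False] by blast
      obtain l where l: "?f i = \<rho> powi (int d * l + int i)" using powi[OF i(1,2)] by blast
      then have "int d * k + int j = int d * l + int i" using eq k l powi_rho_inject by metis
      \<comment> \<open>Modulo d the exponents of the two terms are j and i, both below d.\<close>
      then have "(int d * k + int j) mod int d = (int d * l + int i) mod int d" by simp
      then have "int j = int i" using j i by simp
      then show False using j by simp
    qed
    ultimately show ?thesis by simp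
  qed
  have rest: "(\<Sum>j<d. c j * w ^ j) - c i * w ^ i = (\<Sum>j\<in>{..<d}-{i}. c j * w ^ j)"
    using i by (simp add: sum.remove)
  have "vabs ((\<Sum>j<d. c j * w ^ j) - c i * w ^ i) < ?f i"
    unfolding rest using less i(2) w0 by (intro vabs_sum_less) auto
  moreover from this have "vabs (\<Sum>j<d. c j * w ^ j) = ?f i" by (rule vabs_eq_of_diff_less)
  moreover have "\<forall>j<d. ?f j \<le> ?f i" using less by (metis less_imp_le order_refl)
  ultimately show ?thesis using i by blast
qed

lemma poly_eq_sum:
  fixes w :: 'a
  assumes "degree R < d"
  shows "poly R w = (\<Sum>j<d. coeff R j * w ^ j)"
  unfolding poly_altdef
  by (rule sum.mono_neutral_left) (use assms in \<open>auto simp: coeff_eq_0\<close>)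

lemma poly_orthogonal:
  assumes R: "R \<in> polys_over L" "degree R < d" "R \<noteq> 0" and w: "vabs w = \<rho>"
  shows "\<exists>i<d. coeff R i \<noteq> 0 \<and> vabs (poly R w) = vabs (coeff R i * w ^ i) \<and>
      (\<forall>j<d. vabs (coeff R j * w ^ j) \<le> vabs (coeff R i * w ^ i))"
proof -
  have "\<exists>i<d. coeff R i \<noteq> 0" using R(2,3) leading_coeff_0_iff by blast
  then show ?thesis
    using orthogonal[of "coeff R" w] R w unfolding poly_eq_sum[OF R(2)] by (auto simp: polys_over_def)
qed

lemma poly_nonzero:
  assumes "R \<in> polys_over L" "degree R < d" "R \<noteq> 0" "vabs w = \<rho>"
  shows "poly R w \<noteq> 0"
proof -
  have "w \<noteq> 0" using assms rho by auto
  then show ?thesis using poly_orthogonal[OF assms] by auto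
qed

lemma coeff_le_poly:
  assumes "R \<in> polys_over L" "degree R < d" "vabs w = \<rho>" "j < d"
  shows "vabs (coeff R j * w ^ j) \<le> vabs (poly R w)"
  using poly_orthogonal[OF assms(1,2) _ assms(3)] assms(4) by (cases "R = 0") auto

text \<open>Both absolute values are the maximum of |coeff R i| \<rho>^i over i < d.\<close>

lemma vabs_poly_eq:
  assumes R: "R \<in> polys_over L" "degree R < d" and w: "vabs w = \<rho>" "vabs w' = \<rho>"
  shows "vabs (poly R w) = vabs (poly R w')"
proof (cases "R = 0")
  case False
  have eq: "vabs (coeff R i * w ^ i) = vabs (coeff R i * w' ^ i)" for i using w by (simp add: vabs_mult vabs_power)
  obtain i where "i < d" "vabs (poly R w) = vabs (coeff R i * w ^ i)" using poly_orthogonal[OF R False w(1)] by blast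
  moreover obtain j where "j < d" "vabs (poly R w') = vabs (coeff R j * w' ^ j)" using poly_orthogonal[OF R False w(2)] by blast
  ultimately show ?thesis
    using coeff_le_poly[OF R w(1), of j] coeff_le_poly[OF R w(2), of i] eq by (metis antisym)
qed simp

lemma P_nonzero: "P \<noteq> 0"
  using P(3) by auto

lemma reduce:
  assumes "A \<in> polys_over L"
  obtains R where "R \<in> polys_over L" "degree R < d" "\<And>w. poly P w = 0 \<Longrightarrow> poly A w = poly R w"
proof -
  obtain C R where CR: "R \<in> polys_over L" "A = P * C + R" "R = 0 \<or> degree R < degree P"
    using polys_over_divide[OF P(1) P_nonzero assms] by blast
  show ?thesis using that[of R] CR P(2) d_pos by auto
qed

lemma vabs_u: "vabs u = \<rho>"
  by (rule root_vabs[OF root_u])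

text \<open>In characteristic 0 the derivative is a nonzero polynomial of degree below d, so by
  orthogonality it does not vanish at points of absolute value \<rho>.\<close>

lemma root_simple: "poly P w = 0 \<Longrightarrow> poly (pderiv P) w \<noteq> 0"
proof -
  assume w: "poly P w = 0"
  have "pderiv P \<noteq> 0" using P(2) d_pos by (simp add: pderiv_eq_0_iff)
  moreover have "degree (pderiv P) < d" using P(2) d_pos by (simp add: degree_pderiv)
  ultimately show ?thesis using root_vabs[OF w] by (intro poly_nonzero polys_over_intros P)
qed

lemma card_roots: "card {w. poly P w = 0} = d"
  using card_simple_roots[OF P_nonzero root_simple] P(2) by simp

text \<open>Orthogonality does the work of irreducibility of \<open>P\<close>: a remainder of degree
  below d that vanishes at u is 0.\<close>

lemma poly_root_transfer:
  assumes "A \<in> polys_over L" "B \<in> polys_over L" "poly A u = poly B u" "poly P w = 0"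
  shows "poly A w = poly B w"
proof -
  obtain R where R: "R \<in> polys_over L" "degree R < d" "\<And>w. poly P w = 0 \<Longrightarrow> poly (A - B) w = poly R w"
    using reduce[OF polys_over_intros(5)[OF assms(1,2)]] by metis
  have "poly R u = 0" using R(3)[OF root_u] assms(3) by simp
  then have "R = 0" using poly_nonzero[OF R(1,2) _ vabs_u] by blast
  then show ?thesis using R(3)[OF assms(4)] by simp
qed

lemma vabs_poly_root_eq:
  assumes "A \<in> polys_over L" "poly P w = 0"
  shows "vabs (poly A w) = vabs (poly A u)"
proof -
  obtain R where R: "R \<in> polys_over L" "degree R < d" "\<And>w. poly P w = 0 \<Longrightarrow> poly A w = poly R w"
    using reduce[OF assms(1)] by metis
  show ?thesis using vabs_poly_eq[OF R(1,2) root_vabs[OF assms(2)] vabs_u] R(3) root_u assms(2) by simp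
qed

abbreviation "M \<equiv> adjoin L u"

lemma M_intros: "c \<in> L \<Longrightarrow> c \<in> M" "u \<in> M"
proof -
  show "c \<in> L \<Longrightarrow> c \<in> M" unfolding adjoin_def by (intro CollectI exI[of _ "[:c:]"]) (auto intro: polys_over_intros)
  show "u \<in> M" unfolding adjoin_def
    by (intro CollectI exI[of _ "monom 1 1"]) (auto simp: poly_monom intro: polys_over_intros one)
qed

lemma M_reduced:
  assumes "y \<in> M"
  obtains R where "R \<in> polys_over L" "degree R < d" "y = poly R u"
proof -
  obtain A where A: "A \<in> polys_over L" "y = poly A u" using assms by (auto simp: adjoin_def)
  obtain R where "R \<in> polys_over L" "degree R < d" "\<And>w. poly P w = 0 \<Longrightarrow> poly A w = poly R w"
    using reduce[OF A(1)] by metis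
  then show ?thesis using that[of R] A root_u by simp
qed

lemma M_arith:
  assumes "x \<in> M" "y \<in> M"
  shows "x - y \<in> M" "x * y \<in> M"
proof -
  obtain A B where AB: "A \<in> polys_over L" "B \<in> polys_over L" "x = poly A u" "y = poly B u"
    using assms by (auto simp: adjoin_def)
  show "x - y \<in> M" unfolding adjoin_def using AB
    by (intro CollectI exI[of _ "A - B"]) (auto intro: polys_over_intros)
  show "x * y \<in> M" unfolding adjoin_def using AB
    by (intro CollectI exI[of _ "A * B"]) (auto intro: polys_over_intros)
qed

text \<open>Dividing \<open>P\<close> by \<open>R\<close> with remainder R' gives R(u) C(u) = -
  R'(u) at the root u, where R' is nonzero of smaller degree.\<close>

lemma M_inverse_poly:
  assumes "R \<in> polys_over L" "R \<noteq> 0" "degree R < d"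
  shows "inverse (poly R u) \<in> M"
  using assms
proof (induction "degree R" arbitrary: R rule: less_induct)
  case less
  show ?case
  proof (cases "degree R = 0")
    case True
    then obtain c where c: "R = [:c:]" by (metis degree_eq_zeroE)
    have "c \<in> L" using less.prems(1) unfolding c polys_over_def by (auto dest: spec[of _ 0])
    then show ?thesis using c by (auto intro!: M_intros(1) inv)
  next
    case False
    obtain C R' where CR: "C \<in> polys_over L" "R' \<in> polys_over L" "P = R * C + R'" "R' = 0 \<or> degree R' < degree R"
      using polys_over_divide[OF less.prems(1,2) P(1)] by blast
    have Ru: "poly R u \<noteq> 0" by (rule poly_nonzero[OF less.prems(1,3,2) vabs_u])
    have R'0: "R' \<noteq> 0"
    proof
      assume R': "R' = 0"
      then have PRC: "P = R * C" using CR by simp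
      then have "C \<noteq> 0" using P_nonzero by auto
      moreover have "degree C < d"
        using PRC \<open>C \<noteq> 0\<close> less.prems(2) False P(2) degree_mult_eq[of R C] by simp
      ultimately have "poly C u \<noteq> 0" using CR by (intro poly_nonzero vabs_u)
      then show False using Ru root_u PRC by simp
    qed
    then have deg: "degree R' < degree R" using CR(4) by blast
    have inv': "inverse (poly R' u) \<in> M" using deg CR(2) R'0 less.prems(3) by (intro less.hyps) auto
    have R'u: "poly R' u \<noteq> 0" using deg less.prems(3) by (intro poly_nonzero CR R'0 vabs_u) simp
    have "poly R u * poly C u = - poly R' u" using root_u CR(3) by (simp add: eq_neg_iff_add_eq_0)
    then have eq: "inverse (poly R u) = - 1 * poly C u * inverse (poly R' u)"
      using Ru R'u by (simp add: field_simps)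
    have "poly C u \<in> M" using CR(1) by (auto simp: adjoin_def)
    then show ?thesis unfolding eq
      by (intro M_arith inv' M_intros(1)[OF uminus[OF one]])
  qed
qed

text \<open>By orthogonality each coefficient of a reduced representative is controlled by its value
  at u, so along a convergent sequence the coefficients are Cauchy and converge in
  \<open>L\<close>.\<close>

lemma M_closed: "closed M"
  unfolding closed_sequential_limits
proof (intro allI impI, elim conjE)
  fix y l assume y: "\<forall>n. y n \<in> M" and l: "y \<longlonglongrightarrow> l"
  have "\<forall>n. \<exists>R. R \<in> polys_over L \<and> degree R < d \<and> y n = poly R u"
    using y M_reduced by metis
  then obtain R where R: "\<And>n. R n \<in> polys_over L" "\<And>n. degree (R n) < d" "\<And>n. y n = poly (R n) u" by metis
  have "convergent (\<lambda>n. coeff (R n) i)" if i: "i < d" for i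
  proof -
    have "Cauchy (\<lambda>n. coeff (R n) i)"
    proof (rule metric_CauchyI)
      fix e :: real assume "0 < e"
      then have "0 < e * \<rho> ^ i" using rho by simp
      then obtain N where N: "\<And>m n. m \<ge> N \<Longrightarrow> n \<ge> N \<Longrightarrow> dist (y m) (y n) < e * \<rho> ^ i"
        using metric_CauchyD[OF LIMSEQ_imp_Cauchy[OF l]] by blast
      have "dist (coeff (R m) i) (coeff (R n) i) < e" if "m \<ge> N" "n \<ge> N" for m n
      proof -
        have "degree (R m - R n) < d" using R(2)[of m] R(2)[of n] by (intro degree_diff_less) auto
        then have "vabs (coeff (R m - R n) i * u ^ i) \<le> vabs (poly (R m - R n) u)"
          by (intro coeff_le_poly polys_over_intros R vabs_u i)
        also have "\<dots> < e * \<rho> ^ i" using N[OF that] by (simp add: R(3) dist_vabs)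
        finally have "vabs (coeff (R m) i - coeff (R n) i) * \<rho> ^ i < e * \<rho> ^ i"
          by (simp add: vabs_mult vabs_power vabs_u)
        then show ?thesis using rho by (simp add: dist_vabs)
      qed
      then show "\<exists>N. \<forall>m\<ge>N. \<forall>n\<ge>N. dist (coeff (R m) i) (coeff (R n) i) < e" by blast
    qed
    then show ?thesis by (simp add: Cauchy_convergent_iff)
  qed
  then have "\<forall>i. \<exists>k. i < d \<longrightarrow> (\<lambda>n. coeff (R n) i) \<longlonglongrightarrow> k" by (auto simp: convergent_def)
  then obtain k where k: "\<And>i. i < d \<Longrightarrow> (\<lambda>n. coeff (R n) i) \<longlonglongrightarrow> k i" by metis
  have kL: "k i \<in> L" if "i < d" for i
    using R(1) by (intro limit[OF k[OF that]]) (simp add: polys_over_def)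
  have "(\<lambda>n. \<Sum>i<d. coeff (R n) i * u ^ i) \<longlonglongrightarrow> (\<Sum>i<d. k i * u ^ i)"
    by (intro tendsto_sum tendsto_mult_right k) simp
  moreover have "y = (\<lambda>n. \<Sum>i<d. coeff (R n) i * u ^ i)"
    by (rule ext) (simp add: R(3) poly_eq_sum[OF R(2)])
  ultimately have "y \<longlonglongrightarrow> (\<Sum>i<d. k i * u ^ i)" by simp
  then have "l = (\<Sum>i<d. k i * u ^ i)" using l LIMSEQ_unique by blast
  also have "\<dots> = poly (\<Sum>i<d. monom (k i) i) u" by (simp add: poly_sum poly_monom)
  also have "\<dots> \<in> M"
  proof -
    have "coeff (\<Sum>i<d. monom (k i) i) n \<in> L" for n
      using kL by (auto simp: coeff_sum intro!: sum zero)
    then show ?thesis unfolding adjoin_def polys_over_def by blast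
  qed
  finally show "l \<in> M" .
qed

lemma M_closed_subfield: "closed_subfield M"
proof
  show "inverse x \<in> M" if x: "x \<in> M" for x
  proof (cases "x = 0")
    case False
    obtain R where R: "R \<in> polys_over L" "degree R < d" "x = poly R u" using M_reduced[OF x] by metis
    then have "R \<noteq> 0" using False by auto
    then show ?thesis using M_inverse_poly R by simp
  qed (use x in simp)
qed (auto intro: M_intros one M_arith M_closed)

lemma M_value_group:
  assumes "y \<in> M" "y \<noteq> 0"
  shows "\<exists>k::int. vabs y = \<rho> powi k"
proof -
  obtain R where R: "R \<in> polys_over L" "degree R < d" "y = poly R u" using M_reduced[OF assms(1)] by metis
  then have "R \<noteq> 0" using assms(2) by auto
  then obtain i where i: "i < d" "coeff R i \<noteq> 0" "vabs y = vabs (coeff R i * u ^ i)"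
    using poly_orthogonal[OF R(1,2) _ vabs_u] R(3) by blast
  obtain k where "vabs (coeff R i) = \<rho> powi (int d * k)"
    using value_group[OF _ i(2)] R(1) by (auto simp: polys_over_def)
  then have "vabs y = \<rho> powi (int d * k + int i)"
    using i(3) rho by (simp add: vabs_mult vabs_power vabs_u power_int_add)
  then show ?thesis by blast
qed

subsection \<open>Embeddings\<close>

text \<open>Sends A(u) to A(w). The chosen representative is immaterial when w is a root of
  \<open>P\<close>, by \<open>poly_root_transfer\<close>.\<close>

definition conj_map :: "'a \<Rightarrow> 'a \<Rightarrow> 'a" where
  "conj_map w = (\<lambda>y\<in>M. poly (SOME A. A \<in> polys_over L \<and> poly A u = y) w)"

lemma conj_map_poly:
  assumes "A \<in> polys_over L" "poly P w = 0"
  shows "conj_map w (poly A u) = poly A w"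
proof -
  have M: "poly A u \<in> M" using assms by (auto simp: adjoin_def)
  have "\<exists>B. B \<in> polys_over L \<and> poly B u = poly A u" using assms by blast
  note B = someI_ex[OF this]
  show ?thesis
    unfolding conj_map_def restrict_apply'[OF M]
    by (rule poly_root_transfer[OF B[THEN conjunct1] assms(1) B[THEN conjunct2] assms(2)])
qed

lemma conj_map_embedding:
  assumes w: "poly P w = 0"
  shows "conj_map w \<in> embeddings L M"
proof -
  have "conj_map w \<in> ring_hom (subring_of M) ring_of_type_algebra"
  proof (rule ring_hom_memI)
    fix x y assume "x \<in> carrier (subring_of M)" "y \<in> carrier (subring_of M)"
    then obtain A B where AB: "A \<in> polys_over L" "B \<in> polys_over L" "x = poly A u" "y = poly B u"
      by (auto simp: adjoin_def)
    show "conj_map w (x \<otimes>\<^bsub>subring_of M\<^esub> y) = conj_map w x \<otimes>\<^bsub>ring_of_type_algebra\<^esub> conj_map w y"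
      using conj_map_poly[OF polys_over_intros(6)[OF AB(1,2)] w] AB w by (simp add: conj_map_poly)
    show "conj_map w (x \<oplus>\<^bsub>subring_of M\<^esub> y) = conj_map w x \<oplus>\<^bsub>ring_of_type_algebra\<^esub> conj_map w y"
      using conj_map_poly[OF polys_over_intros(4)[OF AB(1,2)] w] AB w by (simp add: conj_map_poly)
  next
    show "conj_map w \<one>\<^bsub>subring_of M\<^esub> = \<one>\<^bsub>ring_of_type_algebra\<^esub>"
      using conj_map_poly[OF polys_over_intros(3)[OF one] w] by simp
  qed simp
  moreover have "conj_map w \<in> extensional M" by (simp add: conj_map_def)
  moreover have "conj_map w x = x" if "x \<in> L" for x
    using conj_map_poly[OF polys_over_intros(3)[OF that] w] by simp
  ultimately show ?thesis by (simp add: embeddings_def)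
qed

lemma embedding_poly:
  assumes s: "\<sigma> \<in> embeddings L M" and A: "A \<in> polys_over L"
  shows "\<sigma> (poly A u) = poly A (\<sigma> u)"
proof -
  have hom: "\<sigma> \<in> ring_hom (subring_of M) ring_of_type_algebra" and fixL: "\<And>x. x \<in> L \<Longrightarrow> \<sigma> x = x"
    using s by (auto simp: embeddings_def)
  have mult: "\<sigma> (x * y) = \<sigma> x * \<sigma> y" and add: "\<sigma> (x + y) = \<sigma> x + \<sigma> y" if "x \<in> M" "y \<in> M" for x y
    using ring_hom_mult[OF hom, of x y] ring_hom_add[OF hom, of x y] that by auto
  from A show ?thesis
  proof (induction A)
    case 0
    then show ?case using fixL[OF zero] by simp
  next
    case (pCons a A)
    have a: "a \<in> L" using pCons.prems by (auto simp: polys_over_def dest!: spec[of _ 0])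
    have "coeff A i \<in> L" for i
      using pCons.prems unfolding polys_over_def by (auto dest!: spec[of _ "Suc i"])
    then have A: "A \<in> polys_over L" by (simp add: polys_over_def)
    have M: "poly A u \<in> M" using A by (auto simp: adjoin_def)
    have "\<sigma> (poly (pCons a A) u) = \<sigma> a + \<sigma> (u * poly A u)"
      unfolding poly_pCons by (intro add M_intros a M_arith M)
    also have "\<dots> = a + \<sigma> u * poly A (\<sigma> u)" using fixL[OF a] mult[OF M_intros(2) M] pCons.IH[OF A] by simp
    finally show ?case by simp
  qed
qed

lemma embedding_root:
  assumes "\<sigma> \<in> embeddings L M"
  shows "poly P (\<sigma> u) = 0"
proof -
  have "\<sigma> 0 = 0" using assms zero by (auto simp: embeddings_def)
  then show ?thesis using embedding_poly[OF assms P(1)] root_u by simp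
qed

lemma embeddings_bij: "bij_betw (\<lambda>\<sigma>. \<sigma> u) (embeddings L M) {w. poly P w = 0}"
proof (rule bij_betwI')
  fix \<sigma> \<tau> assume st: "\<sigma> \<in> embeddings L M" "\<tau> \<in> embeddings L M"
  show "(\<sigma> u = \<tau> u) = (\<sigma> = \<tau>)"
  proof
    assume eq: "\<sigma> u = \<tau> u"
    show "\<sigma> = \<tau>"
    proof (rule extensionalityI[of _ M])
      show "\<sigma> \<in> extensional M" "\<tau> \<in> extensional M" using st by (auto simp: embeddings_def)
      fix x assume "x \<in> M"
      then obtain A where "A \<in> polys_over L" "x = poly A u" by (auto simp: adjoin_def)
      then show "\<sigma> x = \<tau> x" using embedding_poly[OF st(1)] embedding_poly[OF st(2)] eq by simp
    qed
  qed simp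
next
  fix \<sigma> assume "\<sigma> \<in> embeddings L M"
  then show "\<sigma> u \<in> {w. poly P w = 0}" using embedding_root by simp
next
  fix w assume "w \<in> {w. poly P w = 0}"
  then have w: "poly P w = 0" by simp
  have "conj_map w u = w"
    using conj_map_poly[OF polys_over_intros(2)[OF one, of 1] w] by (simp add: poly_monom)
  then show "\<exists>\<sigma>\<in>embeddings L M. w = \<sigma> u" using conj_map_embedding[OF w] by metis
qed

text \<open>Embeddings are isometric by orthogonality, hence commute with evaluation of series.\<close>

lemma embedding_fps_value:
  assumes s: "\<sigma> \<in> embeddings L M" and h: "h \<in> int_fps L"
  shows "\<sigma> (fps_value h u) = fps_value h (\<sigma> u)"
proof -
  have h1: "fbd 1 h" "h \<in> fps_over L" using h by (auto simp: int_fps_iff)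
  have u1: "vabs u < 1" "vabs (\<sigma> u) < 1"
    using vabs_u root_vabs[OF embedding_root[OF s]] rho by auto
  have "fps_value h u \<in> M"
    using M_intros h1 u1 by (intro closed_subfield.fps_value_in[OF M_closed_subfield]) (auto simp: fps_over_def)
  then obtain A where A: "A \<in> polys_over L" "fps_value h u = poly A u" by (auto simp: adjoin_def)
  define S where "S n = (\<Sum>i<n. monom (fps_nth h i) i)" for n
  have S: "S n \<in> polys_over L" for n
  proof -
    have "coeff (S n) k \<in> L" for k using h1(2) by (auto simp: S_def coeff_sum fps_over_def intro!: sum zero)
    then show ?thesis by (simp add: polys_over_def)
  qed
  have S_val: "poly (S n) w = (\<Sum>i<n. fps_nth h i * w ^ i)" for n w by (simp add: S_def poly_sum poly_monom)
  have lim: "(\<lambda>n. poly (S n) u) \<longlonglongrightarrow> poly A u" "(\<lambda>n. poly (S n) (\<sigma> u)) \<longlonglongrightarrow> fps_value h (\<sigma> u)"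
    using fps_value_sums[OF h1(1) u1(1)] fps_value_sums[OF h1(1) u1(2)] by (simp_all add: S_val sums_def A(2))
  have "(\<lambda>n. poly (S n) (\<sigma> u)) \<longlonglongrightarrow> poly A (\<sigma> u)"
  proof (rule tendsto_vabs_bound)
    show "(\<lambda>n. vabs (poly (S n) u - poly A u)) \<longlonglongrightarrow> 0" using lim(1) by (simp add: tendsto_vabs_iff)
    show "vabs (poly (S n) (\<sigma> u) - poly A (\<sigma> u)) \<le> vabs (poly (S n) u - poly A u)" for n
      using vabs_poly_root_eq[OF polys_over_intros(5)[OF S A(1)] embedding_root[OF s], of n] by simp
  qed
  then have "poly A (\<sigma> u) = fps_value h (\<sigma> u)" using lim(2) LIMSEQ_unique by blast
  then show ?thesis using embedding_poly[OF s A(1)] A(2) by simp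
qed

lemma field_norm_fps_value:
  assumes "h \<in> int_fps L"
  shows "field_norm L M (fps_value h u) = (\<Prod>w | poly P w = 0. fps_value h w)"
proof -
  have "field_norm L M (fps_value h u) = (\<Prod>\<sigma>\<in>embeddings L M. fps_value h (\<sigma> u))"
    unfolding field_norm_def by (intro prod.cong refl embedding_fps_value assms)
  also have "\<dots> = (\<Prod>w\<in>{w. poly P w = 0}. fps_value h w)"
    by (rule prod.reindex_bij_betw[OF embeddings_bij])
  finally show ?thesis by simp
qed

end

section \<open>The Lubin-Tate tower\<close>

lemma closed_subfield_UNIV: "closed_subfield (UNIV :: 'a::{nonarch_field,complete_space} set)"
  by standard auto

context lubin_tate
begin

section \<open>Absolute values of [\<pi>](z) and the size of its fibres\<close>

lemma vabs_e_nth_q: "vabs (fps_nth e q) = 1"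
proof -
  have "vabs (fps_nth e q - 1) < vabs (1 :: 'a)"
    using fbdD[OF e_cong, of q] vabs_pi_less_1 by simp
  then show ?thesis using vabs_eq_of_diff_less[of "fps_nth e q" 1] by simp
qed

lemma vabs_e_nth_less: "i < q \<Longrightarrow> vabs (fps_nth e i) \<le> vabs \<pi>"
  using fbdD[OF e_cong, of i] by simp

text \<open>All coefficients of [\<pi>](x) - x^q are divisible by \<pi>, and the quotient by x has
  constant term \<pi>; so the linear term \<pi> z dominates on the open disc.\<close>

lemma vabs_E_minus_power:
  assumes z: "vabs z < 1"
  shows "vabs (E z - z ^ q) = vabs \<pi> * vabs z"
proof (cases "z = 0")
  case True
  then show ?thesis using q_ge_2 by (simp add: e_0)
next
  case False
  let ?D = "e - fps_X ^ q"
  let ?S = "fps_shift 1 ?D"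
  have D: "?D = fps_X * ?S"
    using q_ge_2 e_0 by (auto simp: fps_eq_iff fps_X_power_nth)
  have S: "fbd (vabs \<pi>) ?S" using e_cong by (simp add: fbd_def)
  have S0: "fps_nth ?S 0 = \<pi>" using q_ge_2 e_props(2) by (simp add: fps_X_power_nth)
  have "vabs (fps_value ?S z - \<pi>) \<le> vabs \<pi> * vabs z"
    using vabs_fps_value_minus_nth_0[OF S z] S0 by simp
  also have "\<dots> < vabs \<pi>" using z pi_nonzero by simp
  finally have "vabs (fps_value ?S z) = vabs \<pi>" by (rule vabs_eq_of_diff_less)
  moreover have "fps_value ?D z = z * fps_value ?S z"
    using fps_value_mult[OF fbd_X S z] D by simp
  moreover have "fps_value ?D z = E z - z ^ q"
    using fps_value_diff[OF e_fbd fbd_power[OF fbd_X] z] fps_value_power[OF fbd_X z] by simp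
  ultimately show ?thesis by (simp add: vabs_mult mult.commute)
qed

lemma E_zero_vabs:
  assumes "vabs z < 1" "E z = 0" "z \<noteq> 0"
  shows "vabs z ^ (q - 1) = vabs \<pi>"
proof -
  have "vabs z * vabs z ^ (q - 1) = vabs z ^ q" using q_ge_2 by (metis power_eq_if not_numeral_le_zero)
  moreover have "vabs z ^ q = vabs \<pi> * vabs z" using vabs_E_minus_power[OF assms(1)] assms(2) by (simp add: vabs_power)
  ultimately show ?thesis using assms(3) by simp
qed

text \<open>The error |\<pi>| |z| of replacing [\<pi>](z) by z^q is below |\<pi>|, hence below
  |[\<pi>](z)|.\<close>

lemma vabs_E_large:
  assumes z: "vabs z < 1" and E: "vabs \<pi> \<le> vabs (E z)"
  shows "vabs (E z) = vabs z ^ q"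
proof -
  have "vabs (E z - z ^ q) < vabs (E z)"
  proof -
    have "vabs \<pi> * vabs z < vabs \<pi>" using z pi_nonzero by simp
    then show ?thesis using E vabs_E_minus_power[OF z] by linarith
  qed
  then have "vabs (z ^ q - E z) < vabs (E z)" by (simp add: vabs_minus_commute)
  then have "vabs (z ^ q) = vabs (E z)" by (rule vabs_eq_of_diff_less)
  then show ?thesis by (simp add: vabs_power)
qed

lemma fadd_0_right: "fadd x 0 = x"
  by (simp add: trans_0)

lemma zero_torsion: "0 \<in> torsion K F \<pi> 0"
  by (simp add: torsion_iff e_0)

lemma F0_iff: "z \<in> torsion K F \<pi> 0 \<longleftrightarrow> vabs z < 1 \<and> E z = 0"
  by (simp add: torsion_iff)

text \<open>Weierstrass preparation for [\<pi>](x) - w: the coefficient of degree q is a unit, and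
  those below it are bounded by the larger of |\<pi>| and |w|.\<close>

lemma weierstrass_E:
  assumes L: "closed_subfield L" "K \<subseteq> L" and w: "w \<in> L" "vabs w < 1"
  obtains P where "\<And>i. coeff P i \<in> L" "degree P = q" "lead_coeff P = 1"
    "\<And>x. poly P x = 0 \<longleftrightarrow> vabs x < 1 \<and> E x = w" "w = 0 \<Longrightarrow> vabs (coeff P 1) = vabs \<pi>"
proof -
  interpret L: closed_subfield L by (rule L)
  let ?g = "e - fps_const w"
  have e: "e \<in> fps_over L" using e_over L(2) by (auto simp: fps_over_def)
  have wb: "fbd 1 (fps_const w)" using w by (simp add: fbd_const)
  have g: "?g \<in> int_fps L" unfolding int_fps_iff
    by (intro conjI L.fps_over_intros e w fbd_diff e_fbd wb)
  have gq: "vabs (fps_nth ?g q) = 1" using vabs_e_nth_q q_ge_2 by simp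
  have small: "vabs (fps_nth ?g i) \<le> max (vabs \<pi>) (vabs w)" if "i < q" for i
    using vabs_e_nth_less[OF that] e_0 by (cases "i = 0") auto
  obtain P where P: "\<And>i. coeff P i \<in> L" "degree P = q" "lead_coeff P = 1"
    "\<And>x. poly P x = 0 \<longleftrightarrow> vabs x < 1 \<and> fps_value ?g x = 0"
    "fps_nth ?g 0 = 0 \<Longrightarrow> vabs (coeff P 1) = vabs (fps_nth ?g 1)"
    by (rule L.weierstrass_polynomial[OF g gq, of "max (vabs \<pi>) (vabs w)"])
      (use small vabs_pi_less_1 w in \<open>auto simp: max_def\<close>)
  have "poly P x = 0 \<longleftrightarrow> vabs x < 1 \<and> E x = w" for x
    using P(4)[of x] fps_value_diff[OF e_fbd wb, of x] by auto
  moreover have "vabs (coeff P 1) = vabs \<pi>" if "w = 0" using P(5) that e_props(2) e_0 by simp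
  ultimately show ?thesis using that P(1-3) by blast
qed

lemma fibre_card_le:
  assumes w: "vabs w < 1"
  shows "finite {x. vabs x < 1 \<and> E x = w}" "card {x. vabs x < 1 \<and> E x = w} \<le> q"
proof -
  obtain P where P: "\<And>i. coeff P i \<in> UNIV" "degree P = q" "lead_coeff P = 1"
    "\<And>x. poly P x = 0 \<longleftrightarrow> vabs x < 1 \<and> E x = w" "w = 0 \<Longrightarrow> vabs (coeff P 1) = vabs \<pi>"
    using weierstrass_E[OF closed_subfield_UNIV _ _ w] by (metis UNIV_I subset_UNIV)
  have "P \<noteq> 0" using P(3) by auto
  then show "finite {x. vabs x < 1 \<and> E x = w}" "card {x. vabs x < 1 \<and> E x = w} \<le> q"
    using poly_roots_finite[of P] card_poly_roots_bound[of P] P(2) by (simp_all add: P(4))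
qed

end

locale lubin_tate_tower = lubin_tate p K \<pi> F q
  for p :: nat and K :: "'a::{nonarch_field, alg_closed_field, complete_space} set"
    and \<pi> :: 'a and F :: "'a fps fps" and q :: nat +
  fixes u :: "nat \<Rightarrow> 'a"
  assumes u_0: "u 0 \<in> torsion K F \<pi> 0" "u 0 \<noteq> 0"
    and u_Suc: "vabs (u (Suc n)) < 1" "E (u (Suc n)) = u n"
begin

section \<open>The system u_n and the ramified extensions it generates\<close>

lemma vabs_u_less_1: "vabs (u n) < 1"
  using u_0(1) u_Suc(1) by (cases n) (auto simp: torsion_iff)

lemma E_u_0: "E (u 0) = 0"
  using u_0(1) by (simp add: torsion_iff)

lemma vabs_u_0: "vabs (u 0) ^ (q - 1) = vabs \<pi>"
  by (rule E_zero_vabs[OF vabs_u_less_1 E_u_0 u_0(2)])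

text \<open>Supplies the hypothesis of \<open>vabs_E_large\<close> at every level of the
  tower.\<close>

lemma pi_le_vabs_u: "vabs \<pi> \<le> vabs (u n)"
proof (induction n)
  case 0
  have "vabs (u 0) ^ (q - 1) \<le> vabs (u 0) ^ 1"
    using vabs_u_less_1[of 0] q_ge_2 by (intro power_decreasing) auto
  then show ?case using vabs_u_0 by simp
next
  case (Suc n)
  have "vabs (u n) = vabs (u (Suc n)) ^ q" using vabs_E_large[OF u_Suc(1)] u_Suc(2) Suc by simp
  also have "\<dots> \<le> vabs (u (Suc n)) ^ 1"
    using vabs_u_less_1[of "Suc n"] q_ge_2 by (intro power_decreasing) auto
  finally show ?case using Suc by simp
qed

lemma vabs_u_Suc: "vabs (u (Suc n)) ^ q = vabs (u n)"
  using vabs_E_large[OF u_Suc(1)[of n]] u_Suc(2)[of n] pi_le_vabs_u[of n] by simp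

lemma u_nonzero: "u n \<noteq> 0"
  using pi_le_vabs_u[of n] pi_nonzero by (metis vabs_eq_0_iff vabs_nonneg antisym)

lemma E_iter_u: "(E ^^ m) (u (n + m)) = u n"
proof (induction m)
  case (Suc m)
  have "(E ^^ Suc m) (u (n + Suc m)) = (E ^^ m) (E (u (Suc (n + m))))" by (simp only: funpow_Suc_right o_apply add_Suc_right)
  then show ?case using Suc u_Suc(2) by simp
qed simp

lemma u_torsion: "u n \<in> torsion K F \<pi> n"
proof -
  have "(E ^^ Suc n) (u n) = E ((E ^^ n) (u (0 + n)))" by simp
  then show ?thesis using E_iter_u[of n 0] E_u_0 vabs_u_less_1 by (simp add: torsion_iff del: funpow.simps)
qed

text \<open>K(u_0, ..., u_n) by successive adjunction; \<open>torsion_field_eq\<close> identifies it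
  with K_n, which is generated by the whole kernel of [\<pi>^(n+1)].\<close>

fun Lf :: "nat \<Rightarrow> 'a set" where
  "Lf 0 = adjoin K (u 0)"
| "Lf (Suc n) = adjoin (Lf n) (u (Suc n))"

text \<open>The Weierstrass polynomial of [\<pi>] has the root 0, simple because its linear
  coefficient has absolute value |\<pi>|. Dividing by x leaves degree q - 1 and the nonzero kernel
  points as roots, all of absolute value |u_0|, where |u_0|^(q-1) = |\<pi>|.\<close>

lemma base_extension:
  "\<exists>P. ramified_extension K P (q - 1) (vabs (u 0)) (u 0) \<and> (\<forall>x. poly P x = 0 \<longleftrightarrow> x \<in> torsion K F \<pi> 0 - {0})"
proof -
  obtain P where P: "\<And>i. coeff P i \<in> K" "degree P = q" "lead_coeff P = 1"
    "\<And>x. poly P x = 0 \<longleftrightarrow> vabs x < 1 \<and> E x = 0" "vabs (coeff P 1) = vabs \<pi>"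
    using weierstrass_E[OF K.closed_subfield_axioms subset_refl K.zero] by auto
  have "poly P 0 = 0" using P(4)[of 0] by (simp add: e_0)
  then obtain R where R: "P = pCons 0 R" by (cases P) auto
  have R0: "R \<noteq> 0" using R P(3) by auto
  then have degR: "degree R = q - 1" using R P(2) by auto
  have coeffR: "coeff R i \<in> K" for i using P(1)[of "Suc i"] R by simp
  have lead: "lead_coeff R = 1" using R R0 P(3) by simp
  have c0: "coeff R 0 \<noteq> 0"
  proof -
    have "coeff P 1 = coeff R 0" by (simp add: R)
    then show ?thesis using P(5) pi_nonzero by (metis vabs_eq_0_iff)
  qed
  have roots: "poly R x = 0 \<longleftrightarrow> x \<in> torsion K F \<pi> 0 - {0}" for x
  proof (cases "x = 0")
    case True
    then show ?thesis using c0 by (simp add: poly_0_coeff_0)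
  next
    case False
    then have "poly R x = 0 \<longleftrightarrow> poly P x = 0" by (simp add: R)
    then show ?thesis using False P(4) by (simp add: F0_iff)
  qed
  have "ramified_extension K R (q - 1) (vabs (u 0)) (u 0)"
  proof
    show "0 < q - 1" using q_ge_2 by simp
    show "0 < vabs (u 0)" using u_nonzero by simp
    show "vabs (u 0) < 1" by (rule vabs_u_less_1)
    show "R \<in> polys_over K" using coeffR by (simp add: polys_over_def)
    show "degree R = q - 1" "lead_coeff R = 1" by fact+
    show "\<exists>k::int. vabs x = vabs (u 0) powi (int (q - 1) * k)" if x: "x \<in> K" "x \<noteq> 0" for x
    proof -
      obtain k where "vabs x = vabs \<pi> powi k" using vabs_K_eq_powi[OF x] by blast
      then show ?thesis unfolding vabs_u_0[symmetric] by (intro exI[of _ k]) (simp add: power_int_mult)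
    qed
    show "vabs w = vabs (u 0)" if "poly R w = 0" for w
    proof -
      have w: "vabs w < 1" "E w = 0" "w \<noteq> 0" using that roots by (auto simp: F0_iff)
      have "vabs w ^ (q - 1) = vabs (u 0) ^ (q - 1)" using E_zero_vabs[OF w] vabs_u_0 by simp
      then show ?thesis by (rule power_eq_imp_eq_base) (use q_ge_2 in auto)
    qed
    show "poly R (u 0) = 0" unfolding roots using u_0 by simp
  qed
  then show ?thesis using roots by blast
qed

text \<open>Here d = q, because |u_(n+1)|^q = |u_n| and every preimage of u_n under [\<pi>] has the
  same absolute value.\<close>

lemma step_extension:
  assumes L: "closed_subfield L" "K \<subseteq> L" "u n \<in> L"
    and vg: "\<And>x. x \<in> L \<Longrightarrow> x \<noteq> 0 \<Longrightarrow> \<exists>k::int. vabs x = vabs (u n) powi k"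
  shows "\<exists>P. ramified_extension L P q (vabs (u (Suc n))) (u (Suc n)) \<and>
    (\<forall>x. poly P x = 0 \<longleftrightarrow> vabs x < 1 \<and> E x = u n)"
proof -
  interpret L: closed_subfield L by (rule L)
  obtain P where P: "\<And>i. coeff P i \<in> L" "degree P = q" "lead_coeff P = 1"
    "\<And>x. poly P x = 0 \<longleftrightarrow> vabs x < 1 \<and> E x = u n" "u n = 0 \<Longrightarrow> vabs (coeff P 1) = vabs \<pi>"
    using weierstrass_E[OF L(1,2,3) vabs_u_less_1] by metis
  have "ramified_extension L P q (vabs (u (Suc n))) (u (Suc n))"
  proof
    show "0 < q" using q_ge_2 by simp
    show "0 < vabs (u (Suc n))" using u_nonzero by simp
    show "vabs (u (Suc n)) < 1" by (rule vabs_u_less_1)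
    show "P \<in> polys_over L" using P by (simp add: polys_over_def)
    show "degree P = q" "lead_coeff P = 1" by fact+
    show "\<exists>k::int. vabs x = vabs (u (Suc n)) powi (int q * k)" if x: "x \<in> L" "x \<noteq> 0" for x
    proof -
      obtain k where "vabs x = vabs (u n) powi k" using vg[OF x] by blast
      then show ?thesis unfolding vabs_u_Suc[of n, symmetric] by (intro exI[of _ k]) (simp add: power_int_mult)
    qed
    show "vabs w = vabs (u (Suc n))" if "poly P w = 0" for w
    proof -
      have w: "vabs w < 1" "E w = u n" using that P(4) by auto
      have "vabs w ^ q = vabs (u (Suc n)) ^ q"
        using vabs_E_large[OF w(1)] w(2) pi_le_vabs_u[of n] vabs_u_Suc by simp
      then show ?thesis by (rule power_eq_imp_eq_base) (use q_ge_2 in auto)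
    qed
    show "poly P (u (Suc n)) = 0" unfolding P(4) using u_Suc by simp
  qed
  then show ?thesis using P(4) by blast
qed

lemma Lf_props:
  "closed_subfield (Lf n) \<and> K \<subseteq> Lf n \<and> u n \<in> Lf n \<and>
    (\<forall>x\<in>Lf n. x \<noteq> 0 \<longrightarrow> (\<exists>k::int. vabs x = vabs (u n) powi k))"
proof (induction n)
  case 0
  obtain P where "ramified_extension K P (q - 1) (vabs (u 0)) (u 0)" using base_extension by blast
  then interpret R: ramified_extension K P "q - 1" "vabs (u 0)" "u 0" .
  have a: "K \<subseteq> R.M" using R.M_intros(1) by (rule subsetI)
  have b: "\<forall>x\<in>R.M. x \<noteq> 0 \<longrightarrow> (\<exists>k::int. vabs x = vabs (u 0) powi k)"
    by (intro ballI impI R.M_value_group)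
  show ?case unfolding Lf.simps by (intro conjI a b R.M_closed_subfield R.M_intros(2))
next
  case (Suc n)
  have IH: "closed_subfield (Lf n)" "K \<subseteq> Lf n" "u n \<in> Lf n"
    "\<And>x. x \<in> Lf n \<Longrightarrow> x \<noteq> 0 \<Longrightarrow> \<exists>k::int. vabs x = vabs (u n) powi k" using Suc by auto
  obtain P where "ramified_extension (Lf n) P q (vabs (u (Suc n))) (u (Suc n))"
    using step_extension[OF IH] by blast
  then interpret R: ramified_extension "Lf n" P q "vabs (u (Suc n))" "u (Suc n)" .
  have "Lf n \<subseteq> R.M" using R.M_intros(1) by (rule subsetI)
  then have a: "K \<subseteq> R.M" using Suc by auto
  have b: "\<forall>x\<in>R.M. x \<noteq> 0 \<longrightarrow> (\<exists>k::int. vabs x = vabs (u (Suc n)) powi k)"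
    by (intro ballI impI R.M_value_group)
  show ?case unfolding Lf.simps by (intro conjI a b R.M_closed_subfield R.M_intros(2))
qed

lemma Lf_closed_subfield: "closed_subfield (Lf n)" and K_subset_Lf: "K \<subseteq> Lf n" and u_in_Lf: "u n \<in> Lf n"
  and Lf_value_group: "x \<in> Lf n \<Longrightarrow> x \<noteq> 0 \<Longrightarrow> \<exists>k::int. vabs x = vabs (u n) powi k"
  using Lf_props[of n] by blast+

lemma Lf_extension:
  "\<exists>P. ramified_extension (Lf n) P q (vabs (u (Suc n))) (u (Suc n)) \<and>
    (\<forall>x. poly P x = 0 \<longleftrightarrow> vabs x < 1 \<and> E x = u n)"
  by (rule step_extension[OF Lf_closed_subfield K_subset_Lf u_in_Lf Lf_value_group])

lemma Lf_mono: "n \<le> m \<Longrightarrow> Lf n \<subseteq> Lf m"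
proof (rule lift_Suc_mono_le)
  show "Lf n \<subseteq> Lf (Suc n)" for n
  proof -
    obtain P where "ramified_extension (Lf n) P q (vabs (u (Suc n))) (u (Suc n))" using Lf_extension by blast
    then interpret R: ramified_extension "Lf n" P q "vabs (u (Suc n))" "u (Suc n)" .
    show ?thesis using R.M_intros(1) by auto
  qed
qed

section \<open>The kernel of [\<pi>] and the fields generated by torsion\<close>

abbreviation F0 :: "'a set" where "F0 \<equiv> torsion K F \<pi> 0"

lemma finite_F0: "finite F0" and card_F0: "card F0 = q"
proof -
  obtain P where P: "ramified_extension K P (q - 1) (vabs (u 0)) (u 0)" "\<forall>x. poly P x = 0 \<longleftrightarrow> x \<in> F0 - {0}"
    using base_extension by blast
  interpret R: ramified_extension K P "q - 1" "vabs (u 0)" "u 0" by (rule P)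
  have eq: "{w. poly P w = 0} = F0 - {0}" using P(2) by auto
  have "finite (F0 - {0})" using poly_roots_finite[OF R.P_nonzero] eq by simp
  then show "finite F0" by simp
  then show "card F0 = q"
    using R.card_roots q_ge_2 card_Suc_Diff1[OF _ zero_torsion] unfolding eq by simp
qed

text \<open>Translates by kernel points are distinct and stay in the fibre. The kernel has q points
  and the fibre has at most q, so they fill it.\<close>

lemma fibre_eq:
  assumes v: "vabs v < 1"
  shows "bij_betw (fadd v) F0 {x. vabs x < 1 \<and> E x = E v}"
proof -
  have inj: "inj_on (fadd v) F0"
  proof (rule inj_onI)
    fix z z' assume "z \<in> F0" "z' \<in> F0" "fadd v z = fadd v z'"
    then have "vabs (z - z') = 0" using vabs_fadd_diff[OF v, of z z'] by (simp add: F0_iff)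
    then show "z = z'" by simp
  qed
  have sub: "fadd v ` F0 \<subseteq> {x. vabs x < 1 \<and> E x = E v}"
    using v by (auto simp: F0_iff E_fadd vabs_fadd_less fadd_0_right)
  have "fadd v ` F0 = {x. vabs x < 1 \<and> E x = E v}"
    using sub fibre_card_le[OF vabs_E_less[OF v]] card_image[OF inj] card_F0
    by (intro card_subset_eq) (auto intro: antisym card_mono)
  then show ?thesis using inj by (simp add: bij_betw_def)
qed

text \<open>A count: representatives of the q residue classes, taken as linear coefficients, give
  commuting series h whose values at u_0 lie in the kernel and are distinct, hence exhaust
  it.\<close>

lemma F0_series:
  assumes z: "z \<in> F0"
  obtains h where "h \<in> int_fps K" "fps_nth h 0 = 0" "fps_compose e h = fps_compose h e" "fps_value h (u 0) = z"
proof -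
  let ?good = "\<lambda>a h. h \<in> int_fps K \<and> fps_nth h 0 = 0 \<and> fps_nth h 1 = a \<and> fps_compose e h = fps_compose h e"
  have "\<forall>c\<in>carrier kres. \<exists>a. a \<in> ring_of_integers K \<and> res a = c" by (auto simp: carrier_kres)
  then obtain a where a: "\<And>c. c \<in> carrier kres \<Longrightarrow> a c \<in> ring_of_integers K \<and> res (a c) = c" by metis
  have "\<forall>c\<in>carrier kres. \<exists>h. ?good (a c) h"
  proof
    fix c assume "c \<in> carrier kres"
    then have "a c \<in> K" "vabs (a c) \<le> 1" using a by (auto simp: ring_of_integers_def)
    then show "\<exists>h. ?good (a c) h" by (rule commuting_series_exists) blast
  qed
  then obtain h where h: "\<And>c. c \<in> carrier kres \<Longrightarrow> ?good (a c) (h c)" by metis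
  let ?v = "\<lambda>c. fps_value (h c) (u 0)"
  have in_F0: "?v c \<in> F0" if c: "c \<in> carrier kres" for c
  proof -
    have hc: "fbd 1 (h c)" "fdisc (h c)" using h[OF c] by (auto simp: int_fps_iff fdisc_def)
    have "E (?v c) = fps_value (fps_subst e (h c)) (u 0)"
      by (rule fps_value_subst[OF e_fbd hc(2) vabs_u_less_1, symmetric])
    also have "fps_subst e (h c) = fps_subst (h c) e"
      using h[OF c] by (simp add: fps_subst_eq_compose e_0)
    also have "fps_value \<dots> (u 0) = fps_value (h c) (E (u 0))"
      by (rule fps_value_subst[OF hc(1) fdisc_e vabs_u_less_1])
    finally have "E (?v c) = 0" using h[OF c] by (simp add: E_u_0)
    then show ?thesis using fps_value_fdisc[OF hc(2) vabs_u_less_1] by (simp add: F0_iff)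
  qed
  have inj: "inj_on ?v (carrier kres)"
  proof (rule inj_onI, rule ccontr)
    fix c c' assume c: "c \<in> carrier kres" "c' \<in> carrier kres" "?v c = ?v c'" "c \<noteq> c'"
    have aK: "a c \<in> K" "vabs (a c) \<le> 1" "a c' \<in> K" "vabs (a c') \<le> 1"
      using a[OF c(1)] a[OF c(2)] by (auto simp: ring_of_integers_def)
    have "res (a c) \<noteq> res (a c')" using a c by metis
    then have "\<not> vabs (a c - a c') < 1" using res_eq_iff[OF aK] by simp
    then have d: "1 \<le> vabs (a c - a c')" by simp
    have b: "fbd 1 (h c)" "fbd 1 (h c')" using h c by (auto simp: int_fps_iff)
    \<comment> \<open>If the values coincide, dividing by x and evaluating at u_0 makes a(c) - a(c')
      divisible by u_0, although it is a unit.\<close>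
    let ?D = "h c - h c'"
    let ?S = "fps_shift 1 ?D"
    have D: "?D = fps_X * ?S" using h[OF c(1)] h[OF c(2)] by (auto simp: fps_eq_iff)
    have S: "fbd 1 ?S" using fbd_diff[OF b] by (simp add: fbd_def)
    have "fps_value ?D (u 0) = u 0 * fps_value ?S (u 0)"
      using fps_value_mult[OF fbd_X S vabs_u_less_1, of 0] D by simp
    moreover have "fps_value ?D (u 0) = 0" using fps_value_diff[OF b vabs_u_less_1] c(3) by simp
    ultimately have "fps_value ?S (u 0) = 0" using u_0(2) by simp
    moreover have "fps_nth ?S 0 = a c - a c'" using h[OF c(1)] h[OF c(2)] by simp
    ultimately have "vabs (a c - a c') \<le> vabs (u 0)"
      using vabs_fps_value_minus_nth_0[OF S vabs_u_less_1, of 0] by (simp add: vabs_minus_commute)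
    then show False using d vabs_u_less_1[of 0] by simp
  qed
  have "?v ` carrier kres = F0"
    using in_F0 card_image[OF inj] card_kres card_F0 finite_F0 by (intro card_subset_eq) auto
  then have "z \<in> ?v ` carrier kres" using z by (simp only:)
  then obtain c where c: "z = ?v c" "c \<in> carrier kres" by (rule imageE)
  show ?thesis by (rule that[of "h c"]) (use h[OF c(2)] c(1) in simp_all)
qed

text \<open>A series h commuting with [\<pi>] transports the system u_n: the m-th iterate of [\<pi>]
  sends h(u_m) to h(u_0), and h(u_m) lies in the m-th field because h has coefficients in K.\<close>

lemma F0_preimage:
  assumes z: "z \<in> F0"
  shows "\<exists>w\<in>Lf m. vabs w < 1 \<and> (E ^^ m) w = z"
proof -
  obtain h where h: "h \<in> int_fps K" "fps_nth h 0 = 0" "fps_compose e h = fps_compose h e" "fps_value h (u 0) = z"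
    using F0_series[OF z] by metis
  have hb: "h \<in> fps_over K" "fbd 1 h" "fdisc h" using h(1,2) by (auto simp: int_fps_iff fdisc_def)
  have comm: "E (fps_value h x) = fps_value h (E x)" if x: "vabs x < 1" for x
    using fps_value_subst[OF e_fbd hb(3) x] fps_value_subst[OF hb(2) fdisc_e x] h(2,3)
    by (simp add: fps_subst_eq_compose e_0)
  have "(E ^^ k) (fps_value h x) = fps_value h ((E ^^ k) x)" if x: "vabs x < 1" for x k
    by (induction k) (simp_all add: comm vabs_E_iter_less[OF x])
  then have "(E ^^ m) (fps_value h (u m)) = z" using E_iter_u[of m 0] h(4) vabs_u_less_1 by simp
  moreover have "fps_value h (u m) \<in> Lf m"
    using hb(1) K_subset_Lf
    by (intro closed_subfield.fps_value_in[OF Lf_closed_subfield hb(2) vabs_u_less_1] u_in_Lf) (auto simp: fps_over_def)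
  ultimately show ?thesis using fps_value_fdisc[OF hb(3) vabs_u_less_1] by blast
qed

lemma trans_over:
  assumes "closed_subfield L" "K \<subseteq> L" "z \<in> L" "vabs z < 1"
  shows "trans z \<in> fps_over L"
proof -
  have "fps_nth (fps_nth F i) j \<in> L" for i j
    using lubin_tate_fgl assms(2) by (auto simp: lubin_tate_fgl_def formal_group_law_def ring_of_integers_def)
  then have "fps_nth (trans z) i \<in> L" for i
    unfolding trans_nth
    by (intro closed_subfield.fps_value_in[OF assms(1) fbd_F_nth]) (use assms in \<open>auto simp: fps_over_def\<close>)
  then show ?thesis by (simp add: fps_over_def)
qed

lemma fadd_in_Lf:
  assumes "x \<in> Lf n" "z \<in> Lf n" "vabs x < 1" "vabs z < 1"
  shows "fadd x z \<in> Lf n"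
  by (rule closed_subfield.fps_value_in[OF Lf_closed_subfield fdisc_fbd[OF fdisc_trans[OF assms(4)]] assms(3)
      trans_over[OF Lf_closed_subfield K_subset_Lf assms(2,4)] assms(1)])

text \<open>The case m = 0 is the goal; general m carries the induction. The hypothesis for
  \<open>E v\<close> with m + 1 gives w whose m-fold image x lies in the fibre of v, so v is x
  translated by a kernel point z, and m-fold preimages of x and z add up to one of v.\<close>

lemma torsion_preimage:
  "v \<in> torsion K F \<pi> n \<Longrightarrow> \<exists>w\<in>Lf (n + m). vabs w < 1 \<and> (E ^^ m) w = v"
proof (induction n arbitrary: v m)
  case 0
  then show ?case using F0_preimage by simp
next
  case (Suc n)
  have v: "vabs v < 1" "(E ^^ Suc (Suc n)) v = 0" using Suc.prems by (auto simp: torsion_iff simp del: funpow.simps)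
  have "(E ^^ Suc n) (E v) = 0" using v(2) by (simp only: funpow_Suc_right o_apply)
  then have "E v \<in> torsion K F \<pi> n" using vabs_E_less[OF v(1)] by (simp add: torsion_iff del: funpow.simps)
  then obtain w where w: "w \<in> Lf (Suc (n + m))" "vabs w < 1" "(E ^^ Suc m) w = E v"
    using Suc.IH[of "E v" "Suc m"] by auto
  let ?x = "(E ^^ m) w"
  have x: "vabs ?x < 1" "E ?x = E v" using w by (auto simp: vabs_E_iter_less)
  then have "v \<in> {y. vabs y < 1 \<and> E y = E ?x}" using v(1) by simp
  then obtain z where z: "z \<in> F0" "v = fadd ?x z"
    using fibre_eq[OF x(1)] unfolding bij_betw_def by blast
  obtain w' where w': "w' \<in> Lf m" "vabs w' < 1" "(E ^^ m) w' = z" using F0_preimage[OF z(1)] by blast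
  have "w' \<in> Lf (Suc (n + m))" using w'(1) Lf_mono[of m "Suc (n + m)"] by auto
  then have "fadd w w' \<in> Lf (Suc n + m)" using w w' by (simp only: add_Suc) (intro fadd_in_Lf)
  moreover have "(E ^^ m) (fadd w w') = v" using E_iter_fadd[OF w(2) w'(2)] w'(3) z(2) by simp
  ultimately show ?case using vabs_fadd_less[OF w(2) w'(2)] by blast
qed

lemma torsion_subset_Lf: "torsion K F \<pi> n \<subseteq> Lf n"
  using torsion_preimage[of _ n 0] by auto

lemma torsion_mono: "n \<le> m \<Longrightarrow> torsion K F \<pi> n \<subseteq> torsion K F \<pi> m"
proof (rule lift_Suc_mono_le)
  show "torsion K F \<pi> n \<subseteq> torsion K F \<pi> (Suc n)" for n by (auto simp: torsion_iff e_0)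
qed

lemma torsion_field_eq: "torsion_field K F \<pi> n = Lf n"
proof
  interpret R: field "ring_of_type_algebra :: 'a ring" by (rule field_from_type_algebra)
  let ?G = "generate_field ring_of_type_algebra (K \<union> torsion K F \<pi> n)"
  have "?G \<subseteq> Lf n"
    using closed_subfield.subfield[OF Lf_closed_subfield] K_subset_Lf torsion_subset_Lf
    by (intro R.generate_field_min_subfield1) auto
  then show "torsion_field K F \<pi> n \<subseteq> Lf n" by (simp add: torsion_field_def)
  have G_add: "x + y \<in> ?G" and G_mult: "x * y \<in> ?G" if "x \<in> ?G" "y \<in> ?G" for x y
    using generate_field.eng_add[OF that] generate_field.eng_mult[OF that] by simp_all
  have G0: "0 \<in> ?G" using R.zero_in_generate[of "K \<union> torsion K F \<pi> n"] by simp
  have adj: "adjoin L v \<subseteq> ?G" if L: "L \<subseteq> ?G" and v: "v \<in> ?G" for L v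
  proof -
    have "poly A v \<in> ?G" if "\<forall>i. coeff A i \<in> L" for A
      using that
    proof (induction A)
      case (pCons a A)
      have "a \<in> L" using pCons.prems by (auto dest!: spec[of _ 0])
      moreover have "coeff A i \<in> L" for i using pCons.prems by (auto dest!: spec[of _ "Suc i"])
      ultimately show ?case using L v pCons.IH by (auto intro!: G_add G_mult)
    qed (use G0 in simp)
    then show ?thesis by (auto simp: adjoin_def polys_over_def)
  qed
  have "Lf k \<subseteq> ?G" if "k \<le> n" for k
    using that
  proof (induction k)
    case 0
    have "u 0 \<in> ?G" using u_torsion[of 0] torsion_mono[of 0 n] by (intro generate_field.incl) auto
    moreover have "K \<subseteq> ?G" by (auto intro: generate_field.incl)
    ultimately show ?case by (simp add: adj)
  next
    case (Suc k)
    have "u (Suc k) \<in> ?G" using u_torsion[of "Suc k"] torsion_mono[OF Suc.prems] by (intro generate_field.incl) auto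
    then show ?case using Suc by (simp add: adj)
  qed
  then show "Lf n \<subseteq> torsion_field K F \<pi> n" by (simp add: torsion_field_def)
qed

text \<open>The conjugates of \<open>u (n + 1)\<close> over the field below are its translates by the kernel of
  the Lubin-Tate endomorphism.\<close>

lemma norm_value:
  assumes h: "h \<in> int_fps K"
  shows "field_norm (torsion_field K F \<pi> n) (torsion_field K F \<pi> (Suc n)) (fps_value h (u (Suc n))) =
    fps_value (\<Prod>z\<in>F0. fps_subst h (trans z)) (u (Suc n))"
proof -
  obtain P where P: "ramified_extension (Lf n) P q (vabs (u (Suc n))) (u (Suc n))"
    "\<forall>x. poly P x = 0 \<longleftrightarrow> vabs x < 1 \<and> E x = u n" using Lf_extension by blast
  interpret R: ramified_extension "Lf n" P q "vabs (u (Suc n))" "u (Suc n)" by (rule P)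
  have hb: "fbd 1 h" using h by (simp add: int_fps_iff)
  have hL: "h \<in> int_fps (Lf n)" using h K_subset_Lf[of n] by (auto simp: int_fps_iff fps_over_def)
  have disc: "fdisc (trans z)" if "z \<in> F0" for z using that by (simp add: F0_iff fdisc_trans)
  have "field_norm (torsion_field K F \<pi> n) (torsion_field K F \<pi> (Suc n)) (fps_value h (u (Suc n))) =
      (\<Prod>w | poly P w = 0. fps_value h w)"
    using R.field_norm_fps_value[OF hL] by (simp add: torsion_field_eq)
  also have "{w. poly P w = 0} = {x. vabs x < 1 \<and> E x = E (u (Suc n))}" using P(2) u_Suc(2) by simp
  also have "(\<Prod>w\<in>\<dots>. fps_value h w) = (\<Prod>z\<in>F0. fps_value h (fadd (u (Suc n)) z))"
    by (rule prod.reindex_bij_betw[OF fibre_eq[OF vabs_u_less_1], symmetric])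
  also have "\<dots> = (\<Prod>z\<in>F0. fps_value (fps_subst h (trans z)) (u (Suc n)))"
    by (intro prod.cong refl fps_value_subst[OF hb disc vabs_u_less_1, symmetric])
  also have "\<dots> = fps_value (\<Prod>z\<in>F0. fps_subst h (trans z)) (u (Suc n))"
    by (intro fps_value_prod[symmetric] fps_subst_fbd[OF hb disc] vabs_u_less_1)
  finally show ?thesis .
qed

end

section \<open>Series interpolating norm compatible sequences\<close>

lemma vabs_power_minus_1_le:
  fixes y :: "'a::nonarch_field"
  assumes "vabs y \<le> 1"
  shows "vabs ((1 + y) ^ n - 1) \<le> vabs y"
proof -
  have "vabs (1 + y) \<le> 1" using assms by (intro vabs_add_le) auto
  then have "vabs (\<Sum>i<n. (1 + y) ^ i) \<le> 1" by (intro vabs_sum_le) (auto simp: vabs_power power_le_one)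
  then show ?thesis using power_diff_1_eq[of "1 + y" n] by (simp add: vabs_mult mult_left_le)
qed

context lubin_tate_tower
begin

abbreviation A :: "'a fps set" where
  "A \<equiv> interpolating_series K F \<pi> u"

lemma F0_disc: "z \<in> F0 \<Longrightarrow> fdisc (trans z)"
  by (simp add: F0_iff fdisc_trans)

lemma vabs_u_power: "vabs (u n) ^ (q ^ n) = vabs (u 0)"
proof (induction n)
  case (Suc n)
  then show ?case using vabs_u_Suc[of n] by (simp add: power_mult)
qed simp

text \<open>The value group of the coefficients is discrete while the absolute values of the \<open>u n\<close> tend
  to 1, so for large \<open>n\<close> the first coefficient of maximal absolute value dominates at \<open>u n\<close>.\<close>

lemma vanishing_on_u:
  assumes D: "D \<in> fps_over (Lf 0)" "fbd 1 D" and zero: "\<And>n. fps_value D (u (Suc n)) = 0"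
  shows "D = 0"
proof (rule ccontr)
  assume "D \<noteq> 0"
  then obtain i0 where i0: "fps_nth D i0 \<noteq> 0" by (auto simp: fps_eq_iff)
  let ?r = "vabs (u 0)"
  have r: "0 < ?r" "?r < 1" using u_nonzero vabs_u_less_1 by auto
  have val: "\<exists>k::nat. vabs (fps_nth D i) = ?r ^ k" if i: "fps_nth D i \<noteq> 0" for i
  proof -
    obtain k :: int where k: "vabs (fps_nth D i) = ?r powi k"
      using Lf_value_group[of "fps_nth D i" 0] D(1) i by (auto simp: fps_over_def)
    have "0 \<le> k"
    proof (rule ccontr)
      assume "\<not> 0 \<le> k"
      then have "?r powi 0 < ?r powi k" using r by (intro power_int_strict_decreasing) auto
      then show False using k fbdD[OF D(2), of i] by simp
    qed
    then show ?thesis using k by (intro exI[of _ "nat k"]) (simp add: power_int_def)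
  qed
  \<comment> \<open>By discreteness the coefficients attain a maximal absolute value |u_0|^k0; m
    will be the first index where this happens.\<close>
  define k0 where "k0 = (LEAST k. \<exists>i. fps_nth D i \<noteq> 0 \<and> vabs (fps_nth D i) = ?r ^ k)"
  have "\<exists>k i. fps_nth D i \<noteq> 0 \<and> vabs (fps_nth D i) = ?r ^ k" using val[OF i0] i0 by blast
  then have ex: "\<exists>i. fps_nth D i \<noteq> 0 \<and> vabs (fps_nth D i) = ?r ^ k0"
    unfolding k0_def by (rule LeastI_ex)
  define m where "m = (LEAST i. fps_nth D i \<noteq> 0 \<and> vabs (fps_nth D i) = ?r ^ k0)"
  have m: "fps_nth D m \<noteq> 0" "vabs (fps_nth D m) = ?r ^ k0" using LeastI_ex[OF ex] unfolding m_def by auto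
  have le: "vabs (fps_nth D i) \<le> ?r ^ k0" for i
  proof (cases "fps_nth D i = 0")
    case True
    then show ?thesis using r by simp
  next
    case False
    then obtain k where k: "vabs (fps_nth D i) = ?r ^ k" using val by blast
    then have "k0 \<le> k" unfolding k0_def using False by (intro Least_le) blast
    then show ?thesis unfolding k using r by (intro power_decreasing) auto
  qed
  have less: "vabs (fps_nth D i) \<le> ?r ^ Suc k0" if i: "i < m" for i
  proof (cases "fps_nth D i = 0")
    case True
    then show ?thesis using r by simp
  next
    case False
    then obtain k where k: "vabs (fps_nth D i) = ?r ^ k" using val by blast
    have "k0 \<le> k" unfolding k0_def using False k by (intro Least_le) blast
    moreover have "k \<noteq> k0" using not_less_Least[OF i[unfolded m_def]] False k by auto
    ultimately show ?thesis unfolding k using r by (intro power_decreasing) auto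
  qed
  \<comment> \<open>Coefficients before index m are smaller by at least the factor r = |u_0|. From
    |u_(m+1)|^(q^(m+1)) = r and m < q^(m+1) follows r < |w|^m, so even then the term of index m
    dominates at w.\<close>
  define w where "w = u (Suc m)"
  let ?R = "vabs w"
  have R: "0 < ?R" "?R < 1" using u_nonzero vabs_u_less_1 by (auto simp: w_def)
  have "m < q ^ Suc m"
  proof -
    have "m < 2 ^ m" by (rule less_exp)
    also have "(2::nat) ^ m \<le> q ^ m" using q_ge_2 by (rule power_mono) simp
    also have "q ^ m \<le> q ^ Suc m" using q_ge_2 by (intro power_increasing) auto
    finally show ?thesis .
  qed
  then have "?R ^ (q ^ Suc m) < ?R ^ m" using R by (intro power_strict_decreasing) auto
  then have rR: "?r < ?R ^ m" unfolding w_def vabs_u_power .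
  define B where "B = max (?r ^ Suc k0) (?r ^ k0 * ?R ^ Suc m)"
  have B: "B < vabs (fps_nth D m * w ^ m)"
  proof -
    have "?r ^ Suc k0 < ?r ^ k0 * ?R ^ m" using rR r by simp
    moreover have "?r ^ k0 * ?R ^ Suc m < ?r ^ k0 * ?R ^ m" using r R by simp
    ultimately show ?thesis by (simp add: B_def m(2) vabs_mult vabs_power)
  qed
  have s: "(\<lambda>i. fps_nth D i * w ^ i - (if i = m then fps_nth D m * w ^ m else 0)) sums
      (fps_value D w - fps_nth D m * w ^ m)"
    using R by (intro nonarch_sums_diff fps_value_sums[OF D(2)] sums_single)
  have "vabs (fps_nth D i * w ^ i - (if i = m then fps_nth D m * w ^ m else 0)) \<le> B" for i
  proof (cases i m rule: linorder_cases)
    case less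
    have "vabs (fps_nth D i * w ^ i) \<le> ?r ^ Suc k0 * 1"
      using \<open>\<And>i. i < m \<Longrightarrow> _\<close>[OF less] R by (intro vabs_mult_le) (auto simp: vabs_power power_le_one)
    then show ?thesis using less by (simp add: B_def)
  next
    case equal
    then show ?thesis using r by (simp add: B_def max_def)
  next
    case greater
    have "?R ^ i \<le> ?R ^ Suc m" using R greater by (intro power_decreasing) auto
    then have "vabs (fps_nth D i * w ^ i) \<le> ?r ^ k0 * ?R ^ Suc m"
      using le[of i] by (intro vabs_mult_le) (auto simp: vabs_power)
    then show ?thesis using greater by (simp add: B_def)
  qed
  then have "vabs (fps_value D w - fps_nth D m * w ^ m) \<le> B"
    unfolding sums_unique[OF s] using r
    by (intro vabs_suminf_le sums_summable[OF s]) (auto simp: B_def max_def)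
  then have "vabs (fps_value D w) = vabs (fps_nth D m * w ^ m)"
    using B by (intro vabs_eq_of_diff_less) simp
  then show False using zero[of m] m(1) R by (simp add: w_def vabs_mult)
qed

text \<open>For Coleman's norm operator N this is N(g)([\<pi>](x)); working with the composite
  avoids undoing the substitution of [\<pi>].\<close>

definition translate_prod :: "'a fps \<Rightarrow> 'a fps" where
  "translate_prod g = (\<Prod>z\<in>F0. fps_subst g (trans z))"

lemma fbd_translate_prod: "fbd 1 g \<Longrightarrow> fbd 1 (translate_prod g)"
  unfolding translate_prod_def by (intro fbd_prod fps_subst_fbd F0_disc)

lemma translate_prod_mult: "fbd 1 g \<Longrightarrow> fbd 1 h \<Longrightarrow> translate_prod (g * h) = translate_prod g * translate_prod h"
  unfolding translate_prod_def prod.distrib[symmetric]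
  by (intro prod.cong refl fps_subst_mult[where B = 1 and C = 1] F0_disc)

lemma translate_prod_1 [simp]: "translate_prod 1 = 1"
  by (simp add: translate_prod_def)

lemma fconv_translate_prod:
  assumes "\<And>j. fbd 1 (G j)" "fconv G g"
  shows "fconv (\<lambda>j. translate_prod (G j)) (translate_prod g)"
  unfolding translate_prod_def using F0_disc by (intro fconv_prod fconv_subst[OF assms])

text \<open>Trades infinitely many norm conditions for one identity. Both sides of it agree at every
  u_(n+1) and have coefficients in K_0, which contains the kernel of [\<pi>], so
  \<open>vanishing_on_u\<close> applies. Conversely, evaluation at u_(n+1) returns the
  norms.\<close>

lemma interpolating_iff:
  "f \<in> A \<longleftrightarrow> f \<in> int_fps K \<and> fdisc f \<and> translate_prod (1 + f) = fps_compose (1 + f) e"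
proof
  assume f: "f \<in> A"
  then obtain a where fK: "f \<in> int_fps K" and a: "\<And>n. a n \<in> principal_units (torsion_field K F \<pi> n)"
    "\<And>n. 1 + fps_value f (u n) = a n"
    "\<And>n. field_norm (torsion_field K F \<pi> n) (torsion_field K F \<pi> (Suc n)) (a (Suc n)) = a n"
    by (auto simp: interpolating_series_def)
  have f1: "fbd 1 f" "f \<in> fps_over K" using fK by (auto simp: int_fps_iff)
  have g: "1 + f \<in> int_fps K" using fK by (intro K.int_fps_intros)
  then have g1: "fbd 1 (1 + f)" "1 + f \<in> fps_over K" by (auto simp: int_fps_iff)
  have val: "fps_value (1 + f) (u n) = 1 + fps_value f (u n)" for n
    using fps_value_add[OF _ f1(1) vabs_u_less_1, of 1 1] by simp
  \<comment> \<open>The principal unit a_0 = 1 + f(u_0) is congruent to 1 + f(0), which puts the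
    constant term of f in the open disc.\<close>
  have "vabs (fps_value f (u 0)) < 1" using a(1)[of 0] a(2)[of 0, symmetric] by (simp add: principal_units_def)
  moreover have "vabs (fps_value f (u 0) - fps_nth f 0) < 1"
    using vabs_fps_value_minus_nth_0[OF f1(1) vabs_u_less_1, of 0] vabs_u_less_1[of 0] by simp
  ultimately have "vabs (fps_value f (u 0) - (fps_value f (u 0) - fps_nth f 0)) < 1"
    by (rule vabs_diff_less)
  then have disc: "fdisc f" using f1 by (simp add: fdisc_def)
  let ?D = "translate_prod (1 + f) - fps_subst (1 + f) e"
  have eb: "fbd 1 (fps_subst (1 + f) e)" by (rule fps_subst_fbd[OF g1(1) fdisc_e])
  have "?D = 0"
  proof (rule vanishing_on_u)
    interpret L: closed_subfield "Lf 0" by (rule Lf_closed_subfield)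
    have gL: "1 + f \<in> fps_over (Lf 0)" "e \<in> fps_over (Lf 0)"
      using g1(2) e_over K_subset_Lf[of 0] unfolding fps_over_def by blast+
    have "trans z \<in> fps_over (Lf 0)" if "z \<in> F0" for z
      using that torsion_subset_Lf[of 0] by (intro trans_over Lf_closed_subfield K_subset_Lf) (auto simp: F0_iff)
    then show "?D \<in> fps_over (Lf 0)" unfolding translate_prod_def
      by (intro L.fps_over_intros L.fps_over_prod L.fps_over_subst[OF g1(1)] F0_disc gL fdisc_e)
    show "fbd 1 ?D" by (intro fbd_diff fbd_translate_prod g1 eb)
    fix n
    have "fps_value (translate_prod (1 + f)) (u (Suc n)) = a n"
      using norm_value[OF g, of n] a(3)[of n] val[of "Suc n"] a(2)[of "Suc n"] by (simp add: translate_prod_def)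
    moreover have "fps_value (fps_subst (1 + f) e) (u (Suc n)) = a n"
      using fps_value_subst[OF g1(1) fdisc_e vabs_u_less_1, of "Suc n"] val[of n] a(2)[of n] u_Suc(2)[of n] by simp
    ultimately show "fps_value ?D (u (Suc n)) = 0"
      using fps_value_diff[OF fbd_translate_prod[OF g1(1)] eb vabs_u_less_1, of "Suc n"] by simp
  qed
  then show "f \<in> int_fps K \<and> fdisc f \<and> translate_prod (1 + f) = fps_compose (1 + f) e"
    using fK disc by (simp add: fps_subst_eq_compose[OF e_0])
next
  assume f: "f \<in> int_fps K \<and> fdisc f \<and> translate_prod (1 + f) = fps_compose (1 + f) e"
  then have f1: "fbd 1 f" "f \<in> fps_over K" by (auto simp: int_fps_iff)
  have g: "1 + f \<in> int_fps K" using f by (intro K.int_fps_intros) auto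
  then have g1: "fbd 1 (1 + f)" by (auto simp: int_fps_iff)
  have val: "fps_value (1 + f) (u n) = 1 + fps_value f (u n)" for n
    using fps_value_add[OF _ f1(1) vabs_u_less_1, of 1 1] by simp
  define a where "a n = 1 + fps_value f (u n)" for n
  have "a n \<in> principal_units (torsion_field K F \<pi> n)" for n
  proof -
    have fL: "f \<in> fps_over (Lf n)" using f1(2) K_subset_Lf[of n] unfolding fps_over_def by blast
    have "a n \<in> Lf n" unfolding a_def
      by (intro closed_subfield.add[OF Lf_closed_subfield] closed_subfield.one[OF Lf_closed_subfield]
          closed_subfield.fps_value_in[OF Lf_closed_subfield f1(1) vabs_u_less_1 fL u_in_Lf])
    moreover have "vabs (fps_value f (u n)) < 1" using f vabs_u_less_1 by (intro fps_value_fdisc) auto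
    ultimately show ?thesis by (simp add: principal_units_def torsion_field_eq a_def)
  qed
  moreover have "field_norm (torsion_field K F \<pi> n) (torsion_field K F \<pi> (Suc n)) (a (Suc n)) = a n" for n
  proof -
    have "field_norm (torsion_field K F \<pi> n) (torsion_field K F \<pi> (Suc n)) (a (Suc n)) =
        fps_value (fps_subst (1 + f) e) (u (Suc n))"
      using norm_value[OF g, of n] f val[of "Suc n"] by (simp add: translate_prod_def a_def fps_subst_eq_compose[OF e_0])
    also have "\<dots> = a n"
      using fps_value_subst[OF g1 fdisc_e vabs_u_less_1, of "Suc n"] val[of n] u_Suc(2)[of n] by (simp add: a_def)
    finally show ?thesis .
  qed
  ultimately show "f \<in> A" unfolding interpolating_series_def
    using f by (intro CollectI conjI exI[of _ a]) (auto simp: a_def)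
qed

lemma interpolatingD:
  assumes "f \<in> A"
  shows "f \<in> int_fps K" "f \<in> fps_over K" "fbd 1 f" "fdisc f" "translate_prod (1 + f) = fps_compose (1 + f) e"
    "1 + f \<in> int_fps K" "fbd 1 (1 + f)" "vabs (1 + fps_nth f 0) = 1"
proof -
  show *: "f \<in> int_fps K" "fdisc f" "translate_prod (1 + f) = fps_compose (1 + f) e"
    using assms by (auto simp: interpolating_iff)
  then show "f \<in> fps_over K" "fbd 1 f" by (auto simp: int_fps_iff)
  show "1 + f \<in> int_fps K" using * by (intro K.int_fps_intros)
  then show "fbd 1 (1 + f)" by (simp add: int_fps_iff)
  show "vabs (1 + fps_nth f 0) = 1" using *(2) vabs_add_eq'[of "fps_nth f 0" 1] by (simp add: fdisc_def)
qed

section \<open>Closure of the interpolating series under the operations of G_m\<close>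

lemma one_plus_gm_add: "1 + gm_add f g = (1 + f) * (1 + g)"
  by (simp add: gm_add_def algebra_simps)

lemma zero_interpolating: "0 \<in> A"
  by (simp add: interpolating_iff K.int_fps_intros fdisc_def)

lemma gm_add_interpolating:
  assumes f: "f \<in> A" and g: "g \<in> A"
  shows "gm_add f g \<in> A"
  unfolding interpolating_iff
proof (intro conjI)
  note f' = interpolatingD[OF f] and g' = interpolatingD[OF g]
  show int: "gm_add f g \<in> int_fps K" unfolding gm_add_def by (intro K.int_fps_intros f' g')
  have "vabs (fps_nth f 0 * fps_nth g 0) < 1"
    using f'(4) g'(4) by (simp add: fdisc_def vabs_mult) (metis mult_less_cancel_right2 mult_strict_mono vabs_nonneg mult.right_neutral zero_less_one)
  then show "fdisc (gm_add f g)" using int f'(4) g'(4) unfolding fdisc_def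
    by (auto simp: gm_add_def int_fps_iff intro!: vabs_add_less)
  show "translate_prod (1 + gm_add f g) = fps_compose (1 + gm_add f g) e"
    unfolding one_plus_gm_add translate_prod_mult[OF f'(7) g'(7)] f'(5) g'(5)
    by (rule fps_compose_mult_distrib[OF e_0, symmetric])
qed

lemma gm_inverse_interpolating:
  assumes f: "f \<in> A"
  shows "inverse (1 + f) - 1 \<in> A" "gm_add (inverse (1 + f) - 1) f = 0"
proof -
  note f' = interpolatingD[OF f]
  have c: "fps_nth (1 + f) 0 \<noteq> 0" using f'(8) by auto
  have inv: "inverse (1 + f) * (1 + f) = 1" by (rule inverse_mult_eq_1[OF c])
  have ib: "fbd 1 (inverse (1 + f))" using f' by (intro fbd_inverse) auto
  have io: "inverse (1 + f) \<in> fps_over K" using f'(6) by (intro K.fps_over_inverse) (simp add: int_fps_iff)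
  show "gm_add (inverse (1 + f) - 1) f = 0"
    using one_plus_gm_add[of "inverse (1 + f) - 1" f] inv by simp
  have "fps_nth (inverse (1 + f) - 1) 0 = - fps_nth f 0 * inverse (1 + fps_nth f 0)"
    using c by (simp add: fps_inverse_nth_0 field_simps)
  then have small: "vabs (fps_nth (inverse (1 + f) - 1) 0) < 1"
    using f'(4,8) by (simp add: vabs_mult vabs_inverse fdisc_def)
  have int: "inverse (1 + f) - 1 \<in> int_fps K"
    using ib io K.int_fps_intros(4)[OF _ K.int_fps_intros(2)] by (simp add: int_fps_iff)
  have "translate_prod (inverse (1 + f)) * translate_prod (1 + f) = fps_compose (inverse (1 + f)) e * fps_compose (1 + f) e"
    unfolding translate_prod_mult[OF ib f'(7), symmetric] fps_compose_mult_distrib[OF e_0, symmetric] inv by simp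
  moreover have "fps_compose (1 + f) e \<noteq> 0"
  proof
    assume "fps_compose (1 + f) e = 0"
    then have "fps_nth (fps_compose (1 + f) e) 0 = 0" by simp
    then show False using c by simp
  qed
  ultimately have "translate_prod (inverse (1 + f)) = fps_compose (inverse (1 + f)) e" using f'(5) by simp
  then show "inverse (1 + f) - 1 \<in> A"
    using int small by (simp add: interpolating_iff fdisc_def int_fps_iff)
qed

lemma power_interpolating: "f \<in> A \<Longrightarrow> (1 + f) ^ n - 1 \<in> A"
proof (induction n)
  case (Suc n)
  have "gm_add f ((1 + f) ^ n - 1) = (1 + f) ^ Suc n - 1" by (simp add: gm_add_def algebra_simps)
  then show ?case using gm_add_interpolating[OF Suc.prems Suc.IH[OF Suc.prems]] by simp
qed (simp add: zero_interpolating)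

text \<open>The functional equation holds for powers of 1 + f, and both of its sides are continuous
  for coefficientwise limits.\<close>

lemma gm_smult_interpolating:
  assumes f: "f \<in> A" and a: "a \<in> (Qp :: 'a set)" "vabs a \<le> 1"
  shows "gm_smult a f \<in> A"
proof -
  note f' = interpolatingD[OF f]
  obtain s where s: "(\<lambda>j. of_nat (s j)) \<longlonglongrightarrow> a" using Zp_limit[OF a] .
  have lim: "fconv (\<lambda>j. (1 + f) ^ s j - 1) (gm_smult a f)" by (rule fconv_gm_smult[OF a f'(4) s])
  note G = interpolatingD[OF power_interpolating[OF f]]
  have lim1: "fconv (\<lambda>j. 1 + ((1 + f) ^ s j - 1)) (1 + gm_smult a f)" by (intro fconv_add lim fconv_const)
  have int: "gm_smult a f \<in> int_fps K"
    unfolding int_fps_iff using K.fps_over_limit[OF lim G(2)] fconv_fbd[OF lim G(3)] by simp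
  have "(\<lambda>j. fps_nth ((1 + f) ^ s j - 1) 0) \<longlonglongrightarrow> fps_nth (gm_smult a f) 0"
    by (rule spec[OF lim[unfolded fconv_def]])
  moreover have "vabs (fps_nth ((1 + f) ^ s j - 1) 0) \<le> vabs (fps_nth f 0)" for j
    using f'(4) by (simp add: fps_power_zeroth vabs_power_minus_1_le fdisc_def)
  ultimately have "vabs (fps_nth (gm_smult a f) 0) \<le> vabs (fps_nth f 0)" by (rule vabs_limit_le)
  then have disc: "fdisc (gm_smult a f)" using int f'(4) by (simp add: fdisc_def int_fps_iff)
  have "fconv (\<lambda>j. translate_prod (1 + ((1 + f) ^ s j - 1))) (translate_prod (1 + gm_smult a f))" by (rule fconv_translate_prod[OF G(7) lim1])
  moreover have "fconv (\<lambda>j. translate_prod (1 + ((1 + f) ^ s j - 1))) (fps_compose (1 + gm_smult a f) e)"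
    unfolding G(5) by (intro fconv_compose lim1)
  ultimately have "translate_prod (1 + gm_smult a f) = fps_compose (1 + gm_smult a f) e" by (rule fconv_unique)
  then show ?thesis using int disc by (simp add: interpolating_iff)
qed

subsection \<open>The two modules\<close>

lemma Zp_cring: "cring (Zp :: 'a ring)"
  by (rule closed_subfield.ring_of_integers_cring[OF closed_subfield_Qp])

lemma Zp_arith:
  assumes "a \<in> (Qp :: 'a set)" "vabs a \<le> 1" "b \<in> (Qp :: 'a set)" "vabs b \<le> 1"
  shows "a + b \<in> Qp" "vabs (a + b) \<le> 1" "a * b \<in> Qp" "vabs (a * b) \<le> 1"
  using assms by (auto intro: closed_subfield.add[OF closed_subfield_Qp] closed_subfield.mult[OF closed_subfield_Qp]
      vabs_add_le vabs_mult_le_1)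

text \<open>The case of a natural factor, from which the module law for a product of scalars is
  obtained by a limit.\<close>

lemma one_plus_gm_smult_power:
  assumes f: "f \<in> A" and a: "a \<in> (Qp :: 'a set)" "vabs a \<le> 1"
  shows "1 + gm_smult (a * of_nat n) f = (1 + gm_smult a f) ^ n"
proof -
  note f' = interpolatingD[OF f]
  obtain s where s: "(\<lambda>j. of_nat (s j)) \<longlonglongrightarrow> a" using Zp_limit[OF a] .
  have "(\<lambda>j. of_nat (s j) * of_nat n) \<longlonglongrightarrow> a * of_nat n" by (intro tendsto_mult_right s)
  then have sn: "(\<lambda>j. of_nat (s j * n)) \<longlonglongrightarrow> a * of_nat n" by simp
  have an: "a * of_nat n \<in> (Qp :: 'a set)" "vabs (a * of_nat n) \<le> 1"
    using Zp_arith[OF a of_nat_in_Qp, of n] by auto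
  have "fconv (\<lambda>j. 1 + ((1 + f) ^ (s j * n) - 1)) (1 + gm_smult (a * of_nat n) f)"
    by (intro fconv_add fconv_const fconv_gm_smult[OF an f'(4) sn])
  moreover have "fconv (\<lambda>j. (1 + ((1 + f) ^ s j - 1)) ^ n) ((1 + gm_smult a f) ^ n)"
    by (intro fconv_power fconv_add fconv_const fconv_gm_smult[OF a f'(4) s])
  ultimately show ?thesis by (simp add: power_mult fconv_unique)
qed

lemma A_module: "module Zp (A_module K F \<pi> u)"
proof (rule module.intro)
  show "cring (Zp :: 'a ring)" by (rule Zp_cring)
  show "abelian_group (A_module K F \<pi> u)"
  proof (rule abelian_groupI, unfold A_module_def, simp_all)
    show "gm_add f g \<in> A" if "f \<in> A" "g \<in> A" for f g using that by (rule gm_add_interpolating)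
    show "0 \<in> A" by (rule zero_interpolating)
    show "gm_add (gm_add f g) h = gm_add f (gm_add g h)" for f g h :: "'a fps"
      by (simp add: gm_add_def algebra_simps)
    show "gm_add f g = gm_add g f" for f g :: "'a fps" by (simp add: gm_add_def algebra_simps)
    show "gm_add 0 f = f" for f :: "'a fps" by (simp add: gm_add_def)
    show "\<exists>g\<in>A. gm_add g f = 0" if "f \<in> A" for f using gm_inverse_interpolating[OF that] by blast
  qed
  show "module_axioms Zp (A_module K F \<pi> u)"
  proof (rule module_axioms.intro, unfold A_module_def, simp_all add: ring_of_integers_def)
    fix a b :: 'a and f g :: "'a fps"
    assume a: "a \<in> Qp \<and> vabs a \<le> 1" and f: "f \<in> A"
    note f' = interpolatingD[OF f]
    have a': "a \<in> Qp" "vabs a \<le> 1" using a by auto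
    obtain s where s: "(\<lambda>j. of_nat (s j)) \<longlonglongrightarrow> a" using Zp_limit[OF a'] .
    note lim = fconv_gm_smult[OF a' f'(4) s]
    have lim1: "fconv (\<lambda>j. (1 + f) ^ s j) (1 + gm_smult a f)"
      using fconv_add[OF fconv_const lim, of 1] by simp
    show "gm_smult a f \<in> A" by (rule gm_smult_interpolating[OF f a'])
    {
      assume b: "b \<in> Qp \<and> vabs b \<le> 1"
      then have b': "b \<in> Qp" "vabs b \<le> 1" by auto
      obtain t where t: "(\<lambda>j. of_nat (t j)) \<longlonglongrightarrow> b" using Zp_limit[OF b'] .
      have lim2: "fconv (\<lambda>j. (1 + f) ^ t j) (1 + gm_smult b f)"
        using fconv_add[OF fconv_const fconv_gm_smult[OF b' f'(4) t], of 1] by simp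
      have st: "(\<lambda>j. of_nat (s j + t j)) \<longlonglongrightarrow> a + b" using tendsto_add[OF s t] by simp
      have "fconv (\<lambda>j. (1 + f) ^ s j * (1 + f) ^ t j) (1 + gm_smult (a + b) f)"
        using fconv_add[OF fconv_const fconv_gm_smult[OF Zp_arith(1,2)[OF a' b'] f'(4) st], of 1]
        by (simp add: power_add)
      moreover have "fconv (\<lambda>j. (1 + f) ^ s j * (1 + f) ^ t j) ((1 + gm_smult a f) * (1 + gm_smult b f))"
        by (rule fconv_mult[OF lim1 lim2])
      ultimately have "1 + gm_smult (a + b) f = (1 + gm_smult a f) * (1 + gm_smult b f)" by (rule fconv_unique)
      then have "1 + gm_smult (a + b) f = 1 + gm_add (gm_smult a f) (gm_smult b f)" by (simp add: one_plus_gm_add)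
      then show "gm_smult (a + b) f = gm_add (gm_smult a f) (gm_smult b f)" by simp
      have bf: "fdisc (gm_smult b f)" by (rule interpolatingD(4)[OF gm_smult_interpolating[OF f b']])
      have "fconv (\<lambda>j. (1 + gm_smult b f) ^ s j) (1 + gm_smult a (gm_smult b f))"
        using fconv_add[OF fconv_const fconv_gm_smult[OF a' bf s], of 1] by simp
      \<comment> \<open>Here the limit is taken in the exponent: (1 + [b](f))^(s_j) is 1 +
        [b s_j](f), and the binomial series depends continuously on its exponent.\<close>
      moreover have "fconv (\<lambda>j. (1 + gm_smult b f) ^ s j) (1 + gm_smult (a * b) f)"
      proof -
        have bs: "b * of_nat (s j) \<in> Qp" "vabs (b * of_nat (s j)) \<le> 1" for j
          using Zp_arith[OF b' of_nat_in_Qp] by auto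
        have "(\<lambda>j. b * of_nat (s j)) \<longlonglongrightarrow> b * a" by (intro tendsto_mult_left s)
        then have "fconv (\<lambda>j. fps_binomial (b * of_nat (s j))) (fps_binomial (b * a))"
          unfolding fconv_def using tendsto_gbinomial by auto
        then have "fconv (\<lambda>j. fps_subst (fps_binomial (b * of_nat (s j))) f) (fps_subst (fps_binomial (b * a)) f)"
          by (intro fconv_subst[where B = 1] fbd_binomial bs f')
        moreover have "fps_subst (fps_binomial (b * of_nat (s j))) f = (1 + gm_smult b f) ^ s j" for j
          using gm_smult_eq[OF bs f'(4)] one_plus_gm_smult_power[OF f b', of "s j"] by simp
        moreover have "fps_subst (fps_binomial (b * a)) f = 1 + gm_smult (a * b) f"
          using gm_smult_eq[OF Zp_arith(3,4)[OF a' b'] f'(4)] by (simp add: mult.commute)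
        ultimately show ?thesis by simp
      qed
      ultimately have "1 + gm_smult a (gm_smult b f) = 1 + gm_smult (a * b) f" by (rule fconv_unique)
      then show "gm_smult (a * b) f = gm_smult a (gm_smult b f)" by simp
    }
    {
      assume g: "g \<in> A"
      note g' = interpolatingD[OF g]
      have lim2: "fconv (\<lambda>j. (1 + g) ^ s j) (1 + gm_smult a g)"
        using fconv_add[OF fconv_const fconv_gm_smult[OF a' g'(4) s], of 1] by simp
      have fg: "fdisc (gm_add f g)" by (rule interpolatingD(4)[OF gm_add_interpolating[OF f g]])
      have "fconv (\<lambda>j. (1 + f) ^ s j * (1 + g) ^ s j) (1 + gm_smult a (gm_add f g))"
        using fconv_add[OF fconv_const fconv_gm_smult[OF a' fg s], of 1]
        by (simp add: one_plus_gm_add power_mult_distrib)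
      then have "1 + gm_smult a (gm_add f g) = 1 + gm_add (gm_smult a f) (gm_smult a g)"
        unfolding one_plus_gm_add using fconv_mult[OF lim1 lim2] by (rule fconv_unique)
      then show "gm_smult a (gm_add f g) = gm_add (gm_smult a f) (gm_smult a g)" by simp
    }
  next
    fix f assume f: "f \<in> A"
    show "gm_smult 1 f = f" using gm_smult_of_nat[OF interpolatingD(4)[OF f], of 1] by simp
  qed
qed

text \<open>Turns divisibility by p into a Gauss bound, since p can be divided out over the field
  K.\<close>

lemma p_int_fps_iff: "g \<in> p_int_fps p K \<longleftrightarrow> g \<in> fps_over K \<and> fbd (1 / real p) g"
proof
  assume "g \<in> p_int_fps p K"
  then obtain h where h: "g = fps_const (of_nat p) * h" "h \<in> int_fps K" by (auto simp: p_int_fps_def)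
  then have "h \<in> fps_over K" "fbd 1 h" by (auto simp: int_fps_iff)
  moreover have "fbd (1 / real p) (fps_const (of_nat p) :: 'a fps)" by (simp add: fbd_const vabs_p)
  ultimately show "g \<in> fps_over K \<and> fbd (1 / real p) g"
    unfolding h(1) by (intro conjI K.fps_over_intros K.of_nat fbd_mult_1')
next
  assume g: "g \<in> fps_over K \<and> fbd (1 / real p) g"
  have p0: "(of_nat p :: 'a) \<noteq> 0" using p_gt_1 by simp
  let ?h = "fps_const (1 / of_nat p) * g"
  have "vabs (fps_nth ?h n) \<le> 1" for n
  proof -
    have "vabs (fps_nth ?h n) = real p * vabs (fps_nth g n)" by (simp add: vabs_mult vabs_divide vabs_p)
    also have "\<dots> \<le> real p * (1 / real p)" using g by (intro mult_left_mono) (auto simp: fbd_def)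
    finally show ?thesis using p_gt_1 by simp
  qed
  then have "?h \<in> int_fps K" unfolding int_fps_iff using g
    by (auto intro!: K.fps_over_intros K.divide K.one K.of_nat simp: fbd_def)
  moreover have "g = fps_const (of_nat p) * ?h"
    using p0 by (simp add: mult.assoc[symmetric])
  ultimately show "g \<in> p_int_fps p K" unfolding p_int_fps_def by blast
qed

definition translate_sum :: "'a fps \<Rightarrow> 'a fps" where
  "translate_sum g = (\<Sum>z\<in>F0. fps_subst g (trans z))"

text \<open>The linear coefficient \<pi> is nonzero, so [\<pi>] has a compositional inverse over the
  field. This makes the description in \<open>coleman_trace\<close> unique and lets the substitution
  be undone.\<close>

lemma coleman_trace_eq_0_iff: "coleman_trace K F \<pi> g = 0 \<longleftrightarrow> translate_sum g = 0"
proof -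
  have e1: "fps_nth e 1 \<noteq> 0" using e_props(2) pi_nonzero by simp
  have inv: "fps_compose (fps_inv e) e = fps_X" by (rule fps_inv[OF e_0 e1])
  have inv': "fps_compose e (fps_inv e) = fps_X" by (rule fps_inv_right[OF e_0 e1])
  have i0: "fps_nth (fps_inv e) 0 = 0" by (simp add: fps_inv_def)
  let ?h = "fps_compose (translate_sum g) (fps_inv e)"
  have "coleman_trace K F \<pi> g = ?h"
    unfolding coleman_trace_def fgl_endo_pi translate_sum_def[symmetric]
  proof (rule the_equality)
    show "fps_compose ?h e = translate_sum g"
      using fps_compose_assoc[OF e_0 i0, of "translate_sum g"] inv by simp
    fix h assume "fps_compose h e = translate_sum g"
    then show "h = ?h" using fps_compose_assoc[OF i0 e_0, of h] inv' by simp
  qed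
  moreover have "?h = 0 \<longleftrightarrow> translate_sum g = 0"
  proof
    assume "?h = 0"
    then have "fps_compose (fps_compose (translate_sum g) (fps_inv e)) e = 0" by simp
    then show "translate_sum g = 0" using fps_compose_assoc[OF e_0 i0, of "translate_sum g"] inv by simp
  qed simp
  ultimately show ?thesis by simp
qed

lemma translate_sum_add: "fbd B g \<Longrightarrow> fbd B h \<Longrightarrow> translate_sum (g + h) = translate_sum g + translate_sum h"
  unfolding translate_sum_def sum.distrib[symmetric] by (intro sum.cong refl fps_subst_add F0_disc)

lemma translate_sum_const_mult: "fbd B g \<Longrightarrow> translate_sum (fps_const c * g) = fps_const c * translate_sum g"
  unfolding translate_sum_def sum_distrib_left by (intro sum.cong refl fps_subst_const_mult F0_disc)

lemma M_carrier_iff: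
  "g \<in> {g \<in> p_int_fps p K. coleman_trace K F \<pi> g = 0} \<longleftrightarrow> g \<in> fps_over K \<and> fbd (1 / real p) g \<and> translate_sum g = 0"
  by (simp add: p_int_fps_iff coleman_trace_eq_0_iff)

lemma M_module: "module Zp (M_module p K F \<pi>)"
proof -
  let ?M = "{g \<in> p_int_fps p K. coleman_trace K F \<pi> g = 0}"
  have add: "g + h \<in> ?M" if "g \<in> ?M" "h \<in> ?M" for g h
    using that unfolding M_carrier_iff by (auto intro: K.fps_over_intros fbd_add simp: translate_sum_add)
  have zero: "0 \<in> ?M" unfolding M_carrier_iff by (simp add: K.fps_over_intros translate_sum_def)
  have smult: "fps_const a * g \<in> ?M" if "a \<in> Qp" "vabs a \<le> 1" "g \<in> ?M" for a g
    using that Qp_subset unfolding M_carrier_iff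
    by (auto intro!: K.fps_over_intros fbd_mult_1 simp: translate_sum_const_mult fbd_const)
  have minus: "- g \<in> ?M" if "g \<in> ?M" for g
    using smult[OF _ _ that, of "- 1"] closed_subfield.uminus[OF closed_subfield_Qp closed_subfield.one[OF closed_subfield_Qp]]
    by (simp flip: fps_const_neg)
  show ?thesis
  proof (rule module.intro)
    show "cring (Zp :: 'a ring)" by (rule Zp_cring)
    show "abelian_group (M_module p K F \<pi>)"
    proof (rule abelian_groupI, unfold M_module_def partial_object.simps ring.simps monoid.simps)
      show "\<exists>h\<in>?M. h + g = 0" if "g \<in> ?M" for g using minus[OF that] by (intro bexI[of _ "- g"]) auto
    qed (use add zero in \<open>auto simp: algebra_simps\<close>)
    show "module_axioms Zp (M_module p K F \<pi>)"
    proof (rule module_axioms.intro, unfold M_module_def partial_object.simps ring.simps monoid.simps module.simps)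
      show "fps_const a * g \<in> ?M" if "a \<in> carrier Zp" "g \<in> ?M" for a g
        using that by (intro smult) (auto simp: ring_of_integers_def)
    qed (auto simp: algebra_simps simp flip: fps_const_add fps_const_mult)
  qed
qed

section \<open>The map\<close>

abbreviation ph :: "'a fps \<Rightarrow> 'a fps" where "ph \<equiv> phi K F \<pi>"

text \<open>The second form is free of inverses; identities for \<phi> are checked in it and then
  cancelled by \<open>phi_eqI\<close>.\<close>

lemma one_plus_phi:
  assumes f: "f \<in> A"
  shows "1 + ph f = (1 + f) ^ q * inverse (fps_compose (1 + f) e)"
    "(1 + ph f) * fps_compose (1 + f) e = (1 + f) ^ q"
proof -
  note f' = interpolatingD[OF f]
  have comp: "fps_compose (1 + f) e = 1 + fps_compose f e" by (simp add: fps_compose_add_distrib)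
  show eq: "1 + ph f = (1 + f) ^ q * inverse (fps_compose (1 + f) e)"
    unfolding phi_def gm_minus_def fgl_endo_pi q_def[symmetric] comp gm_smult_of_nat[OF f'(4)] by simp
  have "fps_nth (fps_compose (1 + f) e) 0 \<noteq> 0" using f'(8) by auto
  then have "inverse (fps_compose (1 + f) e) * fps_compose (1 + f) e = 1" by (rule inverse_mult_eq_1)
  then show "(1 + ph f) * fps_compose (1 + f) e = (1 + f) ^ q"
    unfolding eq by (simp add: mult.assoc)
qed

lemma compose_e_nonzero: "f \<in> A \<Longrightarrow> fps_compose (1 + f) e \<noteq> 0"
proof
  assume f: "f \<in> A" and "fps_compose (1 + f) e = 0"
  then have "fps_nth (fps_compose (1 + f) e) 0 = 0" by simp
  then show False using interpolatingD(8)[OF f] by auto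
qed

lemma phi_eqI: "f \<in> A \<Longrightarrow> g * fps_compose (1 + f) e = (1 + f) ^ q \<Longrightarrow> 1 + ph f = g"
  using one_plus_phi(2)[of f] compose_e_nonzero[of f] by (metis mult_right_cancel)

text \<open>With c = (1 + f)([\<pi>](x)), a unit series, \<phi>(f) is ((1 + f)^q - c) / c, and the
  Frobenius congruence bounds the numerator.\<close>

lemma phi_small:
  assumes f: "f \<in> A"
  shows "fbd (vabs \<pi>) (ph f)" "ph f \<in> fps_over K" "fdisc (ph f)" "fbd 1 (1 + ph f)"
proof -
  note f' = interpolatingD[OF f]
  let ?c = "fps_compose (1 + f) e"
  have c0: "vabs (fps_nth ?c 0) = 1" using f'(8) by simp
  have cb: "fbd 1 ?c" using fps_subst_fbd[OF f'(7) fdisc_e] by (simp add: fps_subst_eq_compose[OF e_0])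
  have co: "?c \<in> fps_over K" using f'(6) by (intro K.fps_over_compose e_over) (simp add: int_fps_iff)
  have "?c * inverse ?c = 1" using c0 by (intro inverse_mult_eq_1') auto
  then have eq: "ph f = ((1 + f) ^ q - ?c) * inverse ?c"
    using one_plus_phi(1)[OF f] by (simp add: left_diff_distrib) (metis add_diff_cancel_left')
  show 1: "fbd (vabs \<pi>) (ph f)"
    unfolding eq by (intro fbd_mult_1' fbd_power_q_compose_e f' fbd_inverse cb c0)
  show "ph f \<in> fps_over K" unfolding eq
    by (intro K.fps_over_intros K.fps_over_power K.fps_over_inverse co f'(2))
  have 2: "fbd 1 (ph f)" using vabs_pi_less_1 by (intro fbd_mono[OF 1]) simp
  then show "fdisc (ph f)" using fbdD[OF 1, of 0] vabs_pi_less_1 by (simp add: fdisc_def)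
  show "fbd 1 (1 + ph f)" by (intro fbd_add 2) simp
qed

abbreviation r :: nat where "r \<equiv> min_r p K F \<pi> u"

definition phi_p_power :: "'a fps \<Rightarrow> 'a fps" where
  "phi_p_power f = (1 + ph f) ^ (p ^ r) - 1"

lemma gm_smult_phi: "f \<in> A \<Longrightarrow> gm_smult (of_nat (p ^ n)) (ph f) = (1 + ph f) ^ (p ^ n) - 1"
  by (rule gm_smult_of_nat[OF phi_small(3)])

text \<open>The exponent has to be uniform in f. Modulo p, (1 + \<phi>(f))^(p^n) is 1 +
  \<phi>(f)^(p^n), and \<phi>(f) is divisible by \<pi>; so any n with |\<pi>|^(p^n) \<le> 1/p serves
  every f.\<close>

lemma r_exists: "\<exists>r>0. \<forall>f\<in>A. gm_smult (of_nat (p ^ r)) (ph f) \<in> p_int_fps p K"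
proof -
  have "(\<lambda>n. vabs \<pi> ^ n) \<longlonglongrightarrow> 0" using vabs_pi_less_1 by (intro LIMSEQ_realpow_zero) auto
  then have "\<forall>\<^sub>F n in sequentially. vabs \<pi> ^ n < 1 / real p" using p_gt_1 by (intro order_tendstoD(2)) auto
  then obtain N where N: "\<And>n. n \<ge> N \<Longrightarrow> vabs \<pi> ^ n < 1 / real p" by (auto simp: eventually_sequentially)
  have "N < 2 ^ N" by (rule less_exp)
  also have "(2::nat) ^ N \<le> p ^ N" using p_gt_1 by (intro power_mono) auto
  also have "p ^ N \<le> p ^ Suc N" using p_gt_1 by (intro power_increasing) auto
  finally have small: "vabs \<pi> ^ (p ^ Suc N) \<le> 1 / real p" using N[of "p ^ Suc N"] by simp
  have "gm_smult (of_nat (p ^ Suc N)) (ph f) \<in> p_int_fps p K" if f: "f \<in> A" for f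
  proof -
    note ph = phi_small[OF f]
    let ?n = "p ^ Suc N"
    have pow: "fbd (vabs \<pi> ^ n) (ph f ^ n)" for n
    proof (induction n)
      case (Suc n)
      then show ?case unfolding power_Suc by (rule fbd_mult[OF ph(1)])
    qed simp
    have "fbd (1 / real p) ((ph f + 1) ^ ?n - (ph f ^ ?n + 1 ^ ?n))"
      by (rule fbd_add_power_p_power[OF fdisc_fbd[OF ph(3)] fbd_1[OF order_refl]])
    then have "fbd (1 / real p) (((ph f + 1) ^ ?n - (ph f ^ ?n + 1 ^ ?n)) + ph f ^ ?n)"
      by (intro fbd_add fbd_mono[OF pow small])
    moreover have "((ph f + 1) ^ ?n - (ph f ^ ?n + 1 ^ ?n)) + ph f ^ ?n = (1 + ph f) ^ ?n - 1"
      by (simp add: add.commute)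
    ultimately have "fbd (1 / real p) ((1 + ph f) ^ ?n - 1)" by (simp only:)
    moreover have "(1 + ph f) ^ ?n - 1 \<in> fps_over K"
      by (intro K.fps_over_intros K.fps_over_power ph(2))
    ultimately show ?thesis unfolding gm_smult_phi[OF f] p_int_fps_iff by blast
  qed
  then show ?thesis by blast
qed

lemma phi_p_power_props:
  assumes f: "f \<in> A"
  shows "gm_smult (of_nat (p ^ r)) (ph f) = phi_p_power f" "phi_p_power f \<in> fps_over K" "fbd (1 / real p) (phi_p_power f)"
    "1 + phi_p_power f = (1 + ph f) ^ (p ^ r)"
proof -
  show eq: "gm_smult (of_nat (p ^ r)) (ph f) = phi_p_power f" unfolding phi_p_power_def by (rule gm_smult_phi[OF f])
  have "\<forall>f\<in>A. gm_smult (of_nat (p ^ r)) (ph f) \<in> p_int_fps p K"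
    unfolding min_r_def using LeastI_ex[OF r_exists] by blast
  then have "phi_p_power f \<in> p_int_fps p K" using f eq by force
  then show "phi_p_power f \<in> fps_over K" "fbd (1 / real p) (phi_p_power f)" by (auto simp: p_int_fps_iff)
  show "1 + phi_p_power f = (1 + ph f) ^ (p ^ r)" by (simp add: phi_p_power_def)
qed

definition log_map :: "'a fps \<Rightarrow> 'a fps" where
  "log_map f = gm_log (phi_p_power f)"

section \<open>The image lies in the kernel of the trace\<close>

lemma translate_prod_power: "fbd 1 g \<Longrightarrow> translate_prod (g ^ n) = translate_prod g ^ n"
  by (induction n) (auto simp: translate_prod_mult fbd_power)

lemma translate_prod_compose_e:
  assumes g: "fbd 1 g"
  shows "translate_prod (fps_compose g e) = fps_compose g e ^ q"
proof -
  have "fps_subst (fps_compose g e) (trans z) = fps_compose g e" if z: "z \<in> F0" for z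
    using fps_subst_assoc[OF g fdisc_e F0_disc[OF z]] e_translate_torsion[OF z]
    by (simp add: fps_subst_eq_compose[OF e_0])
  then show ?thesis by (simp add: translate_prod_def card_F0)
qed

text \<open>With c = (1 + f)([\<pi>](x)), the translates of (1 + f)^q multiply to c^q by the
  functional equation, and those of c also to c^q, because each of the q translations fixes
  c.\<close>

lemma translate_prod_one_plus_phi:
  assumes f: "f \<in> A"
  shows "translate_prod (1 + ph f) = 1"
proof -
  note f' = interpolatingD[OF f]
  let ?c = "fps_compose (1 + f) e"
  have cb: "fbd 1 ?c" using fps_subst_fbd[OF f'(7) fdisc_e] by (simp add: fps_subst_eq_compose[OF e_0])
  have "translate_prod (1 + ph f) * translate_prod ?c = translate_prod ((1 + f) ^ q)"
    unfolding one_plus_phi(2)[OF f, symmetric] by (rule translate_prod_mult[OF phi_small(4)[OF f] cb, symmetric])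
  then have "translate_prod (1 + ph f) * ?c ^ q = 1 * ?c ^ q"
    by (simp only: translate_prod_compose_e[OF f'(7)] translate_prod_power[OF f'(7)] f'(5) mult_1)
  moreover have "?c ^ q \<noteq> 0" using compose_e_nonzero[OF f] by (rule power_not_zero)
  ultimately show ?thesis by (metis mult_right_cancel)
qed

lemma log_map_in_M:
  assumes f: "f \<in> A"
  shows "log_map f \<in> {g \<in> p_int_fps p K. coleman_trace K F \<pi> g = 0}"
  unfolding M_carrier_iff
proof (intro conjI)
  note P = phi_p_power_props[OF f]
  show "log_map f \<in> fps_over K" "fbd (1 / real p) (log_map f)" unfolding log_map_def
    by (intro fps_over_gm_log fbd_gm_log P)+
  have P1: "fbd 1 (phi_p_power f)" using p_gt_1 by (intro fbd_mono[OF P(3)]) simp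
  have sub: "1 + fps_subst (phi_p_power f) (trans z) = fps_subst (1 + phi_p_power f) (trans z)" if z: "z \<in> F0" for z
    using fps_subst_add[OF _ P1 F0_disc[OF z], of 1 1] by simp
  have "(\<Prod>z\<in>F0. 1 + fps_subst (phi_p_power f) (trans z)) = translate_prod (1 + phi_p_power f)"
    unfolding translate_prod_def by (intro prod.cong refl sub)
  also have "\<dots> = 1" unfolding P(4) by (simp add: translate_prod_power[OF phi_small(4)[OF f]] translate_prod_one_plus_phi[OF f])
  finally have one: "(\<Prod>z\<in>F0. 1 + fps_subst (phi_p_power f) (trans z)) = 1" .
  have "translate_sum (log_map f) = (\<Sum>z\<in>F0. gm_log (fps_subst (phi_p_power f) (trans z)))"
    unfolding translate_sum_def log_map_def by (intro sum.cong refl gm_log_subst P F0_disc)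
  also have "\<dots> = gm_log ((\<Prod>z\<in>F0. 1 + fps_subst (phi_p_power f) (trans z)) - 1)"
    using gm_log_prod[OF finite_F0, of "\<lambda>z. fps_subst (phi_p_power f) (trans z)"] fps_subst_fbd[OF P(3) F0_disc] by simp
  finally show "translate_sum (log_map f) = 0" by (simp add: one)
qed

section \<open>Linearity over Z_p\<close>

lemma log_map_gm_add:
  assumes f: "f \<in> A" and g: "g \<in> A"
  shows "log_map (gm_add f g) = log_map f + log_map g"
proof -
  have "1 + ph (gm_add f g) = (1 + ph f) * (1 + ph g)"
  proof (rule phi_eqI[OF gm_add_interpolating[OF f g]])
    have "(1 + ph f) * (1 + ph g) * fps_compose (1 + gm_add f g) e =
       ((1 + ph f) * fps_compose (1 + f) e) * ((1 + ph g) * fps_compose (1 + g) e)"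
      unfolding one_plus_gm_add fps_compose_mult_distrib[OF e_0] by (simp only: mult_ac)
    also have "\<dots> = (1 + gm_add f g) ^ q"
      unfolding one_plus_phi(2)[OF f] one_plus_phi(2)[OF g] one_plus_gm_add by (simp add: power_mult_distrib)
    finally show "(1 + ph f) * (1 + ph g) * fps_compose (1 + gm_add f g) e = (1 + gm_add f g) ^ q" .
  qed
  then have "1 + phi_p_power (gm_add f g) = 1 + gm_add (phi_p_power f) (phi_p_power g)"
    unfolding one_plus_gm_add phi_p_power_props(4)[OF f] phi_p_power_props(4)[OF g]
      phi_p_power_props(4)[OF gm_add_interpolating[OF f g]] by (simp add: power_mult_distrib)
  then show ?thesis unfolding log_map_def
    using gm_log_gm_add[OF phi_p_power_props(3)[OF f] phi_p_power_props(3)[OF g]] by simp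
qed

lemma phi_of_power:
  assumes f: "f \<in> A"
  shows "1 + ph ((1 + f) ^ n - 1) = (1 + ph f) ^ n"
proof (rule phi_eqI[OF power_interpolating[OF f]])
  have "(1 + ph f) ^ n * fps_compose (1 + ((1 + f) ^ n - 1)) e = ((1 + ph f) * fps_compose (1 + f) e) ^ n"
    by (simp add: fps_compose_power[OF e_0] power_mult_distrib)
  then show "(1 + ph f) ^ n * fps_compose (1 + ((1 + f) ^ n - 1)) e = (1 + ((1 + f) ^ n - 1)) ^ q"
    unfolding one_plus_phi(2)[OF f] by (simp add: power_mult[symmetric] mult.commute)
qed

lemma log_map_power:
  assumes f: "f \<in> A"
  shows "log_map ((1 + f) ^ n - 1) = of_nat n * log_map f"
proof -
  have "phi_p_power ((1 + f) ^ n - 1) = (1 + phi_p_power f) ^ n - 1"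
    unfolding phi_p_power_def[of "(1 + f) ^ n - 1"] phi_of_power[OF f] phi_p_power_props(4)[OF f]
    by (simp add: power_mult[symmetric] mult.commute)
  then show ?thesis unfolding log_map_def using gm_log_power[OF phi_p_power_props(3)[OF f]] by simp
qed

lemma log_map_gm_smult:
  assumes f: "f \<in> A" and a: "a \<in> (Qp :: 'a set)" "vabs a \<le> 1"
  shows "log_map (gm_smult a f) = fps_const a * log_map f"
proof -
  obtain s where s: "(\<lambda>j. of_nat (s j)) \<longlonglongrightarrow> a" using Zp_limit[OF a] .
  let ?g = "\<lambda>j. (1 + f) ^ s j - 1"
  note gA = power_interpolating[OF f] and aA = gm_smult_interpolating[OF f a]
  have lim: "fconv ?g (gm_smult a f)" by (rule fconv_gm_smult[OF a interpolatingD(4)[OF f] s])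
  have lim1: "fconv (\<lambda>j. 1 + ?g j) (1 + gm_smult a f)" by (intro fconv_add fconv_const lim)
  have "fconv (\<lambda>j. 1 + ((1 + ph f) ^ s j - 1)) (1 + gm_smult a (ph f))"
    by (intro fconv_add fconv_const fconv_gm_smult[OF a phi_small(3)[OF f] s])
  then have limph: "fconv (\<lambda>j. 1 + ph (?g j)) (1 + gm_smult a (ph f))" by (simp add: phi_of_power[OF f])
  \<comment> \<open>Passing to the limit in the form free of inverses shows that \<phi> commutes
    with [a].\<close>
  have "fconv (\<lambda>j. (1 + ph (?g j)) * fps_compose (1 + ?g j) e) ((1 + gm_smult a (ph f)) * fps_compose (1 + gm_smult a f) e)"
    by (intro fconv_mult limph fconv_compose lim1)
  moreover have "fconv (\<lambda>j. (1 + ph (?g j)) * fps_compose (1 + ?g j) e) ((1 + gm_smult a f) ^ q)"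
    unfolding one_plus_phi(2)[OF gA] by (intro fconv_power lim1)
  ultimately have "(1 + gm_smult a (ph f)) * fps_compose (1 + gm_smult a f) e = (1 + gm_smult a f) ^ q"
    by (rule fconv_unique)
  then have eq: "1 + ph (gm_smult a f) = 1 + gm_smult a (ph f)" by (rule phi_eqI[OF aA])
  have "fconv (\<lambda>j. phi_p_power (?g j)) (phi_p_power (gm_smult a f))"
    unfolding phi_p_power_def eq by (intro fconv_diff fconv_power fconv_const limph)
  then have "fconv (\<lambda>j. log_map (?g j)) (log_map (gm_smult a f))"
    unfolding log_map_def by (intro fconv_gm_log phi_p_power_props(3)[OF gA])
  moreover have "fconv (\<lambda>j. log_map (?g j)) (fps_const a * log_map f)"
  proof -
    have "fconv (\<lambda>j. fps_const (of_nat (s j))) (fps_const a)"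
      unfolding fconv_def
    proof
      show "(\<lambda>j. fps_nth (fps_const (of_nat (s j))) n) \<longlonglongrightarrow> fps_nth (fps_const a) n" for n
        using s by (cases "n = 0") auto
    qed
    then have "fconv (\<lambda>j. fps_const (of_nat (s j)) * log_map f) (fps_const a * log_map f)" by (intro fconv_mult fconv_const)
    then show ?thesis by (simp only: log_map_power[OF f] fps_of_nat)
  qed
  ultimately show ?thesis by (rule fconv_unique)
qed

section \<open>Injectivity\<close>

lemma vabs_q_less_1: "vabs (of_nat q :: 'a) < 1"
proof -
  obtain k where k: "q = p ^ k" using q_prime_power by blast
  then have "k \<noteq> 0" using q_ge_2 by (intro notI) simp
  then have "p dvd q" using k by simp
  then have "vabs (of_int (int q) :: 'a) \<le> (1 / real p) ^ 1" by (intro vabs_of_int_dvd) simp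
  moreover have "1 / real p < 1" using p_gt_1 by simp
  ultimately show ?thesis by simp
qed

text \<open>For a constant the functional equation reads (1 + c)^q = 1 + c, so if c \<noteq> 0 the
  sum of (1 + c)^i over i < q equals 1. Each summand is congruent to 1, so the sum is congruent to
  q, which has absolute value below 1.\<close>

lemma constant_interpolating:
  assumes "fps_const c \<in> A"
  shows "c = 0"
proof (rule ccontr)
  assume c0: "c \<noteq> 0"
  note c' = interpolatingD[OF assms]
  have c: "vabs c < 1" using c'(4) by simp
  have one: "1 + fps_const c = fps_const (1 + c)" by (simp flip: fps_const_1_eq_1)
  have "fps_const ((1 + c) ^ q) = fps_const (1 + c)"
    using c'(5) unfolding one translate_prod_def by (simp add: card_F0 fps_const_power)
  then have "(1 + c) ^ q = 1 + c" by (metis fps_nth_fps_const)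
  then have "c = c * (\<Sum>i<q. (1 + c) ^ i)" using power_diff_1_eq[of "1 + c" q] by simp
  then have "(\<Sum>i<q. (1 + c) ^ i) = 1" using c0 by simp
  moreover have "(\<Sum>i<q. (1 + c) ^ i) = (\<Sum>i<q. (1 + c) ^ i - 1) + of_nat q" by (simp add: sum_subtractf)
  moreover have "vabs (\<Sum>i<q. (1 + c) ^ i - 1) < 1"
    using c vabs_power_minus_1_le[of c] by (intro vabs_sum_less) (auto intro: le_less_trans)
  ultimately have "vabs (1 :: 'a) < 1" using vabs_add_less[OF _ vabs_q_less_1] by metis
  then show False by simp
qed

lemma log_map_eq_0_imp:
  assumes f: "f \<in> A" and H0: "log_map f = 0" and q: "\<forall>n::int. of_nat q \<noteq> \<pi> powi n"
  shows "f = 0"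
proof -
  note f' = interpolatingD[OF f]
  have "fps_deriv (phi_p_power f) = 0" using gm_log_deriv[OF phi_p_power_props(3)[OF f]] H0 by (simp add: log_map_def)
  moreover have "fps_deriv (phi_p_power f) = of_nat (p ^ r) * fps_deriv (ph f) * (1 + ph f) ^ (p ^ r - 1)"
    by (simp add: phi_p_power_def fps_deriv_power')
  moreover have "1 + ph f \<noteq> 0"
  proof
    assume "1 + ph f = 0"
    then have "(1 + f) ^ q = 0" using one_plus_phi(2)[OF f] by simp
    then have "1 + f = 0" by simp
    then have "1 + fps_nth f 0 = 0" by (metis fps_add_nth fps_one_nth fps_zero_nth)
    then show False using f'(8) by simp
  qed
  moreover have "(of_nat (p ^ r) :: 'a fps) \<noteq> 0" using p_gt_1 by simp
  ultimately have "fps_deriv (ph f) = 0" by (metis mult_eq_0_iff power_not_zero)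
  \<comment> \<open>A zero logarithm does not give \<phi>(f) = 0 at once, since the logarithm can
    also vanish at roots of unity; constancy is what the derivative yields and it suffices.\<close>
  then obtain c where c: "ph f = fps_const c" by (auto simp: fps_deriv_eq_0_iff)
  have key: "fps_const (1 + c) * fps_compose (1 + f) e = (1 + f) ^ q"
    using one_plus_phi(2)[OF f] by (simp add: c flip: fps_const_1_eq_1)
  define y where "y = 1 + fps_nth f 0"
  have y0: "y \<noteq> 0" using f'(8) by (auto simp: y_def)
  have yc: "(1 + c) * y = y ^ q" using arg_cong[OF key, of "\<lambda>g. fps_nth g 0"] by (simp add: y_def fps_power_zeroth)
  have yq: "y ^ q = y * y ^ (q - 1)" using q_ge_2 by (metis power_eq_if not_numeral_le_zero)
  \<comment> \<open>The constant terms of \<open>key\<close> determine the unknown constant; this is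
    the unit that cancels from the comparison below.\<close>
  have c_eq: "1 + c = y ^ (q - 1)" using yc y0 unfolding yq by simp
  have "fps_deriv f = 0"
  proof (rule ccontr)
    assume nz: "fps_deriv f \<noteq> 0"
    define m where "m = subdegree (fps_deriv f)"
    let ?d = "fps_nth (fps_deriv f) m"
    have d: "?d \<noteq> 0" unfolding m_def by (rule nth_subdegree_nonzero[OF nz])
    obtain g where g: "fps_deriv f = fps_X ^ m * g" "fps_nth g 0 = ?d"
    proof
      show "fps_deriv f = fps_X ^ m * fps_shift m (fps_deriv f)"
        unfolding m_def by (metis mult.commute subdegree_decompose)
    qed simp
    \<comment> \<open>Writing [\<pi>](x) = x s with s(0) = \<pi>, the lowest power x^m of the
      derivative of f turns into x^m s^m under the substitution, which is where \<pi>^m comes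
      from.\<close>
    have e': "e = fps_X * fps_shift 1 e" using e_0 by (auto simp: fps_eq_iff)
    define s where "s = fps_shift 1 e"
    have s0: "fps_nth s 0 = \<pi>" using e_props(2) by (simp add: s_def)
    have "fps_deriv (fps_const (1 + c) * fps_compose (1 + f) e) = fps_deriv ((1 + f) ^ q)" by (simp only: key)
    then have "fps_const (1 + c) * (fps_compose (fps_deriv f) e * fps_deriv e) =
        of_nat q * fps_deriv f * (1 + f) ^ (q - 1)"
      using fps_compose_deriv[OF e_0, of "1 + f"] by (simp add: fps_deriv_power')
    moreover have "fps_compose (fps_deriv f) e = fps_X ^ m * (s ^ m * fps_compose g e)"
    proof -
      have "fps_compose (fps_deriv f) e = e ^ m * fps_compose g e"
        unfolding g(1) fps_compose_mult_distrib[OF e_0] fps_compose_power[OF e_0, symmetric]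
        by (simp add: e_0)
      also have "e ^ m = fps_X ^ m * s ^ m" using e' by (metis power_mult_distrib s_def)
      finally show ?thesis by (simp add: mult.assoc)
    qed
    ultimately have "fps_X ^ m * (fps_const (1 + c) * (s ^ m * fps_compose g e * fps_deriv e)) =
        fps_X ^ m * (of_nat q * g * (1 + f) ^ (q - 1))"
      unfolding g(1) by (simp only: mult_ac)
    then have "fps_const (1 + c) * (s ^ m * fps_compose g e * fps_deriv e) = of_nat q * g * (1 + f) ^ (q - 1)"
      by simp
    \<comment> \<open>After cancelling x^m the constant terms remain; the extra factor \<pi> is the
      constant term of the derivative of [\<pi>], given by the chain rule.\<close>
    from arg_cong[OF this, of "\<lambda>g. fps_nth g 0"]
    have "(1 + c) * (\<pi> ^ m * ?d * \<pi>) = of_nat q * ?d * y ^ (q - 1)"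
      using e_props(2) by (simp add: s0 g(2) fps_power_zeroth y_def)
    then have "(?d * y ^ (q - 1)) * (\<pi> ^ m * \<pi>) = (?d * y ^ (q - 1)) * of_nat q"
      unfolding c_eq by (simp only: mult_ac)
    moreover have "?d * y ^ (q - 1) \<noteq> 0" using d y0 by (metis mult_eq_0_iff power_not_zero)
    ultimately have "of_nat q = \<pi> ^ m * \<pi>" by (metis mult_left_cancel)
    then have "of_nat q = \<pi> powi int (Suc m)" unfolding power_int_of_nat power_Suc by (simp only: mult.commute)
    then show False using q by blast
  qed
  then obtain k where "f = fps_const k" by (auto simp: fps_deriv_eq_0_iff)
  then show ?thesis using constant_interpolating f by simp
qed

text \<open>An additive map with trivial kernel; the difference in the group law of G_m is formed
  with the inverse of 1 + g.\<close>

lemma log_map_inj: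
  assumes q: "\<forall>n::int. of_nat q \<noteq> \<pi> powi n"
  shows "inj_on log_map A"
proof (rule inj_onI)
  fix f g assume fg: "f \<in> A" "g \<in> A" "log_map f = log_map g"
  let ?g' = "inverse (1 + g) - 1"
  note g' = gm_inverse_interpolating[OF fg(2)]
  let ?k = "gm_add f ?g'"
  have k: "?k \<in> A" by (rule gm_add_interpolating[OF fg(1) g'(1)])
  have assoc: "gm_add ?k g = f"
  proof -
    have "gm_add ?k g = gm_add f (gm_add ?g' g)" by (simp add: gm_add_def algebra_simps)
    then show ?thesis unfolding g'(2) by (simp add: gm_add_def)
  qed
  have "log_map f = log_map ?k + log_map g" using log_map_gm_add[OF k fg(2)] unfolding assoc .
  then have "log_map ?k = 0" using fg(3) by simp
  then have "?k = 0" by (rule log_map_eq_0_imp[OF k _ q])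
  then show "f = g" using assoc by (simp add: gm_add_def)
qed

lemma module_injection_log_map:
  assumes q: "\<forall>n::int. of_nat q \<noteq> \<pi> powi n"
  shows "module_injection Zp (A_module K F \<pi> u) (M_module p K F \<pi>)
    (\<lambda>f. gm_log (gm_smult (of_nat (p ^ r)) (ph f)))"
proof -
  let ?h = "\<lambda>f. gm_log (gm_smult (of_nat (p ^ r)) (ph f))"
  have h: "?h f = log_map f" if "f \<in> A" for f using phi_p_power_props(1)[OF that] by (simp add: log_map_def)
  have "?h \<in> A \<rightarrow> {g \<in> p_int_fps p K. coleman_trace K F \<pi> g = 0}"
    using log_map_in_M h by (auto simp del: mem_Collect_eq)
  moreover have "inj_on ?h A" using log_map_inj[OF q] h by (simp cong: inj_on_cong)
  moreover have "?h (gm_add f g) = ?h f + ?h g" if "f \<in> A" "g \<in> A" for f g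
    using log_map_gm_add[OF that] h that gm_add_interpolating[OF that] by simp
  moreover have "?h (gm_smult a f) = fps_const a * ?h f" if "a \<in> Qp" "vabs a \<le> 1" "f \<in> A" for a f
    using log_map_gm_smult[OF that(3,1,2)] h that(3) gm_smult_interpolating[OF that(3,1,2)] by simp
  ultimately show ?thesis
    unfolding module_injection_def using A_module M_module
    by (simp add: A_module_def M_module_def ring_of_integers_def)
qed

end

theorem theorem3p3p1:
  fixes p q r :: nat
    and K :: "'a::{nonarch_field, alg_closed_field, complete_space} set"
    and \<pi> :: 'a
    and F :: "'a fps fps"
    and u :: "nat \<Rightarrow> 'a"
  assumes "prime p" and "vabs (of_nat p :: 'a) = 1 / real p"
    and "finite_ext_Qp K"
    and "uniformizer K \<pi>"
    and "q = residue_field_size K"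
    and "lubin_tate_fgl K \<pi> F"
    and "u 0 \<in> torsion K F \<pi> 0" and "u 0 \<noteq> 0"
    and "\<And>n. vabs (u (Suc n)) < 1 \<and> fps_value (fgl_endo K F \<pi>) (u (Suc n)) = u n"
    and "r = min_r p K F \<pi> u"
    and "\<forall>n::int. of_nat q \<noteq> \<pi> powi n"
  shows "module_injection Zp (A_module K F \<pi> u) (M_module p K F \<pi>)
           (\<lambda>f. gm_log (gm_smult (of_nat (p ^ r)) (phi K F \<pi> f)))"
proof -
  interpret lubin_tate p K \<pi> F q
    using assms by unfold_locales
  interpret lubin_tate_tower p K \<pi> F q u
    using assms by unfold_locales (simp_all add: fgl_endo_pi)
  show ?thesis unfolding assms(10) by (rule module_injection_log_map[OF assms(11)])
qed

end
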